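(* Let $\xi$ belong to the sparse loading regime, that is, $\xi\in\Xi(q,\bar c)$ with $q\le Ck$ for a constant $C>0$. Suppose that $0<\alpha<\frac12$ and $k_1\le k\le c\min\{p^{\gamma},\frac{n}{\log p}\}$ for some constants $c>0$ and $0\le\gamma<\frac12$. Then $$L^*_\alpha\big(\Theta(k_1),\Theta(k),\xi^{\intercal}\beta\big)\ge c_1\,\|\xi\|_2\Big(\frac{1}{\sqrt n}+k\frac{\log p}{n}\Big)$$ for some constant $c_1>0$.
   Context: Model: one observes $Z=(Z_1,\dots,Z_n)$ with $Z_i=(y_i,X_{i\cdot})\in\mathbb{R}^{p+1}$, $y=X\beta+\epsilon$, where $X\in\mathbb{R}^{n\times p}$ has i.i.d. rows $X_{i\cdot}\sim N_p(0,\Sigma)$, independent of $\epsilon\sim N_n(0,\sigma^2\mathrm{I})$; $\Sigma$ and $\sigma$ are unknown. Let $\Omega=\Sigma^{-1}$ and $\theta=(\beta,\Omega,\sigma)$; $\mathbb{P}_\theta,\mathbb{E}_\theta$ are the corresponding probability and expectation. $\|x\|_0$ is the number of nonzero entries of $x$, $\mathrm{supp}(x)$ the set of their indices, $\|x\|_2$ the Euclidean norm. Parameter space: $\Theta(k)=\{(\beta,\Omega,\sigma):\|\beta\|_0\le k,\ \frac1{M_1}\le\lambda_{\min}(\Omega)\le\lambda_{\max}(\Omega)\le M_1,\ 0<\sigma\le M_2\}$, where $M_1>1$ and $M_2>0$ are constants. Loadings: $\Xi(q,\bar c)=\{\xi\in\mathbb{R}^p:\ \|\xi\|_0=q,\ \xi\ne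 0,\ \max_{j\in\mathrm{supp}(\xi)}|\xi_j|\,/\min_{j\in\mathrm{supp}(\xi)}|\xi_j|\le\bar c\}$, where $\bar c\ge1$ is a constant. Confidence intervals: for a parameter space $\Theta$ and functional $\mathrm{T}$ of $\beta$, $\mathcal{I}_\alpha(\Theta,\mathrm{T})$ is the set of all intervals $\mathrm{CI}=[l(Z),u(Z)]$ with $\inf_{\theta\in\Theta}\mathbb{P}_\theta(l(Z)\le\mathrm{T}(\beta)\le u(Z))\ge1-\alpha$; the length is $L(\mathrm{CI})=u(Z)-l(Z)$. For $\Theta_1\subseteq\Theta$, $L^*_\alpha(\Theta_1,\Theta,\mathrm{T})=\inf_{\mathrm{CI}\in\mathcal{I}_\alpha(\Theta,\mathrm{T})}\sup_{\theta\in\Theta_1}\mathbb{E}_\theta L(\mathrm{CI})$.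
   Formalization: The pair k_1 = 0, k = 1 is excluded: there the bound fails, since for ξ = e_1 the hull of 0 and the simple-regression interval for β_1 is honest over Θ(1) with expected length of order 1/√n at β = 0, while log p / n may be of constant order. *)

theory Defs
  imports
    "HOL-Probability.Probability"
    "Jordan_Normal_Form.Matrix"
    "Jordan_Normal_Form.Determinant"
    "Jordan_Normal_Form.Spectral_Radius"
begin

unbundle no vec_syntax
unbundle no inner_syntax

text \<open>
  The constant of the lower bound has to be uniform in \<open>n\<close> and \<open>p\<close>, so the dimensions are
  natural numbers and not types.  Deterministic vectors and matrices are those of
  \<open>Jordan_Normal_Form\<close>, with explicit carriers.  Random vectors are extensional functions
  on an index set \<open>{..<p}\<close>, i.e. points of a finite product measure; \<open>vec p x\<close> turns
  such a function into a vector.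
\<close>

definition vsupp :: "real vec \<Rightarrow> nat set" where
  "vsupp x = {j. j < dim_vec x \<and> x $ j \<noteq> 0}"

definition l0 :: "real vec \<Rightarrow> nat" where
  "l0 x = card (vsupp x)"

definition l2 :: "real vec \<Rightarrow> real" where
  "l2 x = L2_set (\<lambda>j. x $ j) {..<dim_vec x}"

definition lambda_min :: "real mat \<Rightarrow> real" where
  "lambda_min A = Min (spectrum A)"

definition lambda_max :: "real mat \<Rightarrow> real" where
  "lambda_max A = Max (spectrum A)"

text \<open>
  A parameter is a triple \<open>(\<beta>, \<Omega>, \<sigma>)\<close>.  As the inverse of a covariance matrix, \<open>\<Omega>\<close> is
  symmetric; it is positive definite as soon as its smallest eigenvalue is positive.
\<close>

type_synonym param = "real vec \<times> real mat \<times> real"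

definition Theta :: "real \<Rightarrow> real \<Rightarrow> nat \<Rightarrow> nat \<Rightarrow> param set" where
  "Theta M\<^sub>1 M\<^sub>2 p k = {(\<beta>, \<Omega>, \<sigma>).
     \<beta> \<in> carrier_vec p \<and> \<Omega> \<in> carrier_mat p p \<and> transpose_mat \<Omega> = \<Omega> \<and>
     l0 \<beta> \<le> k \<and>
     1 / M\<^sub>1 \<le> lambda_min \<Omega> \<and> lambda_min \<Omega> \<le> lambda_max \<Omega> \<and> lambda_max \<Omega> \<le> M\<^sub>1 \<and>
     0 < \<sigma> \<and> \<sigma> \<le> M\<^sub>2}"

definition Xi :: "nat \<Rightarrow> nat \<Rightarrow> real \<Rightarrow> real vec set" where
  "Xi p q cb = {\<xi>. \<xi> \<in> carrier_vec p \<and> l0 \<xi> = q \<and> \<xi> \<noteq> 0\<^sub>v p \<and>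
     Max ((\<lambda>j. \<bar>\<xi> $ j\<bar>) ` vsupp \<xi>) / Min ((\<lambda>j. \<bar>\<xi> $ j\<bar>) ` vsupp \<xi>) \<le> cb}"

text \<open>
  The law \<open>N\<^sub>p(0, \<Sigma>)\<close> with \<open>\<Sigma> = \<Omega>\<^sup>-\<^sup>1\<close>, for symmetric positive definite \<open>\<Omega>\<close>, through its
  Lebesgue density.  It is written in terms of \<open>\<Omega>\<close>, so that
  \<open>1 / sqrt (det \<Sigma>)\<close> becomes \<open>sqrt (det \<Omega>)\<close>.
\<close>

definition mvnormal :: "nat \<Rightarrow> real mat \<Rightarrow> (nat \<Rightarrow> real) measure" where
  "mvnormal p \<Omega> = density (\<Pi>\<^sub>M j\<in>{..<p}. lborel)
     (\<lambda>x. ennreal (sqrt (Determinant.det \<Omega>) / sqrt (2 * pi) ^ p *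
                   exp (- (vec p x \<bullet> (\<Omega> *\<^sub>v vec p x)) / 2)))"

text \<open>A data set \<open>z\<close> has the observations \<open>z i = (y\<^sub>i, X\<^sub>i)\<close>, \<open>i < n\<close>, with \<open>X\<^sub>i\<close> the \<open>i\<close>-th row of the design.\<close>

type_synonym data = "nat \<Rightarrow> real \<times> (nat \<Rightarrow> real)"

definition data_space :: "nat \<Rightarrow> nat \<Rightarrow> data measure" where
  "data_space n p = (\<Pi>\<^sub>M i\<in>{..<n}. borel \<Otimes>\<^sub>M (\<Pi>\<^sub>M j\<in>{..<p}. borel))"

definition observe :: "nat \<Rightarrow> nat \<Rightarrow> real vec \<Rightarrow> (nat \<Rightarrow> nat \<Rightarrow> real) \<times> (nat \<Rightarrow> real) \<Rightarrow> data" where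
  "observe n p \<beta> = (\<lambda>(X, \<epsilon>). \<lambda>i\<in>{..<n}. (vec p (X i) \<bullet> \<beta> + \<epsilon> i, X i))"

text \<open>
  The law of \<open>Z\<close> under \<open>\<theta> = (\<beta>, \<Omega>, \<sigma>)\<close>.  The product of the two factors is the independence
  of design and noise; \<open>N\<^sub>n(0, \<sigma>\<^sup>2 I)\<close> is the \<open>n\<close>-fold product of \<open>N(0, \<sigma>\<^sup>2)\<close>.
\<close>

fun model :: "nat \<Rightarrow> nat \<Rightarrow> param \<Rightarrow> data measure" where
  "model n p (\<beta>, \<Omega>, \<sigma>) =
     distr ((\<Pi>\<^sub>M i\<in>{..<n}. mvnormal p \<Omega>) \<Otimes>\<^sub>M (\<Pi>\<^sub>M i\<in>{..<n}. density lborel (normal_density 0 \<sigma>)))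
           (data_space n p) (observe n p \<beta>)"

lemma observe_measurable:
  assumes "\<beta> \<in> carrier_vec p"
  shows "observe n p \<beta> \<in>
    ((\<Pi>\<^sub>M i\<in>{..<n}. mvnormal p \<Omega>) \<Otimes>\<^sub>M (\<Pi>\<^sub>M i\<in>{..<n}. density lborel (normal_density 0 \<sigma>)))
      \<rightarrow>\<^sub>M data_space n p"
proof -
  let ?M = "(\<Pi>\<^sub>M i\<in>{..<n}. mvnormal p \<Omega>) \<Otimes>\<^sub>M
    (\<Pi>\<^sub>M i\<in>{..<n}. density lborel (normal_density 0 \<sigma>))"
  have "sets (mvnormal p \<Omega>) = sets (\<Pi>\<^sub>M j\<in>{..<p}. borel)"
    unfolding mvnormal_def sets_density by (intro sets_PiM_cong) auto
  then have "sets ?M = sets ((\<Pi>\<^sub>M i\<in>{..<n}. \<Pi>\<^sub>M j\<in>{..<p}. borel :: real measure) \<Otimes>\<^sub>M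
      (\<Pi>\<^sub>M i\<in>{..<n}. borel :: real measure))"
    by (intro sets_pair_measure_cong sets_PiM_cong) auto
  moreover have "observe n p \<beta> \<in> ((\<Pi>\<^sub>M i\<in>{..<n}. \<Pi>\<^sub>M j\<in>{..<p}. borel) \<Otimes>\<^sub>M
      (\<Pi>\<^sub>M i\<in>{..<n}. borel)) \<rightarrow>\<^sub>M data_space n p"
    unfolding observe_def data_space_def case_prod_beta
  proof (rule measurable_restrict)
    fix i assume i: "i \<in> {..<n}"
    let ?N = "(\<Pi>\<^sub>M i\<in>{..<n}. \<Pi>\<^sub>M j\<in>{..<p}. borel :: real measure) \<Otimes>\<^sub>M
      (\<Pi>\<^sub>M i\<in>{..<n}. borel :: real measure)"
    have X: "(\<lambda>w. fst w i) \<in> ?N \<rightarrow>\<^sub>M (\<Pi>\<^sub>M j\<in>{..<p}. borel)"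
      using measurable_compose[OF measurable_fst measurable_component_singleton[OF i]] .
    have e: "(\<lambda>w. snd w i) \<in> borel_measurable ?N"
      using measurable_compose[OF measurable_snd measurable_component_singleton[OF i]] .
    have Xj: "(\<lambda>w. fst w i j) \<in> borel_measurable ?N" if "j \<in> {..<p}" for j
      using measurable_compose[OF X measurable_component_singleton[OF that]] .
    have "vec p (fst w i) \<bullet> \<beta> = (\<Sum>j\<in>{..<p}. fst w i j * \<beta> $ j)"
      for w :: "(nat \<Rightarrow> nat \<Rightarrow> real) \<times> (nat \<Rightarrow> real)"
      using assms by (auto simp: scalar_prod_def atLeast0LessThan)
    then show "(\<lambda>w. (vec p (fst w i) \<bullet> \<beta> + snd w i, fst w i)) \<in>
        ?N \<rightarrow>\<^sub>M borel \<Otimes>\<^sub>M (\<Pi>\<^sub>M j\<in>{..<p}. borel)"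
      using X e Xj
      by (simp only:) (intro measurable_Pair borel_measurable_add borel_measurable_sum
        borel_measurable_times borel_measurable_const; assumption)
  qed
  ultimately show ?thesis
    by (simp cong: measurable_cong_sets)
qed

text \<open>
  An interval is the pair \<open>(l, u)\<close> of its measurable endpoints.  The requirement \<open>l \<le> u\<close> is
  essential: without it an ``interval'' could have negative length where it misses \<open>T \<beta>\<close>.
  Lengths are integrated in \<open>ennreal\<close>, so that an interval whose length is not integrable has
  expected length \<open>\<infinity>\<close> (the Bochner integral would return \<open>0\<close>).
\<close>

definition conf_intervals ::
  "nat \<Rightarrow> nat \<Rightarrow> real \<Rightarrow> param set \<Rightarrow> (real vec \<Rightarrow> real) \<Rightarrow> ((data \<Rightarrow> real) \<times> (data \<Rightarrow> real)) set" where
  "conf_intervals n p \<alpha> \<Theta> T = {(l, u).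
     l \<in> borel_measurable (data_space n p) \<and> u \<in> borel_measurable (data_space n p) \<and>
     (\<forall>z \<in> space (data_space n p). l z \<le> u z) \<and>
     ennreal (1 - \<alpha>) \<le> (INF (\<beta>, \<Omega>, \<sigma>)\<in>\<Theta>.
        emeasure (model n p (\<beta>, \<Omega>, \<sigma>)) {z \<in> space (data_space n p). l z \<le> T \<beta> \<and> T \<beta> \<le> u z})}"

definition minimax_length ::
  "nat \<Rightarrow> nat \<Rightarrow> real \<Rightarrow> param set \<Rightarrow> param set \<Rightarrow> (real vec \<Rightarrow> real) \<Rightarrow> ennreal" where
  "minimax_length n p \<alpha> \<Theta>\<^sub>1 \<Theta> T = (INF (l, u)\<in>conf_intervals n p \<alpha> \<Theta> T.
     SUP \<theta>\<in>\<Theta>\<^sub>1. \<integral>\<^sup>+ z. ennreal (u z - l z) \<partial>model n p \<theta>)"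

end

theory Submission
  imports Defs
begin

text \<open>
  An interval that covers \<open>T\<close> with probability \<open>1 - \<alpha>\<close> at every parameter of a space must be long
  at a parameter \<open>\<theta>\<^sub>0\<close> that cannot be told apart from a mixture of parameters \<open>\<theta>\<^sub>i\<close> of the space at
  which \<open>T\<close> takes another common value: under \<open>\<theta>\<^sub>0\<close> it covers both values with probability at least
  \<open>1 - 2 \<alpha> - \<eta>\<close>, where \<open>\<eta>\<close> bounds the total variation distance to the mixture
  (\<open>minimax_length_ge_mixture\<close>).  The distance is controlled by the second moment of the mixture
  likelihood ratio, the average over pairs \<open>(i, j)\<close> of the \<open>n\<close>-th powers of the inner products
  of the likelihood ratios of a single observation.

  In all constructions \<open>\<theta>\<^sub>0\<close> has identity design, and there is one linear statistic \<open>D\<close> of an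
  observation \<open>(y, x)\<close>, with the same variance \<open>\<kappa>\<close> under all parameters, that carries the whole
  difference: the likelihood ratio of \<open>\<theta>\<^sub>i\<close> to \<open>\<theta>\<^sub>0\<close> is the ratio of the densities of
  \<open>N(g\<^sub>i \<bullet> x, \<kappa> - g\<^sub>i \<bullet> g\<^sub>i)\<close> and \<open>N(0, \<kappa>)\<close> at \<open>D\<close>.  The inner product of two such likelihood
  ratios is exactly \<open>\<kappa> / (\<kappa> - g\<^sub>i \<bullet> g\<^sub>j)\<close> (\<open>gaussian_lr_inner_product\<close>), an instance of
  Mehler's identity.

  The loading is compared with a unit vector \<open>v\<close> along the restriction of \<open>\<xi>\<close> to at most about
  \<open>k / 2\<close> coordinates.  As the entries of \<open>\<xi>\<close> are comparable and \<open>q \<le> C k\<close>, still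
  \<open>\<xi> \<bullet> v\<close> is of the order of the norm of \<open>\<xi>\<close> (\<open>obtain_loading_direction\<close>).

  \<^item> The term \<open>1 / sqrt n\<close> comes from the single alternative \<open>\<beta> = \<tau> b v\<close> with \<open>b\<close> of order
    \<open>1 / sqrt n\<close>, where the noise level is reduced so that the variance of \<open>y\<close> does not change.

  \<^item> The term \<open>k log p / n\<close> comes from confounding (\<open>minimax_length_ge_confounded\<close>).  For a set \<open>S\<close> of
    \<open>s\<close> covariates outside the support of \<open>\<xi>\<close>, let \<open>v \<bullet> X\<close> and \<open>y / \<tau>\<close> both have covariance
    \<open>\<rho>\<close> with every \<open>X\<^sub>j\<close>, \<open>j \<in> S\<close>, without changing their variances and their covariance \<open>a\<close>.
    Solving the normal equations, the coefficient along \<open>v\<close> moves by about \<open>\<rho>\<^sup>2 s\<close>, in a direction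
    that does not depend on \<open>S\<close>.  The difference \<open>y / \<tau> - v \<bullet> X\<close> is independent of everything else and
    has the same law as before, so only the sum \<open>y / \<tau> + v \<bullet> X\<close> sees \<open>S\<close>.  The problem has become the
    detection of a sparse regression vector with entries of order \<open>\<rho>\<close>, and a random \<open>S\<close> stays
    invisible as long as \<open>n \<rho>\<^sup>2\<close> is a small multiple of \<open>log p\<close>, since \<open>s\<^sup>2\<close> is smaller than
    \<open>p\<close> by a power of \<open>p\<close>.  The functional moves by \<open>\<rho>\<^sup>2 s\<close>, of order \<open>k log p / n\<close>.

  For \<open>k \<ge> 2\<close> the null can be \<open>\<beta> = 0\<close> (\<open>a = 0\<close>), and the \<open>k\<close> coordinates are shared between \<open>v\<close> and
  \<open>S\<close>.  For \<open>k\<^sub>1 = k = 1\<close> there is no room for both: there \<open>a = \<rho>\<^sup>2 s\<close>, for which the null has a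
  coefficient along \<open>v\<close> only and the alternative a coefficient on \<open>S\<close> only.
\<close>

section \<open>Identity matrices with two orthogonal outer products added\<close>

lemma sum_times_delta:
  fixes g :: "nat \<Rightarrow> real"
  assumes "i < p"
  shows "(\<Sum>k<p. g k * (if k = i then 1 else 0)) = g i" "(\<Sum>k<p. g k * (if i = k then 1 else 0)) = g i"
proof -
  have "(\<Sum>k<p. g k * (if k = i then 1 else 0)) = (\<Sum>k<p. if k = i then g k else 0)"
    by (intro sum.cong) auto
  then show "(\<Sum>k<p. g k * (if k = i then 1 else 0)) = g i" using assms by simp
  have "(\<Sum>k<p. g k * (if i = k then 1 else 0)) = (\<Sum>k<p. if k = i then g k else 0)"
    by (intro sum.cong) auto
  then show "(\<Sum>k<p. g k * (if i = k then 1 else 0)) = g i" using assms by simp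
qed

text \<open>Bordered by one row and one column and conjugated with a unipotent block matrix, the outer product moves
  into the new corner, where it is a scalar.\<close>

lemma det_one_plus_outer:
  fixes u w :: "nat \<Rightarrow> real"
  shows "Determinant.det (mat p p (\<lambda>(i,j). (if i = j then 1 else 0) + u i * w j))
    = 1 + (\<Sum>j<p. u j * w j)"
proof -
  let ?A = "mat p p (\<lambda>(i,j). (if i = j then 1 else 0) + u i * w j)"
  let ?U = "mat p 1 (\<lambda>(i,j). u i)"
  let ?W = "mat 1 p (\<lambda>(i,j). w j)"
  let ?L = "four_block_mat (1\<^sub>m p) (0\<^sub>m p 1) ?W (1\<^sub>m 1)"
  let ?R = "four_block_mat (1\<^sub>m p) (0\<^sub>m p 1) (- ?W) (1\<^sub>m 1)"
  let ?M = "four_block_mat ?A ?U (0\<^sub>m 1 p) (1\<^sub>m 1)"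
  let ?d = "mat 1 1 (\<lambda>(i,j). 1 + (\<Sum>j<p. u j * w j))"
  have LM: "?L * ?M = four_block_mat ?A ?U (?W * ?A) (?W * ?U + 1\<^sub>m 1)"
    by (subst mult_four_block_mat[where ?n1.0=p and ?n2.0=1 and ?nr1.0=p and ?nr2.0=1 and ?nc1.0=p and ?nc2.0=1])
      (auto simp: left_mult_one_mat[of _ p p])
  have "?L * ?M * ?R = four_block_mat (?A + ?U * (- ?W)) ?U (?W * ?A + (?W * ?U + 1\<^sub>m 1) * (- ?W)) (?W * ?U + 1\<^sub>m 1)"
    unfolding LM
    by (subst mult_four_block_mat[where ?n1.0=p and ?n2.0=1 and ?nr1.0=p and ?nr2.0=1 and ?nc1.0=p and ?nc2.0=1])
      (auto simp: right_mult_one_mat[of _ p p])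
  also have "?A + ?U * (- ?W) = 1\<^sub>m p"
    by (rule eq_matI) (auto simp: scalar_prod_def)
  also have "?W * ?U + 1\<^sub>m 1 = ?d"
    by (rule eq_matI) (auto simp: scalar_prod_def atLeast0LessThan mult.commute)
  also have "?W * ?A + ?d * (- ?W) = 0\<^sub>m 1 p"
    by (rule eq_matI)
      (auto simp: scalar_prod_def atLeast0LessThan algebra_simps sum.distrib sum_distrib_left sum_distrib_right sum_times_delta)
  finally have e: "?L * ?M * ?R = four_block_mat (1\<^sub>m p) ?U (0\<^sub>m 1 p) ?d" .
  have dL: "det ?L = 1" "det ?R = 1"
    by (subst det_four_block_mat_upper_right_zero[where n=p and m=1]; simp)+
  have dM: "det ?M = det ?A"
    by (subst det_four_block_mat_lower_left_zero[where n=p and m=1]; simp)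
  have dE: "det (four_block_mat (1\<^sub>m p) ?U (0\<^sub>m 1 p) ?d) = det ?d"
    by (subst det_four_block_mat_lower_left_zero[where n=p and m=1]; simp)
  have c: "?L \<in> carrier_mat (p+1) (p+1)" "?M \<in> carrier_mat (p+1) (p+1)" "?R \<in> carrier_mat (p+1) (p+1)"
    by (intro four_block_carrier_mat; simp)+
  have "det (?L * ?M * ?R) = det ?L * det ?M * det ?R"
    using c by (simp add: det_mult[where n="p+1"])
  then show ?thesis
    unfolding e dL dM dE by (simp add: det_single)
qed

definition rank_two_update :: "nat \<Rightarrow> real \<Rightarrow> (nat \<Rightarrow> real) \<Rightarrow> real \<Rightarrow> (nat \<Rightarrow> real) \<Rightarrow> real mat" where
  "rank_two_update p a e b f = mat p p (\<lambda>(i,j). (if i = j then 1 else 0) + a * e i * e j + b * f i * f j)"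

lemma rank_two_update_carrier: "rank_two_update p a e b f \<in> carrier_mat p p"
  by (simp add: rank_two_update_def)

lemma rank_two_update_sym: "transpose_mat (rank_two_update p a e b f) = rank_two_update p a e b f"
  by (rule eq_matI) (auto simp: rank_two_update_def)

text \<open>For orthogonal directions the update factors into two rank-one updates.\<close>

lemma det_rank_two_update:
  assumes "(\<Sum>j<p. e j * e j) = 1" "(\<Sum>j<p. f j * f j) = 1" "(\<Sum>j<p. e j * f j) = 0"
  shows "Determinant.det (rank_two_update p a e b f) = (1 + a) * (1 + b)"
proof -
  let ?A = "mat p p (\<lambda>(i,j). (if i = j then 1 else 0) + (a * e i) * e j)"
  let ?B = "mat p p (\<lambda>(i,j). (if i = j then 1 else 0) + (b * f i) * f j)"
  have "rank_two_update p a e b f = ?A * ?B"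
  proof (rule eq_matI)
    fix i j assume "i < dim_row (?A * ?B)" "j < dim_col (?A * ?B)"
    then have ij: "i < p" "j < p" by auto
    have "(?A * ?B) $$ (i,j) = (\<Sum>k<p. ((if i = k then 1 else 0) + (a * e i) * e k) * ((if k = j then 1 else 0) + (b * f k) * f j))"
      using ij by (simp add: scalar_prod_def atLeast0LessThan)
    also have "\<dots> = (\<Sum>k<p. (if k = i then (if i = j then 1 else 0) + b * f i * f j else 0)
        + (if k = j then a * e i * e j else 0) + a * e i * b * f j * (e k * f k))"
      by (intro sum.cong refl) (auto simp: algebra_simps)
    also have "\<dots> = (if i = j then 1 else 0) + a * e i * e j + b * f i * f j"
      unfolding sum.distrib using ij assms(3) by (simp flip: sum_distrib_left)
    finally show "rank_two_update p a e b f $$ (i,j) = (?A * ?B) $$ (i,j)"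
      using ij by (simp add: rank_two_update_def)
  qed (auto simp: rank_two_update_def)
  then have "Determinant.det (rank_two_update p a e b f) = det ?A * det ?B"
    by (simp add: det_mult[where n=p])
  also have "det ?A = 1 + a"
    unfolding det_one_plus_outer using assms(1) by (simp add: mult.assoc flip: sum_distrib_left)
  also have "det ?B = 1 + b"
    unfolding det_one_plus_outer using assms(2) by (simp add: mult.assoc flip: sum_distrib_left)
  finally show ?thesis .
qed

lemma rank_two_update_mult_vec:
  "rank_two_update p a e b f *\<^sub>v vec p x
    = vec p (\<lambda>i. x i + a * (\<Sum>j<p. e j * x j) * e i + b * (\<Sum>j<p. f j * x j) * f i)"
proof (rule eq_vecI)
  fix i assume "i < dim_vec (vec p (\<lambda>i. x i + a * (\<Sum>j<p. e j * x j) * e i + b * (\<Sum>j<p. f j * x j) * f i))"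
  then have i: "i < p" by simp
  then have "(rank_two_update p a e b f *\<^sub>v vec p x) $ i =
     (\<Sum>j<p. (if j = i then x i else 0) + a * e i * (e j * x j) + b * f i * (f j * x j))"
    by (auto simp: rank_two_update_def scalar_prod_def atLeast0LessThan algebra_simps sum_times_delta intro!: sum.cong)
  also have "\<dots> = x i + a * e i * (\<Sum>j<p. e j * x j) + b * f i * (\<Sum>j<p. f j * x j)"
    unfolding sum.distrib sum_distrib_left[symmetric] using i by (simp add: sum_times_delta)
  finally show "(rank_two_update p a e b f *\<^sub>v vec p x) $ i
    = vec p (\<lambda>i. x i + a * (\<Sum>j<p. e j * x j) * e i + b * (\<Sum>j<p. f j * x j) * f i) $ i"
    using i by (simp add: algebra_simps)
qed (simp add: rank_two_update_def)

lemma rank_two_update_quadratic: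
  "vec p x \<bullet> (rank_two_update p a e b f *\<^sub>v vec p x) =
    (\<Sum>j<p. (x j)\<^sup>2) + a * (\<Sum>j<p. e j * x j)\<^sup>2 + b * (\<Sum>j<p. f j * x j)\<^sup>2"
proof -
  have "vec p x \<bullet> (rank_two_update p a e b f *\<^sub>v vec p x) = 
    (\<Sum>i<p. x i * (x i + a * (\<Sum>j<p. e j * x j) * e i + b * (\<Sum>j<p. f j * x j) * f i))"
    unfolding rank_two_update_mult_vec scalar_prod_def by (auto simp: atLeast0LessThan intro!: sum.cong)
  also have "\<dots> = (\<Sum>i<p. (x i)\<^sup>2 + (a * (\<Sum>j<p. e j * x j)) * (e i * x i) + (b * (\<Sum>j<p. f j * x j)) * (f i * x i))"
    by (intro sum.cong refl) (simp add: algebra_simps power2_eq_square)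
  also have "\<dots> = (\<Sum>j<p. (x j)\<^sup>2) + a * (\<Sum>j<p. e j * x j)\<^sup>2 + b * (\<Sum>j<p. f j * x j)\<^sup>2"
    unfolding sum.distrib sum_distrib_left[symmetric] by (simp add: power2_eq_square)
  finally show ?thesis .
qed

lemma eigenvalue_between:
  fixes A :: "real mat"
  assumes A: "A \<in> carrier_mat p p"
    and bd: "\<And>x. lo * (\<Sum>j<p. (x j)\<^sup>2) \<le> vec p x \<bullet> (A *\<^sub>v vec p x) \<and>
       vec p x \<bullet> (A *\<^sub>v vec p x) \<le> hi * (\<Sum>j<p. (x j)\<^sup>2)"
    and "eigenvalue A l"
  shows "lo \<le> l \<and> l \<le> hi"
proof -
  obtain v where v: "v \<in> carrier_vec p" "v \<noteq> 0\<^sub>v p" "A *\<^sub>v v = l \<cdot>\<^sub>v v"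
    using assms(3) A by (auto simp: eigenvalue_def eigenvector_def)
  define x where "x = (\<lambda>j. v $ j)"
  have vx: "vec p x = v" using v(1) by (auto simp: x_def)
  have ss: "v \<bullet> v = (\<Sum>j<p. (x j)\<^sup>2)"
    using v(1) by (auto simp: scalar_prod_def x_def atLeast0LessThan power2_eq_square)
  obtain j where j: "j < p" "x j \<noteq> 0"
    using v(1,2) by (auto simp: x_def vec_eq_iff)
  then have pos: "0 < (\<Sum>j<p. (x j)\<^sup>2)"
    by (intro sum_pos2[of _ j]) auto
  have "v \<bullet> (A *\<^sub>v v) = l * (\<Sum>j<p. (x j)\<^sup>2)"
    using v ss by simp
  with bd[of x] pos show ?thesis unfolding vx by simp
qed

lemma rank_two_update_spectrum:
  assumes ee: "(\<Sum>j<p. e j * e j) = 1" and ff: "(\<Sum>j<p. f j * f j) = 1" and ef: "(\<Sum>j<p. e j * f j) = 0"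
    and "a \<le> 0" "0 \<le> b" and "x \<in> spectrum (rank_two_update p a e b f)"
  shows "1 + a \<le> x \<and> x \<le> 1 + b"
proof -
  let ?n = "\<lambda>x. \<Sum>j<p. (x j)\<^sup>2"
  have cs: "(\<Sum>j<p. u j * x j)\<^sup>2 \<le> ?n x" if "(\<Sum>j<p. u j * u j) = 1" for u x :: "nat \<Rightarrow> real"
    using Cauchy_Schwarz_ineq_sum[of u x "{..<p}"] that by (simp add: power2_eq_square)
  have "(1 + a) * ?n x \<le> vec p x \<bullet> (rank_two_update p a e b f *\<^sub>v vec p x) \<and>
      vec p x \<bullet> (rank_two_update p a e b f *\<^sub>v vec p x) \<le> (1 + b) * ?n x" for x
  proof -
    have "a * ?n x \<le> a * (\<Sum>j<p. e j * x j)\<^sup>2" "a * (\<Sum>j<p. e j * x j)\<^sup>2 \<le> 0"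
      using cs[OF ee, of x] \<open>a \<le> 0\<close> by (auto intro: mult_left_mono_neg simp: mult_le_0_iff)
    moreover have "b * (\<Sum>j<p. f j * x j)\<^sup>2 \<le> b * ?n x" "0 \<le> b * (\<Sum>j<p. f j * x j)\<^sup>2"
      using cs[OF ff, of x] \<open>0 \<le> b\<close> by (auto intro: mult_left_mono)
    ultimately show ?thesis unfolding rank_two_update_quadratic by (simp add: algebra_simps)
  qed
  from eigenvalue_between[OF rank_two_update_carrier this] assms(6) show ?thesis
    by (auto simp: spectrum_def)
qed

text \<open>A spectrum over the reals may be empty, and then its minimum and maximum are unspecified; an explicit eigenvector excludes this.\<close>

lemma rank_two_update_eigenvalue:
  assumes ee: "(\<Sum>j<p. e j * e j) = 1" and ef: "(\<Sum>j<p. e j * f j) = 0"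
  shows "1 + a \<in> spectrum (rank_two_update p a e b f)"
proof -
  have fe: "(\<Sum>j<p. f j * e j) = 0" using ef by (simp add: mult.commute)
  have "vec p e \<noteq> 0\<^sub>v p"
  proof
    assume z: "vec p e = 0\<^sub>v p"
    then have "e j = 0" if "j < p" for j using that by (metis index_vec index_zero_vec(1))
    with ee show False by simp
  qed
  moreover have "rank_two_update p a e b f *\<^sub>v vec p e = (1 + a) \<cdot>\<^sub>v vec p e"
    unfolding rank_two_update_mult_vec by (rule eq_vecI) (auto simp: ee ef fe algebra_simps)
  ultimately show ?thesis
    by (auto simp: spectrum_def eigenvalue_def eigenvector_def rank_two_update_carrier[THEN carrier_matD(1)] intro!: exI[of _ "vec p e"])
qed

lemma rank_two_update_lambda:
  assumes ee: "(\<Sum>j<p. e j * e j) = 1" and ff: "(\<Sum>j<p. f j * f j) = 1" and ef: "(\<Sum>j<p. e j * f j) = 0"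
    and "a \<le> 0" "0 \<le> b"
  shows "1 + a \<le> lambda_min (rank_two_update p a e b f)" 
    "lambda_min (rank_two_update p a e b f) \<le> lambda_max (rank_two_update p a e b f)"
    "lambda_max (rank_two_update p a e b f) \<le> 1 + b"
proof -
  let ?S = "spectrum (rank_two_update p a e b f)"
  have fin: "finite ?S" using card_finite_spectrum[OF rank_two_update_carrier] by auto
  have ne: "?S \<noteq> {}" using rank_two_update_eigenvalue[OF ee ef] by auto
  note sp = rank_two_update_spectrum[OF ee ff ef assms(4,5)]
  show "1 + a \<le> lambda_min (rank_two_update p a e b f)" "lambda_max (rank_two_update p a e b f) \<le> 1 + b"
    "lambda_min (rank_two_update p a e b f) \<le> lambda_max (rank_two_update p a e b f)"
    unfolding lambda_min_def lambda_max_def using fin ne sp by (auto intro: order_trans[OF Min_le Max_ge])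
qed

section \<open>Gaussian integrals\<close>

lemma nn_integral_exp_quadratic:
  fixes A B E :: real
  assumes "0 < A"
  shows "(\<integral>\<^sup>+x. ennreal (exp (- (A * x\<^sup>2 - 2 * B * x + E) / 2)) \<partial>lborel)
    = ennreal (sqrt (2 * pi / A) * exp ((B\<^sup>2 / A - E) / 2))"
proof -
  let ?K = "sqrt (2 * pi / A) * exp ((B\<^sup>2 / A - E) / 2)"
  let ?N = "normal_density (B / A) (1 / sqrt A)"
  have s: "0 < 1 / sqrt A" using assms by simp
  have "exp (- (A * x\<^sup>2 - 2 * B * x + E) / 2) = ?K * ?N x" for x
  proof -
    have "?N x = 1 / sqrt (2 * pi / A) * exp (- (x - B / A)\<^sup>2 / (2 / A))"
      using assms by (simp add: normal_density_def power_divide)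
    moreover have "- (A * x\<^sup>2 - 2 * B * x + E) / 2 = (B\<^sup>2 / A - E) / 2 + (- (x - B / A)\<^sup>2 / (2 / A))"
      using assms by (simp add: power2_eq_square field_simps)
    ultimately show ?thesis
      using assms by (simp only: exp_add) simp
  qed
  then have "(\<integral>\<^sup>+x. ennreal (exp (- (A * x\<^sup>2 - 2 * B * x + E) / 2)) \<partial>lborel)
      = (\<integral>\<^sup>+x. ennreal ?K * ennreal (?N x) \<partial>lborel)"
    using assms by (simp add: ennreal_mult)
  also have "\<dots> = ennreal ?K * (\<integral>\<^sup>+x. ennreal (?N x) \<partial>lborel)"
    by (simp add: nn_integral_cmult)
  also have "(\<integral>\<^sup>+x. ennreal (?N x) \<partial>lborel) = 1"
    using s by (simp add: nn_integral_eq_integral)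
  finally show ?thesis by simp
qed

lemma nn_integral_exp_quadratic_cmult:
  fixes A B E K :: real
  assumes "0 < A" "0 \<le> K" "\<And>x. f x = K * exp (- (A * x\<^sup>2 - 2 * B * x + E) / 2)"
  shows "(\<integral>\<^sup>+x. ennreal (f x) \<partial>lborel) = ennreal (K * (sqrt (2 * pi / A) * exp ((B\<^sup>2 / A - E) / 2)))"
  using assms nn_integral_exp_quadratic[OF \<open>0 < A\<close>, of B E]
  by (simp add: ennreal_mult nn_integral_cmult)

lemma normal_density_sqrt:
  "0 < v \<Longrightarrow> normal_density m (sqrt v) x = 1 / sqrt (2 * pi * v) * exp (- (x - m)\<^sup>2 / (2 * v))"
  by (simp add: normal_density_def)

lemma sqrt_two_pi_mult: "sqrt (2 * pi * a) * sqrt (2 * pi * b) = 2 * pi * sqrt (a * b)"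
proof -
  have "sqrt (2 * pi * a) * sqrt (2 * pi * b) = sqrt ((2 * pi)\<^sup>2 * (a * b))"
    by (simp only: real_sqrt_mult[symmetric]) (simp add: power2_eq_square mult_ac)
  also have "\<dots> = 2 * pi * sqrt (a * b)"
    unfolding real_sqrt_mult real_sqrt_abs by simp
  finally show ?thesis .
qed

definition binormal_density :: "real \<Rightarrow> real \<Rightarrow> real \<Rightarrow> real \<Rightarrow> real \<Rightarrow> real" where
  "binormal_density v\<^sub>1 v\<^sub>2 c x y = 1 / (2 * pi * sqrt (v\<^sub>1 * v\<^sub>2 - c\<^sup>2)) *
     exp (- (v\<^sub>2 * x\<^sup>2 - 2 * c * x * y + v\<^sub>1 * y\<^sup>2) / (2 * (v\<^sub>1 * v\<^sub>2 - c\<^sup>2)))"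

lemma borel_measurable_binormal [measurable]:
  assumes [measurable]: "f \<in> borel_measurable M" "g \<in> borel_measurable M"
  shows "(\<lambda>w. binormal_density v\<^sub>1 v\<^sub>2 c (f w) (g w)) \<in> borel_measurable M"
  unfolding binormal_density_def by measurable

lemma binormal_nonneg: "0 < v\<^sub>1 * v\<^sub>2 - c\<^sup>2 \<Longrightarrow> 0 \<le> binormal_density v\<^sub>1 v\<^sub>2 c x y"
  unfolding binormal_density_def by simp

lemma binormal_independent:
  assumes "0 < v\<^sub>1" "0 < v\<^sub>2"
  shows "binormal_density v\<^sub>1 v\<^sub>2 0 x y = normal_density 0 (sqrt v\<^sub>1) x * normal_density 0 (sqrt v\<^sub>2) y"
proof -
  have "sqrt (2 * pi * v\<^sub>1) * sqrt (2 * pi * v\<^sub>2) = 2 * pi * sqrt (v\<^sub>1 * v\<^sub>2)"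
    by (rule sqrt_two_pi_mult)
  moreover have "- (v\<^sub>2 * x\<^sup>2 + v\<^sub>1 * y\<^sup>2) / (2 * (v\<^sub>1 * v\<^sub>2)) = - x\<^sup>2 / (2 * v\<^sub>1) + - y\<^sup>2 / (2 * v\<^sub>2)"
    using assms by (simp add: field_simps)
  ultimately show ?thesis
    using assms unfolding binormal_density_def normal_density_sqrt[OF assms(1)] normal_density_sqrt[OF assms(2)]
    by (simp add: exp_add[symmetric] mult_ac)
qed

lemma normal_convolution_step:
  assumes "0 < v"
  shows "(\<integral>\<^sup>+t. ennreal (normal_density 0 (sqrt v) (d - h * t) * std_normal_density t) \<partial>lborel)
    = ennreal (normal_density 0 (sqrt (v + h\<^sup>2)) d)"
proof -
  define A where "A = 1 + h\<^sup>2 / v"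
  define K where "K = 1 / (2 * pi * sqrt v)"
  have A: "0 < A" using assms by (simp add: A_def add_pos_nonneg)
  have vh: "0 < v + h\<^sup>2" using assms by (simp add: add_pos_nonneg)
  have f: "normal_density 0 (sqrt v) (d - h * t) * std_normal_density t
      = K * exp (- (A * t\<^sup>2 - 2 * (d * h / v) * t + d\<^sup>2 / v) / 2)" for t
  proof -
    have "- (A * t\<^sup>2 - 2 * (d * h / v) * t + d\<^sup>2 / v) / 2 = - (d - h * t)\<^sup>2 / (2 * v) + - t\<^sup>2 / 2"
      using assms by (simp add: A_def power2_eq_square field_simps)
    moreover have "sqrt (2 * pi * v) * sqrt (2 * pi) = 2 * pi * sqrt v"
      using sqrt_two_pi_mult[of v 1] by simp
    ultimately show ?thesis
      unfolding normal_density_sqrt[OF assms] std_normal_density_def K_def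
      by (simp add: exp_add[symmetric] mult_ac)
  qed
  have "(\<integral>\<^sup>+t. ennreal (normal_density 0 (sqrt v) (d - h * t) * std_normal_density t) \<partial>lborel)
    = ennreal (K * (sqrt (2 * pi / A) * exp (((d * h / v)\<^sup>2 / A - d\<^sup>2 / v) / 2)))"
    using assms by (intro nn_integral_exp_quadratic_cmult[OF A _ f]) (simp add: K_def)
  also have "((d * h / v)\<^sup>2 / A - d\<^sup>2 / v) / 2 = - d\<^sup>2 / (2 * (v + h\<^sup>2))"
  proof -
    define w where "w = v + h\<^sup>2"
    have w: "0 < w" using vh by (simp add: w_def)
    have "A = w / v" using assms by (simp add: A_def w_def field_simps)
    then have "((d * h / v)\<^sup>2 / A - d\<^sup>2 / v) = (d\<^sup>2 * h\<^sup>2 - d\<^sup>2 * w) / (v * w)"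
      using assms w by (simp add: power2_eq_square field_simps)
    also have "\<dots> = - d\<^sup>2 / w"
      using assms w by (simp add: divide_simps) (simp add: w_def algebra_simps)
    finally show ?thesis by (simp add: w_def)
  qed
  also have "K * (sqrt (2 * pi / A) * X) = 1 / sqrt (2 * pi * (v + h\<^sup>2)) * X" for X
  proof -
    have "sqrt (2 * pi / A) = sqrt (2 * pi) * sqrt v / sqrt (v + h\<^sup>2)"
      using assms by (simp add: A_def real_sqrt_divide[symmetric] real_sqrt_mult[symmetric] field_simps)
    moreover have "K = 1 / (sqrt (2 * pi) * sqrt (2 * pi) * sqrt v)" by (simp add: K_def)
    moreover have "sqrt (2 * pi * (v + h\<^sup>2)) = sqrt (2 * pi) * sqrt (v + h\<^sup>2)"
      by (rule real_sqrt_mult)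
    ultimately show ?thesis
      using assms by (simp del: real_sqrt_mult_self)
  qed
  finally show ?thesis using normal_density_sqrt[OF vh, of 0 d] by simp
qed

text \<open>
  Adding an independent Gaussian vector \<open>(a, b) t\<close> of rank one adds its covariance matrix.  On the
  level of densities this is the completion of a square; that the remaining quadratic form is the
  one of the new covariance matrix is Lagrange's identity.
\<close>

lemma binormal_convolution_step:
  assumes v1: "0 < v\<^sub>1" and det: "0 < v\<^sub>1 * v\<^sub>2 - c\<^sup>2"
  shows "(\<integral>\<^sup>+t. ennreal (binormal_density v\<^sub>1 v\<^sub>2 c (x - a * t) (y - b * t) * std_normal_density t) \<partial>lborel)
    = ennreal (binormal_density (v\<^sub>1 + a\<^sup>2) (v\<^sub>2 + b\<^sup>2) (c + a * b) x y)"
    and "0 < (v\<^sub>1 + a\<^sup>2) * (v\<^sub>2 + b\<^sup>2) - (c + a * b)\<^sup>2"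
proof -
  define \<Delta> where "\<Delta> = v\<^sub>1 * v\<^sub>2 - c\<^sup>2"
  define q where "q = v\<^sub>2 * a\<^sup>2 - 2 * c * a * b + v\<^sub>1 * b\<^sup>2"
  define Q where "Q = v\<^sub>2 * x\<^sup>2 - 2 * c * x * y + v\<^sub>1 * y\<^sup>2"
  define \<beta> where "\<beta> = v\<^sub>2 * x * a - c * (x * b + y * a) + v\<^sub>1 * y * b"
  define Q' where "Q' = (v\<^sub>2 + b\<^sup>2) * x\<^sup>2 - 2 * (c + a * b) * x * y + (v\<^sub>1 + a\<^sup>2) * y\<^sup>2"
  have \<Delta>: "0 < \<Delta>" using det by (simp add: \<Delta>_def)
  have "v\<^sub>1 * q = (v\<^sub>1 * b - c * a)\<^sup>2 + \<Delta> * a\<^sup>2"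
    by (simp add: q_def \<Delta>_def power2_eq_square algebra_simps)
  moreover have "0 \<le> (v\<^sub>1 * b - c * a)\<^sup>2 + \<Delta> * a\<^sup>2" using \<Delta> by simp
  ultimately have q: "0 \<le> q" using v1 by (metis zero_le_mult_iff not_less_iff_gr_or_eq leD)
  have \<Delta>q: "(v\<^sub>1 + a\<^sup>2) * (v\<^sub>2 + b\<^sup>2) - (c + a * b)\<^sup>2 = \<Delta> + q"
    by (simp add: \<Delta>_def q_def power2_eq_square algebra_simps)
  have \<Delta>q0: "0 < \<Delta> + q" using \<Delta> q by simp
  then show "0 < (v\<^sub>1 + a\<^sup>2) * (v\<^sub>2 + b\<^sup>2) - (c + a * b)\<^sup>2" unfolding \<Delta>q .
  have lagrange: "Q * (\<Delta> + q) - \<beta>\<^sup>2 = \<Delta> * Q'"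
    unfolding Q_def \<Delta>_def q_def \<beta>_def Q'_def
    by (simp add: power2_eq_square algebra_simps)
  define A where "A = 1 + q / \<Delta>"
  define K where "K = 1 / (2 * pi * sqrt \<Delta>) * (1 / sqrt (2 * pi))"
  have A: "0 < A" using \<Delta> q by (simp add: A_def add_pos_nonneg)
  have f: "binormal_density v\<^sub>1 v\<^sub>2 c (x - a * t) (y - b * t) * std_normal_density t
      = K * exp (- (A * t\<^sup>2 - 2 * (\<beta> / \<Delta>) * t + Q / \<Delta>) / 2)" for t
  proof -
    have "v\<^sub>2 * (x - a * t)\<^sup>2 - 2 * c * (x - a * t) * (y - b * t) + v\<^sub>1 * (y - b * t)\<^sup>2
        = q * t\<^sup>2 - 2 * \<beta> * t + Q"
      unfolding q_def \<beta>_def Q_def by (simp add: power2_eq_square algebra_simps)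
    moreover have "- (A * t\<^sup>2 - 2 * (\<beta> / \<Delta>) * t + Q / \<Delta>) / 2
        = - (q * t\<^sup>2 - 2 * \<beta> * t + Q) / (2 * \<Delta>) + - t\<^sup>2 / 2"
      using \<Delta> by (simp add: A_def field_simps)
    ultimately show ?thesis
      unfolding binormal_density_def std_normal_density_def K_def \<Delta>_def[symmetric]
      by (simp add: exp_add[symmetric] mult_ac)
  qed
  have "(\<integral>\<^sup>+t. ennreal (binormal_density v\<^sub>1 v\<^sub>2 c (x - a * t) (y - b * t) * std_normal_density t) \<partial>lborel)
      = ennreal (K * (sqrt (2 * pi / A) * exp (((\<beta> / \<Delta>)\<^sup>2 / A - Q / \<Delta>) / 2)))"
    using \<Delta> by (intro nn_integral_exp_quadratic_cmult[OF A _ f]) (simp add: K_def)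
  also have "((\<beta> / \<Delta>)\<^sup>2 / A - Q / \<Delta>) / 2 = - Q' / (2 * (\<Delta> + q))"
  proof -
    have "A = (\<Delta> + q) / \<Delta>" using \<Delta> by (simp add: A_def field_simps)
    then have "((\<beta> / \<Delta>)\<^sup>2 / A - Q / \<Delta>) = - (Q * (\<Delta> + q) - \<beta>\<^sup>2) / (\<Delta> * (\<Delta> + q))"
      using \<Delta> \<Delta>q0 by (simp add: field_simps power2_eq_square)
    also have "\<dots> = - Q' / (\<Delta> + q)"
      unfolding lagrange using \<Delta> \<Delta>q0 by simp
    finally show ?thesis by simp
  qed
  also have "K * (sqrt (2 * pi / A) * X) = 1 / (2 * pi * sqrt (\<Delta> + q)) * X" for X
  proof -
    have "sqrt (2 * pi / A) = sqrt (2 * pi) * sqrt \<Delta> / sqrt (\<Delta> + q)"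
      using \<Delta> by (simp add: A_def real_sqrt_divide[symmetric] real_sqrt_mult[symmetric] field_simps)
    then show ?thesis
      using \<Delta> \<Delta>q0 by (simp add: K_def)
  qed
  finally show "(\<integral>\<^sup>+t. ennreal (binormal_density v\<^sub>1 v\<^sub>2 c (x - a * t) (y - b * t) * std_normal_density t) \<partial>lborel)
    = ennreal (binormal_density (v\<^sub>1 + a\<^sup>2) (v\<^sub>2 + b\<^sup>2) (c + a * b) x y)"
    unfolding binormal_density_def \<Delta>q Q'_def .
qed

abbreviation std_normal :: "real measure" where
  "std_normal \<equiv> density lborel std_normal_density"

lemma nn_integral_std_normal:
  assumes "\<And>t. 0 \<le> f t" "f \<in> borel_measurable borel"
  shows "(\<integral>\<^sup>+t. ennreal (f t) \<partial>std_normal) = (\<integral>\<^sup>+t. ennreal (f t * std_normal_density t) \<partial>lborel)"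
  using assms by (subst nn_integral_density) (auto simp: ennreal_mult mult.commute)

text \<open>
  Integrating out independent coordinates one at a time, so that no joint law of linear
  functionals is needed.  The hypothesis that a coordinate does not occur both in \<open>h\<close> and in
  \<open>g, g'\<close> is the independence of \<open>h \<bullet> \<omega>\<close> from the other two functionals.
\<close>

lemma nn_integral_normal_product:
  fixes h g g' :: "nat \<Rightarrow> real"
  assumes "finite I" "0 < v" "0 < v\<^sub>1" "0 < v\<^sub>1 * v\<^sub>2 - c\<^sup>2"
    and "\<And>j. j \<in> I \<Longrightarrow> h j = 0 \<or> g j = 0 \<and> g' j = 0"
  shows "(\<integral>\<^sup>+\<omega>. ennreal (normal_density 0 (sqrt v) (d - (\<Sum>j\<in>I. h j * \<omega> j)) *
        binormal_density v\<^sub>1 v\<^sub>2 c (x - (\<Sum>j\<in>I. g j * \<omega> j)) (y - (\<Sum>j\<in>I. g' j * \<omega> j))) \<partial>PiM I (\<lambda>_. std_normal))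
    = ennreal (normal_density 0 (sqrt (v + (\<Sum>j\<in>I. (h j)\<^sup>2))) d *
        binormal_density (v\<^sub>1 + (\<Sum>j\<in>I. (g j)\<^sup>2)) (v\<^sub>2 + (\<Sum>j\<in>I. (g' j)\<^sup>2)) (c + (\<Sum>j\<in>I. g j * g' j)) x y)"
    (is "?L I v v\<^sub>1 v\<^sub>2 c d x y = ?R I v v\<^sub>1 v\<^sub>2 c d x y")
  using assms
proof (induction I arbitrary: v v\<^sub>1 v\<^sub>2 c d x y rule: finite_induct)
  case empty
  then show ?case by (simp add: PiM_empty nn_integral_count_space_finite)
next
  case (insert i I)
  interpret product_sigma_finite "\<lambda>_::nat. std_normal"
    by (intro product_sigma_finite.intro prob_space_imp_sigma_finite prob_space_normal_density) simp
  let ?F = "\<lambda>\<omega>. ennreal (normal_density 0 (sqrt v) (d - (\<Sum>j\<in>insert i I. h j * \<omega> j)) *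
        binormal_density v\<^sub>1 v\<^sub>2 c (x - (\<Sum>j\<in>insert i I. g j * \<omega> j)) (y - (\<Sum>j\<in>insert i I. g' j * \<omega> j)))"
  have upd: "(\<Sum>j\<in>insert i I. w j * fun_upd \<omega> i t j) = w i * t + (\<Sum>j\<in>I. w j * \<omega> j)" for w \<omega> :: "nat \<Rightarrow> real" and t
    using insert(1,2) by (auto intro!: sum.cong)
  have "?L (insert i I) v v\<^sub>1 v\<^sub>2 c d x y = (\<integral>\<^sup>+t. \<integral>\<^sup>+\<omega>. ?F (fun_upd \<omega> i t) \<partial>PiM I (\<lambda>_. std_normal) \<partial>std_normal)"
    using insert(1,2) by (subst product_nn_integral_insert_rev) auto
  also have "\<dots> = (\<integral>\<^sup>+t. ?L I v v\<^sub>1 v\<^sub>2 c (d - h i * t) (x - g i * t) (y - g' i * t) \<partial>std_normal)"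
    unfolding upd by (simp add: algebra_simps)
  also have "\<dots> = (\<integral>\<^sup>+t. ?R I v v\<^sub>1 v\<^sub>2 c (d - h i * t) (x - g i * t) (y - g' i * t) \<partial>std_normal)"
    using insert.prems by (subst insert.IH) auto
  also have "\<dots> = ?R (insert i I) v v\<^sub>1 v\<^sub>2 c d x y"
  proof -
    let ?v = "v + (\<Sum>j\<in>I. (h j)\<^sup>2)" and ?v1 = "v\<^sub>1 + (\<Sum>j\<in>I. (g j)\<^sup>2)"
      and ?v2 = "v\<^sub>2 + (\<Sum>j\<in>I. (g' j)\<^sup>2)" and ?c = "c + (\<Sum>j\<in>I. g j * g' j)"
    have pos: "0 < ?v" "0 < ?v1" using insert.prems(1,2) by (simp_all add: add_pos_nonneg sum_nonneg)
    have det: "0 < ?v1 * ?v2 - ?c\<^sup>2"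
      using insert(1) insert.prems(2,3)
    proof (induction I rule: finite_induct)
      case (insert k I)
      have "0 < v\<^sub>1 + (\<Sum>j\<in>I. (g j)\<^sup>2)" using insert.prems by (simp add: add_pos_nonneg sum_nonneg)
      from binormal_convolution_step(2)[OF this insert.IH[OF insert.prems], of "g k" "g' k"]
      show ?case using insert by (simp add: algebra_simps)
    qed auto
    have nn: "0 \<le> binormal_density ?v1 ?v2 ?c s t" for s t using det by (rule binormal_nonneg)
    consider "h i = 0" | "g i = 0" "g' i = 0" using insert.prems(4)[of i] by auto
    then show ?thesis
    proof cases
      case 1
      have "(\<integral>\<^sup>+t. ?R I v v\<^sub>1 v\<^sub>2 c (d - h i * t) (x - g i * t) (y - g' i * t) \<partial>std_normal)
        = (\<integral>\<^sup>+t. ennreal (normal_density 0 (sqrt ?v) d) *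
            ennreal (binormal_density ?v1 ?v2 ?c (x - g i * t) (y - g' i * t)) \<partial>std_normal)"
        using 1 nn by (simp add: ennreal_mult)
      also have "\<dots> = ennreal (normal_density 0 (sqrt ?v) d) *
          ennreal (binormal_density (?v1 + (g i)\<^sup>2) (?v2 + (g' i)\<^sup>2) (?c + g i * g' i) x y)"
        using nn by (simp add: nn_integral_cmult nn_integral_std_normal binormal_convolution_step(1)[OF pos(2) det])
      finally show ?thesis
        using 1 insert(1,2) binormal_nonneg[OF binormal_convolution_step(2)[OF pos(2) det, of "g i" "g' i"]]
        by (simp add: ennreal_mult add_ac)
    next
      case 2
      have "(\<integral>\<^sup>+t. ?R I v v\<^sub>1 v\<^sub>2 c (d - h i * t) (x - g i * t) (y - g' i * t) \<partial>std_normal)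
        = (\<integral>\<^sup>+t. ennreal (normal_density 0 (sqrt ?v) (d - h i * t)) *
            ennreal (binormal_density ?v1 ?v2 ?c x y) \<partial>std_normal)"
        using 2 nn by (simp add: ennreal_mult)
      also have "\<dots> = ennreal (normal_density 0 (sqrt (?v + (h i)\<^sup>2)) d) * ennreal (binormal_density ?v1 ?v2 ?c x y)"
        by (simp add: nn_integral_multc nn_integral_std_normal normal_convolution_step[OF pos(1)])
      finally show ?thesis
        using 2 insert(1,2) nn by (simp add: ennreal_mult add_ac)
    qed
  qed
  finally show ?case .
qed

text \<open>
  This is the value of the inner product of two likelihood ratios after the design has been
  integrated out: both conditional densities are evaluated at the same point \<open>d\<close>, and the
  design has made the corresponding variables correlated.
\<close>

lemma nn_integral_binormal_diagonal:
  assumes "0 < \<kappa>" "0 < \<kappa> * \<kappa> - c\<^sup>2"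
  shows "(\<integral>\<^sup>+d. ennreal (binormal_density \<kappa> \<kappa> c d d / normal_density 0 (sqrt \<kappa>) d) \<partial>lborel) = ennreal (\<kappa> / (\<kappa> - c))"
proof -
  have "\<bar>c\<bar>\<^sup>2 < \<kappa>\<^sup>2" using assms(2) unfolding power2_abs power2_eq_square[of \<kappa>] by linarith
  then have "\<bar>c\<bar> < \<kappa>" using less_imp_le[OF assms(1)] by (rule power2_less_imp_less)
  then have kc: "0 < \<kappa> - c" "0 < \<kappa> + c" by auto
  define A where "A = (\<kappa> - c) / (\<kappa> * (\<kappa> + c))"
  define K where "K = sqrt (2 * pi * \<kappa>) / (2 * pi * sqrt (\<kappa> * \<kappa> - c\<^sup>2))"
  have A: "0 < A" using assms kc by (simp add: A_def)
  have det: "\<kappa> * \<kappa> - c\<^sup>2 = (\<kappa> - c) * (\<kappa> + c)" by (simp add: power2_eq_square algebra_simps)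
  have f: "binormal_density \<kappa> \<kappa> c d d / normal_density 0 (sqrt \<kappa>) d = K * exp (- (A * d\<^sup>2 - 2 * 0 * d + 0) / 2)" for d
  proof -
    have "- (\<kappa> * d\<^sup>2 - 2 * c * d * d + \<kappa> * d\<^sup>2) / (2 * (\<kappa> * \<kappa> - c\<^sup>2)) = (- d\<^sup>2) * (2 * (\<kappa> - c)) / ((\<kappa> + c) * (2 * (\<kappa> - c)))"
      unfolding det by (simp add: algebra_simps power2_eq_square)
    also have "\<dots> = - d\<^sup>2 / (\<kappa> + c)" using kc
      by (intro mult_divide_mult_cancel_right) simp
    finally have e: "- (\<kappa> * d\<^sup>2 - 2 * c * d * d + \<kappa> * d\<^sup>2) / (2 * (\<kappa> * \<kappa> - c\<^sup>2)) = - d\<^sup>2 / (\<kappa> + c)" .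
    have "- d\<^sup>2 / (\<kappa> + c) - - (d - 0)\<^sup>2 / (2 * \<kappa>) = - (A * d\<^sup>2 - 2 * 0 * d + 0) / 2"
      using assms kc by (simp add: A_def divide_simps) (simp add: algebra_simps)
    then have "exp (- (A * d\<^sup>2 - 2 * 0 * d + 0) / 2) = exp (- d\<^sup>2 / (\<kappa> + c)) / exp (- (d - 0)\<^sup>2 / (2 * \<kappa>))"
      by (metis exp_diff)
    then show ?thesis
      unfolding binormal_density_def normal_density_sqrt[OF assms(1)] e K_def by simp
  qed
  have "(\<integral>\<^sup>+d. ennreal (binormal_density \<kappa> \<kappa> c d d / normal_density 0 (sqrt \<kappa>) d) \<partial>lborel)
      = ennreal (K * (sqrt (2 * pi / A) * exp ((0\<^sup>2 / A - 0) / 2)))"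
    using assms by (intro nn_integral_exp_quadratic_cmult[OF A _ f]) (simp add: K_def)
  also have "K * (sqrt (2 * pi / A) * exp ((0\<^sup>2 / A - 0) / 2)) = \<kappa> / (\<kappa> - c)"
  proof -
    have "sqrt (2 * pi / A) = sqrt (2 * pi * (\<kappa> * (\<kappa> + c) / (\<kappa> - c)))"
      by (simp add: A_def)
    then have "K * sqrt (2 * pi / A) = sqrt (\<kappa> * (\<kappa> * (\<kappa> + c) / (\<kappa> - c))) / sqrt (\<kappa> * \<kappa> - c\<^sup>2)"
      using sqrt_two_pi_mult[of \<kappa> "\<kappa> * (\<kappa> + c) / (\<kappa> - c)"] by (simp add: K_def)
    also have "\<dots> = sqrt ((\<kappa> / (\<kappa> - c))\<^sup>2)"
      unfolding real_sqrt_divide[symmetric] det using kc by (simp add: power2_eq_square)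
    also have "\<dots> = \<kappa> / (\<kappa> - c)" using assms kc by simp
    finally show ?thesis by simp
  qed
  finally show ?thesis .
qed

text \<open>
  The variance of \<open>d\<close> given \<open>x\<close> is reduced by exactly what \<open>g \<bullet> x\<close> contributes for standard normal
  \<open>x\<close>, so that \<open>d\<close> alone has law \<open>N(0, \<kappa>)\<close> in both models.  Without this compensation the
  variance of \<open>d\<close> would reveal the norm of \<open>g\<close> and the rate would be lost.
\<close>

definition gaussian_lr :: "nat \<Rightarrow> real \<Rightarrow> (nat \<Rightarrow> real) \<Rightarrow> real \<Rightarrow> (nat \<Rightarrow> real) \<Rightarrow> real" where
  "gaussian_lr p \<kappa> g d x = normal_density 0 (sqrt (\<kappa> - (\<Sum>j<p. (g j)\<^sup>2))) (d - (\<Sum>j<p. g j * x j)) / normal_density 0 (sqrt \<kappa>) d"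

lemma gaussian_lr_nonneg: "0 \<le> gaussian_lr p \<kappa> g d x"
  by (simp add: gaussian_lr_def)

lemma gaussian_lr_zero: "0 < \<kappa> \<Longrightarrow> gaussian_lr p \<kappa> (\<lambda>_. 0) d x = 1"
  using normal_density_pos[of "sqrt \<kappa>" 0 d] by (simp add: gaussian_lr_def)

lemma nn_integral_std_normal_affine:
  fixes w m :: real
  assumes [measurable]: "F \<in> borel_measurable borel" and w: "0 < w"
  shows "(\<integral>\<^sup>+e. F (m + w * e) \<partial>std_normal) = (\<integral>\<^sup>+d. F d * ennreal (normal_density m w d) \<partial>lborel)"
proof -
  have "(\<integral>\<^sup>+d. F d * ennreal (normal_density m w d) \<partial>lborel)
    = ennreal \<bar>w\<bar> * (\<integral>\<^sup>+e. F (m + w * e) * ennreal (normal_density m w (m + w * e)) \<partial>lborel)"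
    using w by (intro nn_integral_real_affine) auto
  also have "\<dots> = (\<integral>\<^sup>+e. F (m + w * e) * (ennreal w * ennreal (normal_density m w (m + w * e))) \<partial>lborel)"
    using w by (simp add: nn_integral_cmult[symmetric] mult_ac)
  also have "\<dots> = (\<integral>\<^sup>+e. ennreal (std_normal_density e) * F (m + w * e) \<partial>lborel)"
  proof (intro nn_integral_cong)
    fix e
    have "w * normal_density m w (m + w * e) = std_normal_density e"
      using w by (simp add: normal_density_def real_sqrt_mult power_mult_distrib)
    then have "ennreal w * ennreal (normal_density m w (m + w * e)) = ennreal (std_normal_density e)"
      using w by (simp flip: ennreal_mult)
    then show "F (m + w * e) * (ennreal w * ennreal (normal_density m w (m + w * e))) = ennreal (std_normal_density e) * F (m + w * e)"
      by (simp add: mult.commute)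
  qed
  also have "\<dots> = (\<integral>\<^sup>+e. F (m + w * e) \<partial>std_normal)"
    by (subst nn_integral_density) auto
  finally show ?thesis by simp
qed

lemma prob_space_std_normal_PiM: "prob_space (PiM I (\<lambda>_. std_normal))"
  by (intro prob_space_PiM prob_space_normal_density) simp

text \<open>
  Given \<open>d\<close>, which is independent of the coordinates that \<open>g\<close> and \<open>g'\<close> use, the product of the two
  densities is integrated over the design by \<open>nn_integral_normal_product\<close>; this restores both variances
  to \<open>\<kappa>\<close> and leaves the covariance \<open>g \<bullet> g'\<close>.
\<close>

lemma gaussian_lr_inner_product:
  fixes h g g' :: "nat \<Rightarrow> real"
  assumes w: "0 < w" and \<kappa>: "\<kappa> = w\<^sup>2 + (\<Sum>j<p. (h j)\<^sup>2)"
    and g: "(\<Sum>j<p. (g j)\<^sup>2) < \<kappa>" and g': "(\<Sum>j<p. (g' j)\<^sup>2) < \<kappa>"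
    and orth: "\<And>j. j < p \<Longrightarrow> h j = 0 \<or> g j = 0 \<and> g' j = 0"
  shows "(\<integral>\<^sup>+x. \<integral>\<^sup>+e. ennreal (gaussian_lr p \<kappa> g ((\<Sum>j<p. h j * x j) + w * e) x *
        gaussian_lr p \<kappa> g' ((\<Sum>j<p. h j * x j) + w * e) x) \<partial>std_normal \<partial>PiM {..<p} (\<lambda>_. std_normal))
    = ennreal (\<kappa> / (\<kappa> - (\<Sum>j<p. g j * g' j)))"
    and "(\<Sum>j<p. g j * g' j) < \<kappa>"
proof -
  let ?P = "PiM {..<p} (\<lambda>_. std_normal) :: (nat \<Rightarrow> real) measure"
  interpret P: prob_space ?P by (rule prob_space_std_normal_PiM)
  interpret PL: pair_sigma_finite ?P "lborel :: real measure" ..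
  let ?G = "\<Sum>j<p. (g j)\<^sup>2" and ?G' = "\<Sum>j<p. (g' j)\<^sup>2" and ?c = "\<Sum>j<p. g j * g' j"
  have k0: "0 < \<kappa>" unfolding \<kappa> using w by (simp add: add_pos_nonneg sum_nonneg)
  have cs: "?c\<^sup>2 \<le> ?G * ?G'" using Cauchy_Schwarz_ineq_sum[of g g' "{..<p}"] .
  have GG: "0 \<le> ?G" "0 \<le> ?G'" by (simp_all add: sum_nonneg)
  have "?G * ?G' < \<kappa> * \<kappa>" using GG g g' by (intro mult_strict_mono') auto
  then have det: "0 < \<kappa> * \<kappa> - ?c\<^sup>2" using cs by linarith
  have "\<bar>?c\<bar>\<^sup>2 < \<kappa>\<^sup>2" using det unfolding power2_abs power2_eq_square[of \<kappa>] by linarith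
  then have "\<bar>?c\<bar> < \<kappa>" using less_imp_le[OF k0] by (rule power2_less_imp_less)
  then show "?c < \<kappa>" by linarith
  let ?N = "normal_density 0 (sqrt \<kappa>)"
  have Np: "0 < ?N d" for d using k0 by (simp add: normal_density_pos)
  let ?hx = "\<lambda>x. \<Sum>j<p. h j * x j"
  let ?B = "\<lambda>x d. binormal_density (\<kappa> - ?G) (\<kappa> - ?G') 0 (d - (\<Sum>j<p. g j * x j)) (d - (\<Sum>j<p. g' j * x j))"
  have B0: "0 \<le> ?B x d" for x d using g g' by (intro binormal_nonneg) simp
  have lr2: "gaussian_lr p \<kappa> g d x * gaussian_lr p \<kappa> g' d x = ?B x d / (?N d * ?N d)" for d x
    using g g' by (simp add: gaussian_lr_def binormal_independent)
  have "(\<integral>\<^sup>+x. \<integral>\<^sup>+e. ennreal (gaussian_lr p \<kappa> g (?hx x + w * e) x * gaussian_lr p \<kappa> g' (?hx x + w * e) x) \<partial>std_normal \<partial>?P)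
    = (\<integral>\<^sup>+x. \<integral>\<^sup>+d. ennreal (?B x d / (?N d * ?N d)) * ennreal (normal_density (?hx x) w d) \<partial>lborel \<partial>?P)"
    unfolding lr2 using w by (intro nn_integral_cong nn_integral_std_normal_affine) auto
  also have "\<dots> = (\<integral>\<^sup>+x. \<integral>\<^sup>+d. ennreal (1 / (?N d * ?N d)) *
      ennreal (normal_density 0 (sqrt (w\<^sup>2)) (d - ?hx x) * ?B x d) \<partial>lborel \<partial>?P)"
  proof (intro nn_integral_cong)
    fix x :: "nat \<Rightarrow> real" and d :: real
    have "normal_density (?hx x) w d = normal_density 0 (sqrt (w\<^sup>2)) (d - ?hx x)"
      using w by (simp add: normal_density_def)
    then show "ennreal (?B x d / (?N d * ?N d)) * ennreal (normal_density (?hx x) w d)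
      = ennreal (1 / (?N d * ?N d)) * ennreal (normal_density 0 (sqrt (w\<^sup>2)) (d - ?hx x) * ?B x d)"
      using B0[of d x] by (simp add: ennreal_mult[symmetric] divide_simps)
  qed
  also have "\<dots> = (\<integral>\<^sup>+d. \<integral>\<^sup>+x. ennreal (1 / (?N d * ?N d)) *
      ennreal (normal_density 0 (sqrt (w\<^sup>2)) (d - ?hx x) * ?B x d) \<partial>?P \<partial>lborel)"
    by (intro PL.Fubini'[symmetric]) simp
  also have "\<dots> = (\<integral>\<^sup>+d. ennreal (1 / (?N d * ?N d)) *
      ennreal (normal_density 0 (sqrt (w\<^sup>2 + (\<Sum>j<p. (h j)\<^sup>2))) d *
        binormal_density (\<kappa> - ?G + ?G) (\<kappa> - ?G' + ?G') (0 + ?c) d d) \<partial>lborel)"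
    using w g g' orth
    by (subst nn_integral_cmult, simp, subst nn_integral_normal_product) auto
  also have "\<dots> = (\<integral>\<^sup>+d. ennreal (binormal_density \<kappa> \<kappa> ?c d d / ?N d) \<partial>lborel)"
  proof (intro nn_integral_cong)
    fix d
    have "0 \<le> binormal_density \<kappa> \<kappa> ?c d d" using det by (rule binormal_nonneg)
    then have "ennreal (1 / (?N d * ?N d)) * ennreal (?N d * binormal_density \<kappa> \<kappa> ?c d d)
      = ennreal (1 / (?N d * ?N d) * (?N d * binormal_density \<kappa> \<kappa> ?c d d))"
      by (subst ennreal_mult) auto
    also have "1 / (?N d * ?N d) * (?N d * binormal_density \<kappa> \<kappa> ?c d d) = binormal_density \<kappa> \<kappa> ?c d d / ?N d"
      using Np[of d] by simp
    finally show "ennreal (1 / (?N d * ?N d)) *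
      ennreal (normal_density 0 (sqrt (w\<^sup>2 + (\<Sum>j<p. (h j)\<^sup>2))) d *
        binormal_density (\<kappa> - ?G + ?G) (\<kappa> - ?G' + ?G') (0 + ?c) d d) = ennreal (binormal_density \<kappa> \<kappa> ?c d d / ?N d)"
      unfolding \<kappa>[symmetric] by simp
  qed
  also have "\<dots> = ennreal (\<kappa> / (\<kappa> - ?c))"
    by (rule nn_integral_binormal_diagonal[OF k0 det])
  finally show "(\<integral>\<^sup>+x. \<integral>\<^sup>+e. ennreal (gaussian_lr p \<kappa> g (?hx x + w * e) x * gaussian_lr p \<kappa> g' (?hx x + w * e) x) \<partial>std_normal \<partial>?P)
    = ennreal (\<kappa> / (\<kappa> - ?c))" .
qed

section \<open>The law of the data as a product of laws of single observations\<close>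

lemma sigma_finite_density_real:
  assumes "sigma_finite_measure M" "f \<in> borel_measurable M"
  shows "sigma_finite_measure (density M (\<lambda>x. ennreal (f x)))"
  using sigma_finite_measure.sigma_finite_iff_density_finite[OF assms(1), of "\<lambda>x. ennreal (f x)"] assms(2)
  by simp

lemma PiM_density:
  assumes fin: "finite I" and ps: "product_sigma_finite M"
    and f [measurable]: "\<And>i. i \<in> I \<Longrightarrow> f i \<in> borel_measurable (M i)"
    and pd: "product_sigma_finite (\<lambda>i. density (M i) (f i))"
  shows "PiM I (\<lambda>i. density (M i) (f i)) = density (PiM I M) (\<lambda>x. \<Prod>i\<in>I. f i (x i))"
proof -
  interpret D: product_sigma_finite "\<lambda>i. density (M i) (f i)" by fact
  interpret product_sigma_finite M by fact
  have "density (PiM I M) (\<lambda>x. \<Prod>i\<in>I. f i (x i)) = PiM I (\<lambda>i. density (M i) (f i))"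
  proof (rule D.PiM_eqI[OF fin])
    show "sets (density (PiM I M) (\<lambda>x. \<Prod>i\<in>I. f i (x i))) = sets (PiM I (\<lambda>i. density (M i) (f i)))"
      by (simp cong: sets_PiM_cong)
    fix A assume "\<And>i. i \<in> I \<Longrightarrow> A i \<in> sets (density (M i) (f i))"
    then have A [measurable]: "\<And>i. i \<in> I \<Longrightarrow> A i \<in> sets (M i)" by simp
    have "(\<lambda>x. f i (x i)) \<in> borel_measurable (PiM I M)" if "i \<in> I" for i
      by (rule measurable_compose[OF measurable_component_singleton[OF that, where M=M] f[OF that]])
    then have m: "(\<lambda>x. \<Prod>i\<in>I. f i (x i)) \<in> borel_measurable (PiM I M)"
      by (intro borel_measurable_prod_ennreal)
    have "emeasure (density (PiM I M) (\<lambda>x. \<Prod>i\<in>I. f i (x i))) (Pi\<^sub>E I A)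
        = (\<integral>\<^sup>+x. (\<Prod>i\<in>I. f i (x i)) * indicator (Pi\<^sub>E I A) x \<partial>PiM I M)"
      using fin A m by (subst emeasure_density) (auto intro!: sets_PiM_I_finite)
    also have "\<dots> = (\<integral>\<^sup>+x. (\<Prod>i\<in>I. f i (x i) * indicator (A i) (x i)) \<partial>PiM I M)"
    proof (intro nn_integral_cong)
      fix x assume "x \<in> space (PiM I M)"
      then have "x \<in> extensional I" by (simp add: space_PiM PiE_def)
      then have "x \<in> Pi\<^sub>E I A \<longleftrightarrow> (\<forall>i\<in>I. x i \<in> A i)" by (auto simp: PiE_iff)
      then have "indicator (Pi\<^sub>E I A) x = (\<Prod>i\<in>I. indicator (A i) (x i) :: ennreal)"
        using fin by (auto simp: indicator_def prod_zero_iff)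
      then show "(\<Prod>i\<in>I. f i (x i)) * indicator (Pi\<^sub>E I A) x = (\<Prod>i\<in>I. f i (x i) * indicator (A i) (x i))"
        by (simp add: prod.distrib)
    qed
    also have "\<dots> = (\<Prod>i\<in>I. \<integral>\<^sup>+x. f i x * indicator (A i) x \<partial>M i)"
      using fin by (subst product_nn_integral_prod) auto
    also have "\<dots> = (\<Prod>i\<in>I. emeasure (density (M i) (f i)) (A i))"
      by (intro prod.cong refl) (simp add: emeasure_density)
    finally show "emeasure (density (PiM I M) (\<lambda>x. \<Prod>i\<in>I. f i (x i))) (Pi\<^sub>E I A)
      = (\<Prod>i\<in>I. emeasure (density (M i) (f i)) (A i))" .
  qed
  then show ?thesis by simp
qed

lemma product_sigma_finite_prob: "(\<And>i. prob_space (M i)) \<Longrightarrow> product_sigma_finite M"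
  by (intro product_sigma_finite.intro prob_space_imp_sigma_finite)

lemma mvnormal_identity: "mvnormal p (1\<^sub>m p) = PiM {..<p} (\<lambda>_. std_normal)"
proof -
  have "PiM {..<p} (\<lambda>_. std_normal) = density (PiM {..<p} (\<lambda>_. lborel)) (\<lambda>x. \<Prod>i<p. ennreal (std_normal_density (x i)))"
    by (rule PiM_density)
      (auto intro!: product_sigma_finite.intro sigma_finite_lborel sigma_finite_density_real)
  also have "(\<lambda>x. \<Prod>i<p. ennreal (std_normal_density (x i))) =
    (\<lambda>x. ennreal (sqrt (Determinant.det (1\<^sub>m p)) / sqrt (2 * pi) ^ p *
                   exp (- (vec p x \<bullet> (1\<^sub>m p *\<^sub>v vec p x)) / 2)))"
  proof
    fix x :: "nat \<Rightarrow> real"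
    have "(\<Prod>i<p. ennreal (std_normal_density (x i))) = ennreal (\<Prod>i<p. std_normal_density (x i))"
      by (rule prod_ennreal) simp
    also have "(\<Prod>i<p. std_normal_density (x i)) = (1 / sqrt (2 * pi)) ^ p * exp (\<Sum>i<p. - (x i)\<^sup>2 / 2)"
      by (simp only: std_normal_density_def prod.distrib exp_sum[OF finite_lessThan]) simp
    also have "(\<Sum>i<p. - (x i)\<^sup>2 / 2) = - (vec p x \<bullet> (1\<^sub>m p *\<^sub>v vec p x)) / 2"
      by (simp add: scalar_prod_def atLeast0LessThan power2_eq_square sum_negf sum_divide_distrib)
    finally show "(\<Prod>i<p. ennreal (std_normal_density (x i))) =
      ennreal (sqrt (Determinant.det (1\<^sub>m p)) / sqrt (2 * pi) ^ p *
                   exp (- (vec p x \<bullet> (1\<^sub>m p *\<^sub>v vec p x)) / 2))"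
      by (simp add: power_divide)
  qed
  finally show ?thesis unfolding mvnormal_def by simp
qed

abbreviation obs_space :: "nat \<Rightarrow> (real \<times> (nat \<Rightarrow> real)) measure" where
  "obs_space p \<equiv> borel \<Otimes>\<^sub>M (\<Pi>\<^sub>M j\<in>{..<p}. borel)"

definition obs_law :: "nat \<Rightarrow> param \<Rightarrow> (real \<times> (nat \<Rightarrow> real)) measure" where
  "obs_law p = (\<lambda>(\<beta>, \<Omega>, \<sigma>). distr (mvnormal p \<Omega> \<Otimes>\<^sub>M density lborel (normal_density 0 \<sigma>)) (obs_space p)
     (\<lambda>(x, e). (vec p x \<bullet> \<beta> + e, x)))"

lemma sets_mvnormal: "sets (mvnormal p \<Omega>) = sets (\<Pi>\<^sub>M j\<in>{..<p}. borel)"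
  unfolding mvnormal_def sets_density by (intro sets_PiM_cong) auto

lemma scalar_prod_vec:
  "\<beta> \<in> carrier_vec p \<Longrightarrow> vec p x \<bullet> \<beta> = (\<Sum>j<p. \<beta> $ j * (x j :: real))"
  by (auto simp: scalar_prod_def atLeast0LessThan mult.commute intro!: sum.cong)

lemma measurable_scalar_prod_vec [measurable]:
  fixes \<beta> :: "real vec"
  assumes "\<beta> \<in> carrier_vec p"
  shows "(\<lambda>x. vec p x \<bullet> \<beta>) \<in> borel_measurable (\<Pi>\<^sub>M j\<in>{..<p}. borel)"
  unfolding scalar_prod_vec[OF assms] by measurable

lemma mvnormal_density_measurable:
  fixes K :: real
  assumes "\<Omega> \<in> carrier_mat p p"
  shows "(\<lambda>x. K * exp (- (vec p x \<bullet> (\<Omega> *\<^sub>v vec p x)) / 2)) \<in> borel_measurable (\<Pi>\<^sub>M j\<in>{..<p}. borel)"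
proof -
  have "vec p x \<bullet> (\<Omega> *\<^sub>v vec p x) = (\<Sum>i<p. x i * (\<Sum>j<p. \<Omega> $$ (i,j) * x j))" for x
    using assms by (auto simp: scalar_prod_def atLeast0LessThan intro!: sum.cong)
  then show ?thesis by simp
qed

lemma sets_PiM_lborel: "sets (\<Pi>\<^sub>M j\<in>{..<p}. lborel :: real measure) = sets (\<Pi>\<^sub>M j\<in>{..<p}. borel)"
  by (intro sets_PiM_cong) auto

lemma sigma_finite_PiM_lborel: "sigma_finite_measure (PiM {..<p::nat} (\<lambda>_. lborel :: real measure))"
  by (intro product_sigma_finite.sigma_finite) (auto intro!: product_sigma_finite.intro sigma_finite_lborel)

lemma sigma_finite_mvnormal:
  assumes "\<Omega> \<in> carrier_mat p p"
  shows "sigma_finite_measure (mvnormal p \<Omega>)"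
  unfolding mvnormal_def using mvnormal_density_measurable[OF assms]
  by (intro sigma_finite_density_real sigma_finite_PiM_lborel) (simp cong: measurable_cong_sets add: sets_PiM_lborel)

lemma observe_one_measurable:
  assumes "\<beta> \<in> carrier_vec p"
  shows "(\<lambda>(x, e). (vec p x \<bullet> \<beta> + e, x)) \<in> mvnormal p \<Omega> \<Otimes>\<^sub>M density lborel (normal_density 0 \<sigma>) \<rightarrow>\<^sub>M obs_space p"
proof -
  have "sets (mvnormal p \<Omega> \<Otimes>\<^sub>M density lborel (normal_density 0 \<sigma>)) = sets ((\<Pi>\<^sub>M j\<in>{..<p}. borel) \<Otimes>\<^sub>M borel)"
    by (intro sets_pair_measure_cong) (auto simp: sets_mvnormal)
  moreover note [measurable] = measurable_scalar_prod_vec[OF assms]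
  have "(\<lambda>(x, e). (vec p x \<bullet> \<beta> + e, x)) \<in> (\<Pi>\<^sub>M j\<in>{..<p}. borel) \<Otimes>\<^sub>M borel \<rightarrow>\<^sub>M obs_space p"
    by measurable
  ultimately show ?thesis by (simp cong: measurable_cong_sets)
qed

lemma nn_integral_obs_law:
  assumes \<beta>: "\<beta> \<in> carrier_vec p" and f: "f \<in> borel_measurable (obs_space p)"
  shows "(\<integral>\<^sup>+z. f z \<partial>obs_law p (\<beta>, \<Omega>, \<sigma>))
    = (\<integral>\<^sup>+x. \<integral>\<^sup>+e. f (vec p x \<bullet> \<beta> + e, x) \<partial>density lborel (normal_density 0 \<sigma>) \<partial>mvnormal p \<Omega>)"
proof -
  interpret sigma_finite_measure "density lborel (\<lambda>x. ennreal (normal_density 0 \<sigma> x))"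
    by (intro sigma_finite_density_real sigma_finite_lborel) simp
  have m: "(\<lambda>w. f (case w of (x, e) \<Rightarrow> (vec p x \<bullet> \<beta> + e, x))) \<in> borel_measurable (mvnormal p \<Omega> \<Otimes>\<^sub>M density lborel (normal_density 0 \<sigma>))"
    by (rule measurable_compose[OF observe_one_measurable[OF \<beta>] f])
  show ?thesis
    unfolding obs_law_def using observe_one_measurable[OF \<beta>] f
    by (simp add: nn_integral_distr nn_integral_fst[OF m, symmetric])
qed

text \<open>
  The model draws all rows and then all errors; regrouping them by observation makes it a product
  of \<open>n\<close> laws.  It suffices to compare boxes, on which both sides are iterated integrals of products.
\<close>

lemma model_eq_PiM:
  assumes \<beta>: "\<beta> \<in> carrier_vec p" and \<Omega>: "\<Omega> \<in> carrier_mat p p"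
    and ps: "prob_space (obs_law p (\<beta>, \<Omega>, \<sigma>))"
  shows "model n p (\<beta>, \<Omega>, \<sigma>) = PiM {..<n} (\<lambda>_. obs_law p (\<beta>, \<Omega>, \<sigma>))"
proof -
  let ?N = "density lborel (\<lambda>x. ennreal (normal_density 0 \<sigma> x))"
  let ?Q = "obs_law p (\<beta>, \<Omega>, \<sigma>)"
  have sN: "sigma_finite_measure ?N"
    by (intro sigma_finite_density_real sigma_finite_lborel) simp
  interpret Q: product_sigma_finite "\<lambda>_::nat. ?Q"
    by (intro product_sigma_finite_prob ps)
  interpret X: product_sigma_finite "\<lambda>_::nat. mvnormal p \<Omega>"
    by (intro product_sigma_finite.intro sigma_finite_mvnormal \<Omega>)
  interpret E: product_sigma_finite "\<lambda>_::nat. ?N"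
    by (intro product_sigma_finite.intro sN)
  let ?X = "PiM {..<n} (\<lambda>_. mvnormal p \<Omega>)" and ?E = "PiM {..<n} (\<lambda>_. ?N)"
  interpret ES: sigma_finite_measure ?E by (intro E.sigma_finite) simp
  have sQ: "sets ?Q = sets (obs_space p)" by (simp add: obs_law_def)
  note om = observe_measurable[OF \<beta>, of n \<Omega> \<sigma>]
  show ?thesis
  proof (rule Q.PiM_eqI)
    show "sets (model n p (\<beta>, \<Omega>, \<sigma>)) = sets (PiM {..<n} (\<lambda>_. ?Q))"
      using sQ by (simp add: data_space_def cong: sets_PiM_cong)
    fix A assume "\<And>i. i \<in> {..<n} \<Longrightarrow> A i \<in> sets ?Q"
    then have A: "\<And>i. i < n \<Longrightarrow> A i \<in> sets (obs_space p)" by (simp add: sQ)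
    have PA: "Pi\<^sub>E {..<n} A \<in> sets (data_space n p)"
      unfolding data_space_def using A by (intro sets_PiM_I_finite) auto
    let ?f = "\<lambda>i x e. indicator (A i) (vec p x \<bullet> \<beta> + e, x) :: ennreal"
    have fm: "(\<lambda>(x, e). ?f i x e) \<in> borel_measurable (mvnormal p \<Omega> \<Otimes>\<^sub>M ?N)" if "i < n" for i
      using measurable_compose[OF observe_one_measurable[OF \<beta>] borel_measurable_indicator[OF A[OF that]]]
      by (simp add: case_prod_unfold)
    have "emeasure (model n p (\<beta>, \<Omega>, \<sigma>)) (Pi\<^sub>E {..<n} A)
        = (\<integral>\<^sup>+z. indicator (Pi\<^sub>E {..<n} A) z \<partial>model n p (\<beta>, \<Omega>, \<sigma>))"
      using PA by simp
    also have "\<dots> = (\<integral>\<^sup>+w. indicator (Pi\<^sub>E {..<n} A) (observe n p \<beta> w) \<partial>(?X \<Otimes>\<^sub>M ?E))"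
      unfolding model.simps using om PA by (intro nn_integral_distr) simp_all
    also have "\<dots> = (\<integral>\<^sup>+X. \<integral>\<^sup>+e. indicator (Pi\<^sub>E {..<n} A) (observe n p \<beta> (X, e)) \<partial>?E \<partial>?X)"
      by (intro ES.nn_integral_fst[symmetric] measurable_compose[OF om] borel_measurable_indicator PA)
    also have "\<dots> = (\<integral>\<^sup>+X. \<integral>\<^sup>+e. (\<Prod>i<n. ?f i (X i) (e i)) \<partial>?E \<partial>?X)"
    proof (intro nn_integral_cong)
      fix X e
      have "observe n p \<beta> (X, e) \<in> Pi\<^sub>E {..<n} A \<longleftrightarrow> (\<forall>i<n. (vec p (X i) \<bullet> \<beta> + e i, X i) \<in> A i)"
        by (auto simp: observe_def PiE_iff)
      then show "indicator (Pi\<^sub>E {..<n} A) (observe n p \<beta> (X, e)) = (\<Prod>i<n. ?f i (X i) (e i))"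
        by (auto simp: indicator_def prod_zero_iff)
    qed
    also have "\<dots> = (\<integral>\<^sup>+X. (\<Prod>i<n. \<integral>\<^sup>+e. ?f i (X i) e \<partial>?N) \<partial>?X)"
    proof (intro nn_integral_cong)
      fix X assume X: "X \<in> space ?X"
      show "(\<integral>\<^sup>+e. (\<Prod>i<n. ?f i (X i) (e i)) \<partial>?E) = (\<Prod>i<n. \<integral>\<^sup>+e. ?f i (X i) e \<partial>?N)"
      proof (rule E.product_nn_integral_prod)
        fix i assume i: "i \<in> {..<n}"
        then have "X i \<in> space (mvnormal p \<Omega>)" using X by (auto simp: space_PiM)
        then show "?f i (X i) \<in> borel_measurable ?N"
          using measurable_Pair2[OF fm, of i "X i"] i by simp
      qed simp
    qed
    also have "\<dots> = (\<Prod>i<n. \<integral>\<^sup>+x. \<integral>\<^sup>+e. ?f i x e \<partial>?N \<partial>mvnormal p \<Omega>)"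
      using fm by (intro X.product_nn_integral_prod sigma_finite_measure.borel_measurable_nn_integral[OF sN]) auto
    also have "\<dots> = (\<Prod>i<n. emeasure ?Q (A i))"
    proof (intro prod.cong refl)
      fix i assume "i \<in> {..<n}"
      then have Ai: "A i \<in> sets (obs_space p)" using A by simp
      have "emeasure ?Q (A i) = (\<integral>\<^sup>+z. indicator (A i) z \<partial>?Q)" using Ai sQ by simp
      also have "\<dots> = (\<integral>\<^sup>+x. \<integral>\<^sup>+e. ?f i x e \<partial>?N \<partial>mvnormal p \<Omega>)"
        using Ai by (intro nn_integral_obs_law[OF \<beta>]) simp
      finally show "(\<integral>\<^sup>+x. \<integral>\<^sup>+e. ?f i x e \<partial>?N \<partial>mvnormal p \<Omega>) = emeasure ?Q (A i)" by simp
    qed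
    finally show "emeasure (model n p (\<beta>, \<Omega>, \<sigma>)) (Pi\<^sub>E {..<n} A) = (\<Prod>i<n. emeasure ?Q (A i))" .
  qed simp
qed

definition obs_density :: "nat \<Rightarrow> param \<Rightarrow> real \<Rightarrow> (nat \<Rightarrow> real) \<Rightarrow> real" where
  "obs_density p = (\<lambda>(\<beta>, \<Omega>, \<sigma>) y x. sqrt (Determinant.det \<Omega>) / sqrt (2 * pi) ^ p *
     exp (- (vec p x \<bullet> (\<Omega> *\<^sub>v vec p x)) / 2) * normal_density 0 \<sigma> (y - vec p x \<bullet> \<beta>))"

lemma nn_integral_obs_law_lebesgue:
  assumes \<beta>: "\<beta> \<in> carrier_vec p" and \<Omega>: "\<Omega> \<in> carrier_mat p p" and f: "f \<in> borel_measurable (obs_space p)"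
    and pos: "0 \<le> Determinant.det \<Omega>"
  shows "(\<integral>\<^sup>+z. f z \<partial>obs_law p (\<beta>, \<Omega>, \<sigma>))
    = (\<integral>\<^sup>+x. \<integral>\<^sup>+y. ennreal (obs_density p (\<beta>, \<Omega>, \<sigma>) y x) * f (y, x) \<partial>lborel \<partial>(\<Pi>\<^sub>M j\<in>{..<p}. lborel))"
proof -
  let ?K = "\<lambda>x. sqrt (Determinant.det \<Omega>) / sqrt (2 * pi) ^ p * exp (- (vec p x \<bullet> (\<Omega> *\<^sub>v vec p x)) / 2)"
  let ?L = "\<Pi>\<^sub>M j\<in>{..<p}. lborel :: real measure"
  let ?N = "density lborel (\<lambda>x. ennreal (normal_density 0 \<sigma> x))"
  interpret N: sigma_finite_measure ?N
    by (intro sigma_finite_density_real sigma_finite_lborel) simp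
  have m: "(\<lambda>w. f (case w of (x, e) \<Rightarrow> (vec p x \<bullet> \<beta> + e, x))) \<in> borel_measurable (mvnormal p \<Omega> \<Otimes>\<^sub>M ?N)"
    by (rule measurable_compose[OF observe_one_measurable[OF \<beta>] f])
  then have m1: "(\<lambda>x. \<integral>\<^sup>+e. f (vec p x \<bullet> \<beta> + e, x) \<partial>?N) \<in> borel_measurable (mvnormal p \<Omega>)"
    by (intro N.borel_measurable_nn_integral) (simp add: case_prod_beta)
  have Km: "?K \<in> borel_measurable ?L"
    using mvnormal_density_measurable[OF \<Omega>] by (simp cong: measurable_cong_sets add: sets_PiM_lborel)
  have "(\<integral>\<^sup>+z. f z \<partial>obs_law p (\<beta>, \<Omega>, \<sigma>)) = (\<integral>\<^sup>+x. \<integral>\<^sup>+e. f (vec p x \<bullet> \<beta> + e, x) \<partial>?N \<partial>mvnormal p \<Omega>)"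
    by (rule nn_integral_obs_law[OF \<beta> f])
  also have "\<dots> = (\<integral>\<^sup>+x. ennreal (?K x) * (\<integral>\<^sup>+e. f (vec p x \<bullet> \<beta> + e, x) \<partial>?N) \<partial>?L)"
    using m1 Km unfolding mvnormal_def by (subst nn_integral_density) (simp_all cong: measurable_cong_sets)
  also have "\<dots> = (\<integral>\<^sup>+x. \<integral>\<^sup>+y. ennreal (obs_density p (\<beta>, \<Omega>, \<sigma>) y x) * f (y, x) \<partial>lborel \<partial>?L)"
  proof (intro nn_integral_cong)
    fix x assume "x \<in> space ?L"
    then have x: "x \<in> space (\<Pi>\<^sub>M j\<in>{..<p}. borel)" by (simp add: space_PiM)
    have [measurable]: "(\<lambda>y. f (y, x)) \<in> borel_measurable borel"
      using measurable_Pair1[OF f x] .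
    have "(\<integral>\<^sup>+e. f (vec p x \<bullet> \<beta> + e, x) \<partial>?N) = (\<integral>\<^sup>+e. ennreal (normal_density 0 \<sigma> e) * f (vec p x \<bullet> \<beta> + e, x) \<partial>lborel)"
      by (rule nn_integral_density) measurable
    also have "\<dots> = (\<integral>\<^sup>+y. ennreal (normal_density 0 \<sigma> (y - vec p x \<bullet> \<beta>)) * f (y, x) \<partial>lborel)"
      by (subst nn_integral_real_affine[where c=1 and t="vec p x \<bullet> \<beta>"]) auto
    finally have "ennreal (?K x) * (\<integral>\<^sup>+e. f (vec p x \<bullet> \<beta> + e, x) \<partial>?N)
       = (\<integral>\<^sup>+y. ennreal (?K x) * (ennreal (normal_density 0 \<sigma> (y - vec p x \<bullet> \<beta>)) * f (y, x)) \<partial>lborel)"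
      by (simp add: nn_integral_cmult)
    moreover have "ennreal (obs_density p (\<beta>, \<Omega>, \<sigma>) y x)
        = ennreal (?K x) * ennreal (normal_density 0 \<sigma> (y - vec p x \<bullet> \<beta>))" for y
      unfolding obs_density_def prod.case using pos by (intro ennreal_mult) simp_all
    ultimately show "ennreal (?K x) * (\<integral>\<^sup>+e. f (vec p x \<bullet> \<beta> + e, x) \<partial>?N)
       = (\<integral>\<^sup>+y. ennreal (obs_density p (\<beta>, \<Omega>, \<sigma>) y x) * f (y, x) \<partial>lborel)"
      by (simp add: mult.assoc)
  qed
  finally show ?thesis .
qed

text \<open>
  The alternative is represented by a density with respect to the null itself, as this is the form in which
  likelihood ratios multiply over observations.
\<close>

lemma obs_law_eq_density:
  assumes \<beta>: "\<beta> \<in> carrier_vec p" and \<Omega>: "\<Omega> \<in> carrier_mat p p" "0 \<le> Determinant.det \<Omega>"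
    and \<beta>': "\<beta>' \<in> carrier_vec p" and \<Omega>': "\<Omega>' \<in> carrier_mat p p" "0 \<le> Determinant.det \<Omega>'"
    and l [measurable]: "l \<in> borel_measurable (obs_space p)" and l0: "\<And>z. 0 \<le> l z"
    and eq: "\<And>y x. obs_density p (\<beta>', \<Omega>', \<sigma>') y x = obs_density p (\<beta>, \<Omega>, \<sigma>) y x * l (y, x)"
  shows "obs_law p (\<beta>', \<Omega>', \<sigma>') = density (obs_law p (\<beta>, \<Omega>, \<sigma>)) (\<lambda>z. ennreal (l z))"
proof (rule measure_eqI)
  show "sets (obs_law p (\<beta>', \<Omega>', \<sigma>')) = sets (density (obs_law p (\<beta>, \<Omega>, \<sigma>)) (\<lambda>z. ennreal (l z)))"
    by (simp add: obs_law_def)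
  fix A assume "A \<in> sets (obs_law p (\<beta>', \<Omega>', \<sigma>'))"
  then have A [measurable]: "A \<in> sets (obs_space p)" by (simp add: obs_law_def)
  have ge: "0 \<le> obs_density p (\<beta>, \<Omega>, \<sigma>) y x" for y x
    using \<Omega> by (simp add: obs_density_def)
  have "emeasure (obs_law p (\<beta>', \<Omega>', \<sigma>')) A = (\<integral>\<^sup>+z. indicator A z \<partial>obs_law p (\<beta>', \<Omega>', \<sigma>'))"
    using A by (simp add: obs_law_def)
  also have "\<dots> = (\<integral>\<^sup>+x. \<integral>\<^sup>+y. ennreal (obs_density p (\<beta>', \<Omega>', \<sigma>') y x) * indicator A (y, x) \<partial>lborel \<partial>(\<Pi>\<^sub>M j\<in>{..<p}. lborel))"
    by (intro nn_integral_obs_law_lebesgue \<beta>' \<Omega>') measurable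
  also have "\<dots> = (\<integral>\<^sup>+x. \<integral>\<^sup>+y. ennreal (obs_density p (\<beta>, \<Omega>, \<sigma>) y x) * (ennreal (l (y, x)) * indicator A (y, x)) \<partial>lborel \<partial>(\<Pi>\<^sub>M j\<in>{..<p}. lborel))"
    unfolding eq using ge l0 by (simp add: ennreal_mult mult.assoc)
  also have "\<dots> = (\<integral>\<^sup>+z. ennreal (l z) * indicator A z \<partial>obs_law p (\<beta>, \<Omega>, \<sigma>))"
    by (intro nn_integral_obs_law_lebesgue[symmetric] \<beta> \<Omega>) measurable
  also have "\<dots> = emeasure (density (obs_law p (\<beta>, \<Omega>, \<sigma>)) (\<lambda>z. ennreal (l z))) A"
    using A l by (subst emeasure_density) (simp_all add: obs_law_def)
  finally show "emeasure (obs_law p (\<beta>', \<Omega>', \<sigma>')) A = emeasure (density (obs_law p (\<beta>, \<Omega>, \<sigma>)) (\<lambda>z. ennreal (l z))) A" .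
qed

section \<open>From indistinguishable mixtures to the length of confidence intervals\<close>

text \<open>
  With \<open>L\<close> the average of the \<open>l i\<close>, the probability of \<open>A\<close> under the mixture exceeds the one under \<open>M\<close>
  by at most the integral of \<open>(L - 1) 1\<^sub>A\<close>, and \<open>(L - 1) 1\<^sub>A \<le> h / 2 + (L - 1)\<^sup>2 / (2 h)\<close>.
\<close>

lemma mixture_probability_le:
  fixes l :: "'i \<Rightarrow> 'a \<Rightarrow> real" and w :: "'i \<Rightarrow> 'i \<Rightarrow> real"
  assumes "prob_space M" and F: "finite F" "F \<noteq> {}" and h: "0 < h"
    and l [measurable]: "\<And>i. i \<in> F \<Longrightarrow> l i \<in> borel_measurable M" and l0: "\<And>i z. 0 \<le> l i z"
    and l1: "\<And>i. i \<in> F \<Longrightarrow> (\<integral>\<^sup>+z. ennreal (l i z) \<partial>M) = 1"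
    and l2: "\<And>i j. i \<in> F \<Longrightarrow> j \<in> F \<Longrightarrow> (\<integral>\<^sup>+z. ennreal (l i z * l j z) \<partial>M) = ennreal (w i j)"
    and w0: "\<And>i j. i \<in> F \<Longrightarrow> j \<in> F \<Longrightarrow> 0 \<le> w i j"
    and chi: "(\<Sum>i\<in>F. \<Sum>j\<in>F. w i j) \<le> (1 + h\<^sup>2) * (real (card F))\<^sup>2"
    and A [measurable]: "A \<in> sets M"
    and cov: "\<And>i. i \<in> F \<Longrightarrow> ennreal q \<le> emeasure (density M (\<lambda>z. ennreal (l i z))) A"
  shows "q - h \<le> measure M A"
proof -
  interpret prob_space M by fact
  let ?N = "real (card F)"
  have N: "0 < ?N" using F by (simp add: card_gt_0_iff)
  define L where "L z = (\<Sum>i\<in>F. l i z) / ?N" for z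
  have i1: "has_bochner_integral M (l i) 1" if "i \<in> F" for i
    using l1[OF that] l0 l[OF that] by (intro has_bochner_integral_nn_integral) auto
  have i2: "has_bochner_integral M (\<lambda>z. l i z * l j z) (w i j)" if "i \<in> F" "j \<in> F" for i j
    using l2[OF that] l0 l that w0[OF that] by (intro has_bochner_integral_nn_integral) auto
  have "has_bochner_integral M (\<lambda>z. (\<Sum>i\<in>F. l i z) / ?N) ((\<Sum>i\<in>F. 1) / ?N)"
    by (intro has_bochner_integral_divide_zero has_bochner_integral_sum i1)
  then have L1: "has_bochner_integral M L 1" using N by (simp add: L_def[abs_def])
  have "has_bochner_integral M (\<lambda>z. (\<Sum>i\<in>F. \<Sum>j\<in>F. l i z * l j z) / ?N\<^sup>2) ((\<Sum>i\<in>F. \<Sum>j\<in>F. w i j) / ?N\<^sup>2)"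
    by (intro has_bochner_integral_divide_zero has_bochner_integral_sum i2)
  then have L2: "has_bochner_integral M (\<lambda>z. (L z)\<^sup>2) ((\<Sum>i\<in>F. \<Sum>j\<in>F. w i j) / ?N\<^sup>2)"
    by (simp add: L_def[abs_def] power_divide power2_eq_square sum_product)
  have V: "(\<Sum>i\<in>F. \<Sum>j\<in>F. w i j) / ?N\<^sup>2 \<le> 1 + h\<^sup>2"
    using chi N by (simp add: divide_le_eq)
  have iA: "integrable M (\<lambda>z. l i z * indicator A z)" if "i \<in> F" for i
    using integrable_mult_indicator[OF A, of "l i"] i1[OF that] by (simp add: has_bochner_integral_iff mult.commute)
  have "q \<le> (\<integral>z. l i z * indicator A z \<partial>M)" if "i \<in> F" for i
  proof -
    have "emeasure (density M (\<lambda>z. ennreal (l i z))) A = (\<integral>\<^sup>+z. ennreal (l i z * indicator A z) \<partial>M)"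
      using l[OF that] l0 by (subst emeasure_density) (auto simp: ennreal_mult ennreal_indicator)
    also have "\<dots> = ennreal (\<integral>z. l i z * indicator A z \<partial>M)"
      using iA[OF that] l0 by (intro nn_integral_eq_integral) auto
    finally show ?thesis
      using cov[OF that] l0 by (simp add: ennreal_le_iff integral_nonneg)
  qed
  then have "(\<Sum>i\<in>F. q) \<le> (\<Sum>i\<in>F. \<integral>z. l i z * indicator A z \<partial>M)" by (intro sum_mono)
  also have "\<dots> = (\<integral>z. (\<Sum>i\<in>F. l i z * indicator A z) \<partial>M)"
    using iA by (intro Bochner_Integration.integral_sum[symmetric])
  also have "\<dots> = (\<integral>z. ?N * (L z * indicator A z) \<partial>M)"
    using N by (simp add: L_def sum_distrib_right)
  also have "\<dots> = ?N * (\<integral>z. L z * indicator A z \<partial>M)" by simp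
  finally have q: "q \<le> (\<integral>z. L z * indicator A z \<partial>M)" using N by simp
  have iL: "integrable M L" "integrable M (\<lambda>z. (L z)\<^sup>2)" using L1 L2 by (auto simp: has_bochner_integral_iff)
  have iLA: "integrable M (\<lambda>z. L z * indicator A z)"
    using integrable_mult_indicator[OF A iL(1)] by (simp add: mult.commute)
  have iI: "integrable M (indicator A :: _ \<Rightarrow> real)"
    using A by (simp add: emeasure_eq_measure)
  have pt: "(L z - 1) * indicator A z \<le> h / 2 + ((L z)\<^sup>2 - 2 * L z + 1) / (2 * h)" for z
  proof -
    have "0 \<le> (L z - 1 - h)\<^sup>2 / (2 * h)" using h by simp
    also have "\<dots> = h / 2 + ((L z)\<^sup>2 - 2 * L z + 1) / (2 * h) - (L z - 1)"
      using h by (simp add: field_simps power2_eq_square)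
    finally have "L z - 1 \<le> h / 2 + ((L z)\<^sup>2 - 2 * L z + 1) / (2 * h)" by simp
    moreover have "0 \<le> (L z - 1)\<^sup>2 / (2 * h)" using h by simp
    then have "0 \<le> h / 2 + ((L z)\<^sup>2 - 2 * L z + 1) / (2 * h)"
      using h by (simp add: power2_eq_square algebra_simps)
    ultimately show ?thesis by (simp split: split_indicator)
  qed
  have "(\<integral>z. L z * indicator A z \<partial>M) - measure M A = (\<integral>z. L z * indicator A z - indicator A z \<partial>M)"
    using iLA iI A by simp
  also have "\<dots> \<le> (\<integral>z. h / 2 + ((L z)\<^sup>2 - 2 * L z + 1) / (2 * h) \<partial>M)"
    using pt iLA iI iL by (intro integral_mono) (auto simp: algebra_simps)
  also have "\<dots> = h / 2 + ((\<Sum>i\<in>F. \<Sum>j\<in>F. w i j) / ?N\<^sup>2 - 2 * 1 + 1) / (2 * h)"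
    using iL L1 L2 by (simp add: has_bochner_integral_iff prob_space)
  also have "\<dots> \<le> h / 2 + h\<^sup>2 / (2 * h)"
    using h V by (intro add_left_mono divide_right_mono) auto
  also have "\<dots> = h" using h by (simp add: power2_eq_square)
  finally show ?thesis using q by simp
qed

text \<open>
  Under \<open>\<theta>\<^sub>0\<close> the interval contains \<open>T \<beta>\<^sub>0\<close> with probability \<open>1 - \<alpha>\<close>.  Each \<open>\<theta>\<^sub>i\<close> gives the same
  guarantee for \<open>t\<close>, which by \<open>mixture_probability_le\<close> carries over to \<open>\<theta>\<^sub>0\<close> at the price \<open>h\<close>.
  On the intersection of both events the interval is at least as long as the distance between the two values.
\<close>

lemma minimax_length_ge_mixture:
  fixes l :: "'i \<Rightarrow> data \<Rightarrow> real"
  assumes \<theta>0: "(\<beta>\<^sub>0, \<Omega>\<^sub>0, \<sigma>\<^sub>0) \<in> \<Theta>\<^sub>1" "(\<beta>\<^sub>0, \<Omega>\<^sub>0, \<sigma>\<^sub>0) \<in> \<Theta>"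
    and ps: "prob_space (model n p (\<beta>\<^sub>0, \<Omega>\<^sub>0, \<sigma>\<^sub>0))"
    and \<theta>: "\<And>i. i \<in> F \<Longrightarrow> (\<beta> i, \<Omega> i, \<sigma> i) \<in> \<Theta>" "\<And>i. i \<in> F \<Longrightarrow> T (\<beta> i) = t"
    and model: "\<And>i. i \<in> F \<Longrightarrow> model n p (\<beta> i, \<Omega> i, \<sigma> i) = density (model n p (\<beta>\<^sub>0, \<Omega>\<^sub>0, \<sigma>\<^sub>0)) (\<lambda>z. ennreal (l i z))"
    and F: "finite F" "F \<noteq> {}" and h: "0 < h" and \<alpha>: "\<alpha> < 1"
    and l: "\<And>i. i \<in> F \<Longrightarrow> l i \<in> borel_measurable (data_space n p)" and l0: "\<And>i z. 0 \<le> l i z"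
    and l1: "\<And>i. i \<in> F \<Longrightarrow> (\<integral>\<^sup>+z. ennreal (l i z) \<partial>model n p (\<beta>\<^sub>0, \<Omega>\<^sub>0, \<sigma>\<^sub>0)) = 1"
    and l2: "\<And>i j. i \<in> F \<Longrightarrow> j \<in> F \<Longrightarrow> (\<integral>\<^sup>+z. ennreal (l i z * l j z) \<partial>model n p (\<beta>\<^sub>0, \<Omega>\<^sub>0, \<sigma>\<^sub>0)) = ennreal (w i j)"
    and w0: "\<And>i j. i \<in> F \<Longrightarrow> j \<in> F \<Longrightarrow> 0 \<le> w i j"
    and chi: "(\<Sum>i\<in>F. \<Sum>j\<in>F. w i j) \<le> (1 + h\<^sup>2) * (real (card F))\<^sup>2"
  shows "ennreal (\<bar>t - T \<beta>\<^sub>0\<bar> * (1 - 2 * \<alpha> - h)) \<le> minimax_length n p \<alpha> \<Theta>\<^sub>1 \<Theta> T"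
  unfolding minimax_length_def
proof (rule INF_greatest, clarify)
  fix lo up assume ci: "(lo, up) \<in> conf_intervals n p \<alpha> \<Theta> T"
  let ?M = "model n p (\<beta>\<^sub>0, \<Omega>\<^sub>0, \<sigma>\<^sub>0)"
  interpret prob_space ?M by (rule ps)
  have sM: "sets ?M = sets (data_space n p)" by simp
  have [measurable]: "lo \<in> borel_measurable (data_space n p)" "up \<in> borel_measurable (data_space n p)"
    using ci by (auto simp: conf_intervals_def)
  have cov: "ennreal (1 - \<alpha>) \<le> emeasure (model n p (b, O', s)) {z \<in> space (data_space n p). lo z \<le> T b \<and> T b \<le> up z}"
      if "(b, O', s) \<in> \<Theta>" for b O' s
    using ci that by (auto simp: conf_intervals_def le_INF_iff)
  define E where "E s = {z \<in> space (data_space n p). lo z \<le> s \<and> s \<le> up z}" for s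
  have E: "E s \<in> sets ?M" for s unfolding E_def sM by measurable
  have "1 - \<alpha> \<le> measure ?M (E (T \<beta>\<^sub>0))"
    using cov[OF \<theta>0(2)] \<alpha> unfolding E_def[symmetric] by (simp add: emeasure_eq_measure del: model.simps)
  moreover have "1 - \<alpha> - h \<le> measure ?M (E t)"
  proof (rule mixture_probability_le[OF ps F h _ l0 l1 l2 w0 chi E])
    fix i assume i: "i \<in> F"
    show "l i \<in> borel_measurable ?M" using l[OF i] sM by (simp cong: measurable_cong_sets)
    show "ennreal (1 - \<alpha>) \<le> emeasure (density ?M (\<lambda>z. ennreal (l i z))) (E t)"
      using cov[OF \<theta>(1)[OF i]] unfolding \<theta>(2)[OF i] model[OF i] E_def .
  qed
  moreover have "measure ?M (E (T \<beta>\<^sub>0)) + measure ?M (E t) \<le> 1 + measure ?M (E (T \<beta>\<^sub>0) \<inter> E t)"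
  proof -
    have "measure ?M (E (T \<beta>\<^sub>0) \<union> E t) = measure ?M (E (T \<beta>\<^sub>0)) + measure ?M (E t) - measure ?M (E (T \<beta>\<^sub>0) \<inter> E t)"
      using E by (intro measure_Un3) (simp_all only: fmeasurable_eq_sets)
    then show ?thesis using prob_le_1[of "E (T \<beta>\<^sub>0) \<union> E t"] by linarith
  qed
  ultimately have both: "1 - 2 * \<alpha> - h \<le> measure ?M (E (T \<beta>\<^sub>0) \<inter> E t)" by linarith
  have "ennreal (\<bar>t - T \<beta>\<^sub>0\<bar> * (1 - 2 * \<alpha> - h)) \<le> ennreal (\<bar>t - T \<beta>\<^sub>0\<bar> * measure ?M (E (T \<beta>\<^sub>0) \<inter> E t))"
    using both by (intro ennreal_leI mult_left_mono) auto
  also have "\<dots> = ennreal \<bar>t - T \<beta>\<^sub>0\<bar> * emeasure ?M (E (T \<beta>\<^sub>0) \<inter> E t)"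
    by (simp add: ennreal_mult emeasure_eq_measure del: model.simps)
  also have "\<dots> = (\<integral>\<^sup>+z. ennreal \<bar>t - T \<beta>\<^sub>0\<bar> * indicator (E (T \<beta>\<^sub>0) \<inter> E t) z \<partial>?M)"
    using E by (intro nn_integral_cmult_indicator[symmetric] sets.Int)
  also have "\<dots> \<le> (\<integral>\<^sup>+z. ennreal (up z - lo z) \<partial>?M)"
    by (intro nn_integral_mono) (auto simp: E_def abs_if intro!: ennreal_leI split: split_indicator)
  also have "\<dots> \<le> (SUP \<theta>\<in>\<Theta>\<^sub>1. \<integral>\<^sup>+z. ennreal (up z - lo z) \<partial>model n p \<theta>)"
    by (rule SUP_upper[OF \<theta>0(1)])
  finally show "ennreal (\<bar>t - T \<beta>\<^sub>0\<bar> * (1 - 2 * \<alpha> - h)) \<le> (SUP \<theta>\<in>\<Theta>\<^sub>1. \<integral>\<^sup>+z. ennreal (up z - lo z) \<partial>model n p \<theta>)" .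
qed

lemma nn_integral_obs_law_identity:
  assumes \<beta>: "\<beta> \<in> carrier_vec p" and f: "f \<in> borel_measurable (obs_space p)" and \<sigma>: "0 < \<sigma>"
  shows "(\<integral>\<^sup>+z. f z \<partial>obs_law p (\<beta>, 1\<^sub>m p, \<sigma>))
    = (\<integral>\<^sup>+x. \<integral>\<^sup>+e. f (vec p x \<bullet> \<beta> + \<sigma> * e, x) \<partial>std_normal \<partial>PiM {..<p} (\<lambda>_. std_normal))"
  unfolding nn_integral_obs_law[OF \<beta> f] mvnormal_identity
proof (intro nn_integral_cong)
  fix x assume "x \<in> space (PiM {..<p} (\<lambda>_. std_normal))"
  then have x: "x \<in> space (\<Pi>\<^sub>M j\<in>{..<p}. borel)" by (simp add: space_PiM)
  have [measurable]: "(\<lambda>y. f (y, x)) \<in> borel_measurable borel"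
    using measurable_Pair1[OF f x] .
  have "(\<integral>\<^sup>+e. f (vec p x \<bullet> \<beta> + e, x) \<partial>density lborel (normal_density 0 \<sigma>))
    = (\<integral>\<^sup>+e. f (vec p x \<bullet> \<beta> + e, x) * ennreal (normal_density 0 \<sigma> e) \<partial>lborel)"
    by (subst nn_integral_density) (auto simp: mult.commute)
  also have "\<dots> = (\<integral>\<^sup>+e. f (vec p x \<bullet> \<beta> + (0 + \<sigma> * e), x) \<partial>std_normal)"
    using \<sigma> by (intro nn_integral_std_normal_affine[symmetric]) auto
  finally show "(\<integral>\<^sup>+e. f (vec p x \<bullet> \<beta> + e, x) \<partial>density lborel (normal_density 0 \<sigma>))
    = (\<integral>\<^sup>+e. f (vec p x \<bullet> \<beta> + \<sigma> * e, x) \<partial>std_normal)" by simp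
qed

lemma prob_space_obs_law_identity:
  assumes "\<beta> \<in> carrier_vec p" "0 < \<sigma>"
  shows "prob_space (obs_law p (\<beta>, 1\<^sub>m p, \<sigma>))"
proof
  interpret P: prob_space "PiM {..<p} (\<lambda>_. std_normal)" by (rule prob_space_std_normal_PiM)
  interpret S: prob_space std_normal by (rule prob_space_normal_density) simp
  have "emeasure (obs_law p (\<beta>, 1\<^sub>m p, \<sigma>)) (space (obs_law p (\<beta>, 1\<^sub>m p, \<sigma>))) = (\<integral>\<^sup>+z. 1 \<partial>obs_law p (\<beta>, 1\<^sub>m p, \<sigma>))"
    by simp
  also have "\<dots> = 1"
    using assms by (subst nn_integral_obs_law_identity) (simp_all add: P.emeasure_space_1 S.emeasure_space_1[simplified])
  finally show "emeasure (obs_law p (\<beta>, 1\<^sub>m p, \<sigma>)) (space (obs_law p (\<beta>, 1\<^sub>m p, \<sigma>))) = 1" .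
qed

text \<open>
  In the null model \<open>(y - x \<bullet> \<beta>\<^sub>0) / \<sigma>\<^sub>0\<close> is standard normal and independent of \<open>x\<close>, so the statistic
  \<open>h \<bullet> x + w (y - x \<bullet> \<beta>\<^sub>0) / \<sigma>\<^sub>0\<close> has variance \<open>\<kappa>\<close>.  It plays the role of the response that
  \<open>g i\<close> predicts under the \<open>i\<close>-th alternative, and \<open>gaussian_lr_inner_product\<close> applies.
\<close>

lemma minimax_length_ge_gaussian_mixture:
  fixes g :: "'i \<Rightarrow> nat \<Rightarrow> real" and h :: "nat \<Rightarrow> real"
  assumes \<beta>0: "\<beta>\<^sub>0 \<in> carrier_vec p" and \<sigma>0: "0 < \<sigma>\<^sub>0"
    and \<theta>0: "(\<beta>\<^sub>0, 1\<^sub>m p, \<sigma>\<^sub>0) \<in> \<Theta>\<^sub>1" "(\<beta>\<^sub>0, 1\<^sub>m p, \<sigma>\<^sub>0) \<in> \<Theta>"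
    and \<theta>: "\<And>i. i \<in> F \<Longrightarrow> (\<beta> i, \<Omega> i, \<sigma> i) \<in> \<Theta>" "\<And>i. i \<in> F \<Longrightarrow> T (\<beta> i) = t"
    and \<beta>: "\<And>i. i \<in> F \<Longrightarrow> \<beta> i \<in> carrier_vec p"
    and \<Omega>: "\<And>i. i \<in> F \<Longrightarrow> \<Omega> i \<in> carrier_mat p p" "\<And>i. i \<in> F \<Longrightarrow> 0 \<le> Determinant.det (\<Omega> i)"
    and F: "finite F" "F \<noteq> {}" and \<eta>: "0 < \<eta>" and \<alpha>: "\<alpha> < 1"
    and w: "0 < w" and \<kappa>: "\<kappa> = w\<^sup>2 + (\<Sum>j<p. (h j)\<^sup>2)"
    and g: "\<And>i. i \<in> F \<Longrightarrow> (\<Sum>j<p. (g i j)\<^sup>2) < \<kappa>"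
    and orth: "\<And>i j. i \<in> F \<Longrightarrow> j < p \<Longrightarrow> h j = 0 \<or> g i j = 0"
    and dens: "\<And>i y x. i \<in> F \<Longrightarrow> obs_density p (\<beta> i, \<Omega> i, \<sigma> i) y x = obs_density p (\<beta>\<^sub>0, 1\<^sub>m p, \<sigma>\<^sub>0) y x *
      gaussian_lr p \<kappa> (g i) ((\<Sum>j<p. h j * x j) + w * ((y - vec p x \<bullet> \<beta>\<^sub>0) / \<sigma>\<^sub>0)) x"
    and chi: "(\<Sum>i\<in>F. \<Sum>j\<in>F. (\<kappa> / (\<kappa> - (\<Sum>k<p. g i k * g j k))) ^ n) \<le> (1 + \<eta>\<^sup>2) * (real (card F))\<^sup>2"
  shows "ennreal (\<bar>t - T \<beta>\<^sub>0\<bar> * (1 - 2 * \<alpha> - \<eta>)) \<le> minimax_length n p \<alpha> \<Theta>\<^sub>1 \<Theta> T"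
proof -
  let ?Q = "obs_law p (\<beta>\<^sub>0, 1\<^sub>m p, \<sigma>\<^sub>0)"
  interpret Q: prob_space ?Q by (rule prob_space_obs_law_identity[OF \<beta>0 \<sigma>0])
  interpret QP: product_sigma_finite "\<lambda>_::nat. ?Q" by (rule product_sigma_finite_prob) unfold_locales
  have k0: "0 < \<kappa>" unfolding \<kappa> using w by (simp add: add_pos_nonneg sum_nonneg)
  have sQ: "sets ?Q = sets (obs_space p)" by (simp add: obs_law_def)
  define D where "D z = (\<Sum>j<p. h j * snd z j) + w * ((fst z - vec p (snd z) \<bullet> \<beta>\<^sub>0) / \<sigma>\<^sub>0)" for z :: "real \<times> (nat \<Rightarrow> real)"
  define r where "r f z = gaussian_lr p \<kappa> f (D z) (snd z)" for f z
  have Dm [measurable]: "D \<in> borel_measurable (obs_space p)"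
    unfolding D_def scalar_prod_vec[OF \<beta>0] by measurable
  have rm [measurable]: "r f \<in> borel_measurable (obs_space p)" for f
    unfolding r_def gaussian_lr_def by measurable
  have rmQ: "r f \<in> borel_measurable ?Q" for f
    using rm by (simp cong: measurable_cong_sets add: sQ)
  have r0: "0 \<le> r f z" for f z by (simp add: r_def gaussian_lr_nonneg)
  have rr: "(\<integral>\<^sup>+z. ennreal (r f z * r f' z) \<partial>?Q) = ennreal (\<kappa> / (\<kappa> - (\<Sum>j<p. f j * f' j)))"
    and rr0: "(\<Sum>j<p. f j * f' j) < \<kappa>"
    if "(\<Sum>j<p. (f j)\<^sup>2) < \<kappa>" "(\<Sum>j<p. (f' j)\<^sup>2) < \<kappa>" "\<And>j. j < p \<Longrightarrow> h j = 0 \<or> f j = 0 \<and> f' j = 0" for f f'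
  proof -
    have "(\<integral>\<^sup>+z. ennreal (r f z * r f' z) \<partial>?Q)
      = (\<integral>\<^sup>+x. \<integral>\<^sup>+e. ennreal (r f (vec p x \<bullet> \<beta>\<^sub>0 + \<sigma>\<^sub>0 * e, x) * r f' (vec p x \<bullet> \<beta>\<^sub>0 + \<sigma>\<^sub>0 * e, x))
          \<partial>std_normal \<partial>PiM {..<p} (\<lambda>_. std_normal))"
      using \<beta>0 \<sigma>0 by (intro nn_integral_obs_law_identity) auto
    also have "\<dots> = (\<integral>\<^sup>+x. \<integral>\<^sup>+e. ennreal (gaussian_lr p \<kappa> f ((\<Sum>j<p. h j * x j) + w * e) x *
        gaussian_lr p \<kappa> f' ((\<Sum>j<p. h j * x j) + w * e) x) \<partial>std_normal \<partial>PiM {..<p} (\<lambda>_. std_normal))"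
      using \<sigma>0 by (simp add: r_def D_def)
    finally show "(\<integral>\<^sup>+z. ennreal (r f z * r f' z) \<partial>?Q) = ennreal (\<kappa> / (\<kappa> - (\<Sum>j<p. f j * f' j)))"
      using gaussian_lr_inner_product(1)[OF w \<kappa> that] by simp
    show "(\<Sum>j<p. f j * f' j) < \<kappa>" by (rule gaussian_lr_inner_product(2)[OF w \<kappa> that])
  qed
  have r1: "(\<integral>\<^sup>+z. ennreal (r (g i) z) \<partial>?Q) = 1" if "i \<in> F" for i
    using rr[of "g i" "\<lambda>_. 0"] g[OF that] orth[OF that] k0 by (simp add: r_def gaussian_lr_zero[OF k0])
  have law: "obs_law p (\<beta> i, \<Omega> i, \<sigma> i) = density ?Q (\<lambda>z. ennreal (r (g i) z))" if "i \<in> F" for i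
    using that \<beta>0 \<beta> \<Omega> dens by (intro obs_law_eq_density rm r0) (auto simp: r_def D_def)
  have prob: "prob_space (density ?Q (\<lambda>z. ennreal (r (g i) z)))" if "i \<in> F" for i
    using r1[OF that] rmQ by (intro prob_spaceI) (simp add: emeasure_density cong: nn_integral_cong)
  have model0: "model n p (\<beta>\<^sub>0, 1\<^sub>m p, \<sigma>\<^sub>0) = PiM {..<n} (\<lambda>_. ?Q)"
    using \<beta>0 by (intro model_eq_PiM) (auto intro: Q.prob_space_axioms)
  define l where "l i z = (\<Prod>m<n. r (g i) (z m))" for i and z :: data
  have l0: "0 \<le> l i z" for i z unfolding l_def by (intro prod_nonneg) (simp add: r0)
  show ?thesis
  proof (rule minimax_length_ge_mixture[where T = T and t = t and h = \<eta> and F = F and l = l and \<beta> = \<beta> and \<Omega> = \<Omega> and \<sigma> = \<sigma>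
        and w = "\<lambda>i j. (\<kappa> / (\<kappa> - (\<Sum>k<p. g i k * g j k))) ^ n", OF \<theta>0])
    show "prob_space (model n p (\<beta>\<^sub>0, 1\<^sub>m p, \<sigma>\<^sub>0))"
      unfolding model0 by (intro prob_space_PiM Q.prob_space_axioms)
  next
    fix i assume i: "i \<in> F"
    have "model n p (\<beta> i, \<Omega> i, \<sigma> i) = PiM {..<n} (\<lambda>_. obs_law p (\<beta> i, \<Omega> i, \<sigma> i))"
      using i \<beta> \<Omega> prob law by (intro model_eq_PiM) auto
    also have "\<dots> = density (PiM {..<n} (\<lambda>_. ?Q)) (\<lambda>z. \<Prod>m<n. ennreal (r (g i) (z m)))"
      unfolding law[OF i] using rmQ prob[OF i]
      by (intro PiM_density product_sigma_finite_prob Q.prob_space_axioms) auto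
    also have "\<dots> = density (model n p (\<beta>\<^sub>0, 1\<^sub>m p, \<sigma>\<^sub>0)) (\<lambda>z. ennreal (l i z))"
      unfolding model0 l_def by (simp add: prod_ennreal r0)
    finally show "model n p (\<beta> i, \<Omega> i, \<sigma> i) = density (model n p (\<beta>\<^sub>0, 1\<^sub>m p, \<sigma>\<^sub>0)) (\<lambda>z. ennreal (l i z))" .
    show "l i \<in> borel_measurable (data_space n p)"
      unfolding l_def data_space_def by measurable
    have "(\<integral>\<^sup>+z. ennreal (l i z) \<partial>model n p (\<beta>\<^sub>0, 1\<^sub>m p, \<sigma>\<^sub>0)) = (\<integral>\<^sup>+z. (\<Prod>m<n. ennreal (r (g i) (z m))) \<partial>PiM {..<n} (\<lambda>_. ?Q))"
      unfolding model0 l_def by (simp add: prod_ennreal r0)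
    also have "\<dots> = 1"
      using rmQ r1[OF i] by (subst QP.product_nn_integral_prod) auto
    finally show "(\<integral>\<^sup>+z. ennreal (l i z) \<partial>model n p (\<beta>\<^sub>0, 1\<^sub>m p, \<sigma>\<^sub>0)) = 1" .
    fix j assume j: "j \<in> F"
    have gg: "(\<Sum>k<p. g i k * g j k) < \<kappa>"
      and ggi: "(\<integral>\<^sup>+z. ennreal (r (g i) z * r (g j) z) \<partial>?Q) = ennreal (\<kappa> / (\<kappa> - (\<Sum>k<p. g i k * g j k)))"
      using rr[OF g[OF i] g[OF j]] rr0[OF g[OF i] g[OF j]] orth[OF i] orth[OF j] by auto
    then have pos: "0 \<le> \<kappa> / (\<kappa> - (\<Sum>k<p. g i k * g j k))" using k0 by simp
    then show "0 \<le> (\<kappa> / (\<kappa> - (\<Sum>k<p. g i k * g j k))) ^ n" by simp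
    have "(\<integral>\<^sup>+z. ennreal (l i z * l j z) \<partial>model n p (\<beta>\<^sub>0, 1\<^sub>m p, \<sigma>\<^sub>0))
      = (\<integral>\<^sup>+z. (\<Prod>m<n. ennreal (r (g i) (z m) * r (g j) (z m))) \<partial>PiM {..<n} (\<lambda>_. ?Q))"
      unfolding model0 l_def prod.distrib[symmetric] by (simp add: prod_ennreal r0)
    also have "\<dots> = ennreal (\<kappa> / (\<kappa> - (\<Sum>k<p. g i k * g j k))) ^ n"
      using rmQ by (subst QP.product_nn_integral_prod) (auto simp: ggi)
    also have "\<dots> = ennreal ((\<kappa> / (\<kappa> - (\<Sum>k<p. g i k * g j k))) ^ n)"
      using pos by (simp add: ennreal_power)
    finally show "(\<integral>\<^sup>+z. ennreal (l i z * l j z) \<partial>model n p (\<beta>\<^sub>0, 1\<^sub>m p, \<sigma>\<^sub>0))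
      = ennreal ((\<kappa> / (\<kappa> - (\<Sum>k<p. g i k * g j k))) ^ n)" .
  qed (use chi \<theta> F \<eta> \<alpha> l0 in auto)
qed

section \<open>A local shift of the regression vector\<close>

lemma normal_density_scale:
  assumes "0 < \<tau>" "0 < s"
  shows "normal_density 0 (\<tau> * s) (\<tau> * z) = normal_density 0 s z / \<tau>"
proof -
  have "sqrt (2 * pi * (\<tau> * s)\<^sup>2) = \<tau> * sqrt (2 * pi * s\<^sup>2)"
    using assms by (simp add: real_sqrt_mult)
  moreover have "(\<tau> * z)\<^sup>2 / (2 * (\<tau> * s)\<^sup>2) = z\<^sup>2 / (2 * s\<^sup>2)"
    using assms by (simp add: power_mult_distrib)
  ultimately show ?thesis
    using assms by (simp add: normal_density_def)
qed

lemma identity_quadratic: "vec p x \<bullet> (1\<^sub>m p *\<^sub>v vec p x) = (\<Sum>j<p. (x j :: real)\<^sup>2)"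
  by (simp add: scalar_prod_def atLeast0LessThan power2_eq_square)

lemma lambda_identity:
  assumes "0 < p"
  shows "lambda_min (1\<^sub>m p) = 1" "lambda_max (1\<^sub>m p) = 1"
proof -
  have "spectrum (1\<^sub>m p :: real mat) = {1}"
  proof
    show "spectrum (1\<^sub>m p :: real mat) \<subseteq> {1}"
      using eigenvalue_between[of "1\<^sub>m p" p 1 1] identity_quadratic[of p]
      by (fastforce simp: spectrum_def)
    have "unit_vec p 0 \<noteq> (0\<^sub>v p :: real vec)"
      using assms by simp
    then show "{1} \<subseteq> spectrum (1\<^sub>m p :: real mat)"
      by (auto simp: spectrum_def eigenvalue_def eigenvector_def intro!: exI[of _ "unit_vec p 0"])
  qed
  then show "lambda_min (1\<^sub>m p) = 1" "lambda_max (1\<^sub>m p) = 1"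
    by (simp_all add: lambda_min_def lambda_max_def)
qed

lemma l0_vec: "l0 (vec p f) = card {j. j < p \<and> f j \<noteq> 0}"
  unfolding l0_def vsupp_def by (intro arg_cong[where f=card]) auto

lemma identity_in_Theta:
  assumes "0 < p" "1 < M\<^sub>1" "l0 (vec p f) \<le> k" "0 < \<sigma>" "\<sigma> \<le> M\<^sub>2"
  shows "(vec p f, 1\<^sub>m p, \<sigma>) \<in> Theta M\<^sub>1 M\<^sub>2 p k"
  using assms by (simp add: Theta_def lambda_identity)

lemma scalar_prod_vec_vec: "vec p x \<bullet> vec p f = (\<Sum>j<p. f j * (x j :: real))"
  by (subst scalar_prod_vec[of _ p]) auto

text \<open>
  The null is \<open>\<beta> = 0\<close> with the largest noise level, and the alternative moves variance from the
  noise to \<open>x \<bullet> \<beta>\<close>.  The response itself is the statistic with unchanged variance.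
\<close>

lemma minimax_length_ge_parametric:
  fixes v :: "nat \<Rightarrow> real"
  assumes p: "0 < p" and M: "1 < M\<^sub>1" "0 < M\<^sub>2" and v: "(\<Sum>j<p. (v j)\<^sup>2) = 1"
    and sp: "card {j. j < p \<and> v j \<noteq> 0} \<le> k" and b: "0 < b" "b < 1"
    and \<eta>: "0 < \<eta>" and \<alpha>: "\<alpha> < 1" and chi: "(1 / (1 - b\<^sup>2)) ^ n \<le> 1 + \<eta>\<^sup>2"
  shows "ennreal (M\<^sub>2 * b * \<bar>\<xi> \<bullet> vec p v\<bar> * (1 - 2 * \<alpha> - \<eta>))
    \<le> minimax_length n p \<alpha> (Theta M\<^sub>1 M\<^sub>2 p k\<^sub>1) (Theta M\<^sub>1 M\<^sub>2 p k) (\<lambda>\<beta>. \<xi> \<bullet> \<beta>)"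
proof -
  let ?\<beta> = "vec p (\<lambda>j. M\<^sub>2 * b * v j)" and ?s = "sqrt (1 - b\<^sup>2)"
  have b2: "0 < 1 - b\<^sup>2" using b by (simp add: power_less_one_iff abs_square_less_1)
  have s: "0 < ?s" "?s \<le> 1" using b2 by simp_all
  have lsup: "l0 ?\<beta> \<le> k" using sp b M by (simp add: l0_vec)
  have th0: "(vec p (\<lambda>_. 0), 1\<^sub>m p, M\<^sub>2) \<in> Theta M\<^sub>1 M\<^sub>2 p k'" for k'
    using p M by (intro identity_in_Theta) (simp_all add: l0_vec)
  have th: "(?\<beta>, 1\<^sub>m p, M\<^sub>2 * ?s) \<in> Theta M\<^sub>1 M\<^sub>2 p k"
    using p M s lsup by (intro identity_in_Theta) (simp_all add: mult_le_cancel_left1)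
  have gg: "(\<Sum>j<p. (b * v j)\<^sup>2) = b\<^sup>2" "(\<Sum>j<p. b * v j * (b * v j)) = b\<^sup>2"
    using v by (simp_all add: power_mult_distrib power2_eq_square mult_ac flip: sum_distrib_left)
  have dens: "obs_density p (?\<beta>, 1\<^sub>m p, M\<^sub>2 * ?s) y x = obs_density p (vec p (\<lambda>_. 0), 1\<^sub>m p, M\<^sub>2) y x *
      gaussian_lr p 1 (\<lambda>j. b * v j) ((\<Sum>j<p. 0 * x j) + 1 * ((y - vec p x \<bullet> vec p (\<lambda>_. 0)) / M\<^sub>2)) x" for y x
  proof -
    define A where "A = (\<Sum>j<p. b * v j * x j)"
    have e: "y - vec p x \<bullet> ?\<beta> = M\<^sub>2 * (y / M\<^sub>2 - A)"
      using M by (simp add: scalar_prod_vec_vec A_def sum_distrib_left algebra_simps)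
    have "normal_density 0 M\<^sub>2 y = normal_density 0 1 (y / M\<^sub>2) / M\<^sub>2"
      using normal_density_scale[of M\<^sub>2 1 "y / M\<^sub>2"] M by simp
    then show ?thesis
      unfolding obs_density_def prod.case e normal_density_scale[OF M(2) s(1)]
      using normal_density_pos[of 1 0 "y / M\<^sub>2"]
      by (simp add: gaussian_lr_def gg A_def scalar_prod_vec_vec del: std_normal_density_def)
  qed
  have "ennreal (\<bar>\<xi> \<bullet> ?\<beta> - \<xi> \<bullet> vec p (\<lambda>_. 0)\<bar> * (1 - 2 * \<alpha> - \<eta>))
    \<le> minimax_length n p \<alpha> (Theta M\<^sub>1 M\<^sub>2 p k\<^sub>1) (Theta M\<^sub>1 M\<^sub>2 p k) (\<lambda>\<beta>. \<xi> \<bullet> \<beta>)"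
    by (rule minimax_length_ge_gaussian_mixture[where F = "{()}" and \<beta> = "\<lambda>_. ?\<beta>" and \<Omega> = "\<lambda>_. 1\<^sub>m p"
        and \<sigma> = "\<lambda>_. M\<^sub>2 * ?s" and w = 1 and \<kappa> = 1 and h = "\<lambda>_. 0" and g = "\<lambda>_ j. b * v j"
        and \<sigma>\<^sub>0 = M\<^sub>2 and \<eta> = \<eta>])
      (use M th0 th dens \<eta> \<alpha> chi b2 in \<open>auto simp: gg\<close>)
  moreover have "\<bar>\<xi> \<bullet> ?\<beta> - \<xi> \<bullet> vec p (\<lambda>_. 0)\<bar> = M\<^sub>2 * b * \<bar>\<xi> \<bullet> vec p v\<bar>"
  proof -
    have "\<xi> \<bullet> vec p (\<lambda>_. 0) = 0" by (simp add: scalar_prod_def)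
    moreover have "\<xi> \<bullet> ?\<beta> = M\<^sub>2 * b * (\<xi> \<bullet> vec p v)"
      by (simp add: scalar_prod_def sum_distrib_left mult_ac)
    ultimately show ?thesis using M b by (simp add: abs_mult)
  qed
  ultimately show ?thesis by simp
qed

section \<open>Hidden confounding between the loading direction and other covariates\<close>

lemma clear_three_denominators:
  fixes q u z K P A R R' :: real
  assumes "0 < z" "0 < u" "0 < K" "(q + z * A) * (2 * u * K) + 2 * P = z * (R * K + R' * u)"
  shows "q / z + P / (z * u * K) + A = R / (2 * u) + R' / (2 * K)"
proof -
  have "q / z + P / (z * u * K) + A = ((q + z * A) * (2 * u * K) + 2 * P) / (2 * z * u * K)"
    using assms(1-3) by (simp add: field_simps)
  also have "\<dots> = R / (2 * u) + R' / (2 * K)"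
    unfolding assms(4) using assms(1-3) by (simp add: field_simps)
  finally show ?thesis .
qed

text \<open>
  The comparison of densities for confounding, in the coordinates \<open>Y = y / \<tau>\<close>, \<open>A = v \<bullet> x\<close> and \<open>W\<close>, the
  normalized sum of the confounders.  On the left is the density of the alternative, relative to a standard
  normal design, as the product of a design factor and a noise factor, where \<open>b\<close> and \<open>r (1 - b)\<close> solve the normal equations and
  \<open>(1 - a) (1 + b)\<close> is the residual variance.  The right side is the null times the conditional density of
  \<open>(Y + A) / sqrt 2\<close>, relative to its marginal density; the factor of \<open>Y - A\<close> is common to both models
  and has cancelled.
\<close>

lemma confounded_density_identity:
  fixes a r Y A W :: real
  assumes a: "0 \<le> a" "a < 1" and r: "0 < r" "0 < 1 + a - 2 * r\<^sup>2"
  defines "b \<equiv> (a - r\<^sup>2) / (1 - r\<^sup>2)"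
  shows "sqrt (1 / (1 - r\<^sup>2)) *
      exp (- (- (r / (1 + r)) * ((A + W) / sqrt 2)\<^sup>2 + r / (1 - r) * ((A - W) / sqrt 2)\<^sup>2) / 2) *
      normal_density 0 (sqrt ((1 - a) * (1 + b))) (Y - (b * A + r * (1 - b) * W))
    = normal_density 0 (sqrt (1 - a\<^sup>2)) (Y - a * A) *
      (normal_density 0 (sqrt (1 + a - 2 * r\<^sup>2)) ((Y + A) / sqrt 2 - sqrt 2 * r * W) /
       normal_density 0 (sqrt (1 + a)) ((Y + A) / sqrt 2))"
proof -
  define K where "K = 1 + a - 2 * r\<^sup>2"
  define z where "z = 1 - r\<^sup>2"
  have K: "0 < K" using r by (simp add: K_def)
  have z: "0 < z" using a r by (simp add: z_def)
  have r1: "r < 1" using z r(1) by (simp add: z_def power_less_one_iff abs_square_less_1)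
  have b1: "1 + b = K / z" using z by (simp add: b_def K_def z_def field_simps)
  have bb: "b = (a - r\<^sup>2) / z" by (simp add: b_def z_def)
  have b2: "1 - b = (1 - a) / z" using z by (simp add: bb z_def field_simps)
  have pos: "0 < (1 - a) * (1 + b)" "0 < 1 - a\<^sup>2" "0 < 1 + a"
    using a z K unfolding b1 by (simp_all add: abs_square_less_1)
  have a2: "1 - a\<^sup>2 = (1 - a) * (1 + a)" by (simp add: power2_eq_square algebra_simps)
  \<comment> \<open>the normalizing constants\<close>
  have pref: "sqrt (1 / z) * (1 / sqrt (2 * pi * ((1 - a) * (1 + b))))
    = 1 / sqrt (2 * pi * (1 - a\<^sup>2)) * (1 / sqrt (2 * pi * K) / (1 / sqrt (2 * pi * (1 + a))))"
  proof -
    have "sqrt (1 / z) * (1 / sqrt (2 * pi * ((1 - a) * (1 + b)))) = sqrt (1 / z * (1 / (2 * pi * ((1 - a) * (K / z)))))"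
      unfolding b1 by (simp only: real_sqrt_mult real_sqrt_divide real_sqrt_one)
    also have "1 / z * (1 / (2 * pi * ((1 - a) * (K / z)))) = 1 / (2 * pi * (1 - a) * K)"
      using z by simp
    also have "\<dots> = 1 / (2 * pi * (1 - a\<^sup>2)) * (1 / (2 * pi * K) / (1 / (2 * pi * (1 + a))))"
      unfolding a2 using pos(3) by simp
    also have "sqrt \<dots> = 1 / sqrt (2 * pi * (1 - a\<^sup>2)) * (1 / sqrt (2 * pi * K) / (1 / sqrt (2 * pi * (1 + a))))"
      by (simp only: real_sqrt_mult real_sqrt_divide real_sqrt_one)
    finally show ?thesis .
  qed
  define Z where "Z = Y - (b * A + r * (1 - b) * W)"
  have Z: "z * Z = z * Y - (a - r\<^sup>2) * A - r * (1 - a) * W"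
  proof -
    have "z * b = a - r\<^sup>2" "z * (1 - b) = 1 - a" using z unfolding b2 unfolding bb by simp_all
    moreover have "z * Z = z * Y - z * b * A - r * (z * (1 - b)) * W"
      by (simp add: Z_def algebra_simps)
    ultimately show ?thesis by simp
  qed
  have Q: "- (r / (1 + r)) * ((A + W) / sqrt 2)\<^sup>2 + r / (1 - r) * ((A - W) / sqrt 2)\<^sup>2
      = (r\<^sup>2 * (A\<^sup>2 + W\<^sup>2) - 2 * r * A * W) / z"
  proof -
    have "z = (1 - r) * (1 + r)" by (simp add: z_def power2_eq_square algebra_simps)
    then show ?thesis using r r1
      by (simp add: power_divide divide_simps) (simp add: power2_eq_square algebra_simps)
  qed
  have lin: "- (t\<^sub>1 / 2) + - s\<^sub>2 = - s\<^sub>6 + (- s\<^sub>5 - - s\<^sub>7)"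
    if "t\<^sub>1 + t\<^sub>2 + t\<^sub>3 = t\<^sub>4 + t\<^sub>5" "t\<^sub>4 = t\<^sub>6 - t\<^sub>7 + t\<^sub>3" "s\<^sub>5 = t\<^sub>5 / 2" "s\<^sub>7 = t\<^sub>7 / 2" "s\<^sub>2 = t\<^sub>2 / 2" "s\<^sub>6 = t\<^sub>6 / 2"
    for t\<^sub>1 t\<^sub>2 t\<^sub>3 t\<^sub>4 t\<^sub>5 t\<^sub>6 t\<^sub>7 s\<^sub>2 s\<^sub>5 s\<^sub>6 s\<^sub>7 :: real
    using that by simp
  have "(r\<^sup>2 * (A\<^sup>2 + W\<^sup>2) - 2 * r * A * W) / z + Z\<^sup>2 / ((1 - a) * (1 + b)) + A\<^sup>2
      = (Y - A)\<^sup>2 / (2 * (1 - a)) + (Y + A - 2 * r * W)\<^sup>2 / (2 * K)"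
  proof -
    have "Z\<^sup>2 / ((1 - a) * (1 + b)) = (z * Z)\<^sup>2 / (z * (1 - a) * K)"
      unfolding b1 using z a K by (simp add: field_simps power2_eq_square)
    moreover have "(r\<^sup>2 * (A\<^sup>2 + W\<^sup>2) - 2 * r * A * W + z * A\<^sup>2) * (2 * (1 - a) * K)
        + 2 * (z * Z)\<^sup>2
      = z * ((Y - A)\<^sup>2 * K + (Y + A - 2 * r * W)\<^sup>2 * (1 - a))"
      unfolding Z unfolding K_def z_def by (simp add: power2_eq_square algebra_simps)
    ultimately show ?thesis
      using clear_three_denominators[OF z _ K, of "1 - a"] a by simp
  qed
  \<comment> \<open>the null density of \<open>(Y, A)\<close>, written in the independent coordinates \<open>Y - A\<close> and \<open>Y + A\<close>\<close>
  moreover have "(Y - A)\<^sup>2 / (2 * (1 - a)) = (Y - a * A)\<^sup>2 / (1 - a\<^sup>2) - (Y + A)\<^sup>2 / (2 * (1 + a)) + A\<^sup>2"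
    unfolding a2 using a by (simp add: divide_simps) (simp add: power2_eq_square algebra_simps)
  moreover have "((Y + A) / sqrt 2 - sqrt 2 * r * W - 0)\<^sup>2 / (2 * K) = (Y + A - 2 * r * W)\<^sup>2 / (2 * K) / 2"
  proof -
    have "(Y + A) / sqrt 2 - sqrt 2 * r * W = (Y + A - 2 * r * W) / sqrt 2"
      by (simp add: field_simps)
    then show ?thesis by (simp add: power_divide)
  qed
  moreover have "((Y + A) / sqrt 2 - 0)\<^sup>2 / (2 * (1 + a)) = (Y + A)\<^sup>2 / (2 * (1 + a)) / 2"
    by (simp add: power_divide)
  moreover have "(Z - 0)\<^sup>2 / (2 * ((1 - a) * (1 + b))) = Z\<^sup>2 / ((1 - a) * (1 + b)) / 2"
    "(Y - a * A - 0)\<^sup>2 / (2 * (1 - a\<^sup>2)) = (Y - a * A)\<^sup>2 / (1 - a\<^sup>2) / 2"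
    by simp_all
  ultimately have ex: "- ((r\<^sup>2 * (A\<^sup>2 + W\<^sup>2) - 2 * r * A * W) / z) / 2 + - (Z - 0)\<^sup>2 / (2 * ((1 - a) * (1 + b)))
    = - (Y - a * A - 0)\<^sup>2 / (2 * (1 - a\<^sup>2)) + (- ((Y + A) / sqrt 2 - sqrt 2 * r * W - 0)\<^sup>2 / (2 * K)
       - - ((Y + A) / sqrt 2 - 0)\<^sup>2 / (2 * (1 + a)))"
    unfolding minus_divide_left[symmetric] by (rule lin)
  have reorder: "p\<^sub>1 * (p\<^sub>2 / p\<^sub>3) * (e\<^sub>1 * (e\<^sub>2 / e\<^sub>3)) = p\<^sub>1 * e\<^sub>1 * (p\<^sub>2 * e\<^sub>2 / (p\<^sub>3 * e\<^sub>3))"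
    for p\<^sub>1 p\<^sub>2 p\<^sub>3 e\<^sub>1 e\<^sub>2 e\<^sub>3 :: real by simp
  have "sqrt (1 / z) * exp (- ((r\<^sup>2 * (A\<^sup>2 + W\<^sup>2) - 2 * r * A * W) / z) / 2) * normal_density 0 (sqrt ((1 - a) * (1 + b))) Z
    = sqrt (1 / z) * (1 / sqrt (2 * pi * ((1 - a) * (1 + b)))) *
      exp (- ((r\<^sup>2 * (A\<^sup>2 + W\<^sup>2) - 2 * r * A * W) / z) / 2 + - (Z - 0)\<^sup>2 / (2 * ((1 - a) * (1 + b))))"
    unfolding normal_density_sqrt[OF pos(1)] exp_add by (simp only: mult_ac)
  also have "\<dots> = normal_density 0 (sqrt (1 - a\<^sup>2)) (Y - a * A) *
      (normal_density 0 (sqrt K) ((Y + A) / sqrt 2 - sqrt 2 * r * W) /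
       normal_density 0 (sqrt (1 + a)) ((Y + A) / sqrt 2))"
    unfolding normal_density_sqrt[OF pos(2)] normal_density_sqrt[OF pos(3)] normal_density_sqrt[OF K] pref ex exp_add exp_diff
    by (rule reorder)
  finally show ?thesis
    unfolding Q K_def[symmetric] z_def[symmetric] Z_def[symmetric] by simp
qed

text \<open>
  Let \<open>w\<close> be the unit vector along the indicator of \<open>S i\<close> and \<open>r = \<rho> sqrt s\<close>.  The covariance matrix of
  the alternative is \<open>I + r (v w\<^sup>T + w v\<^sup>T)\<close>, with eigenvalues \<open>1 + r\<close> and \<open>1 - r\<close> in the directions
  \<open>e, f = (v \<plusminus> w) / sqrt 2\<close>; its inverse is a rank-two update.  The null has covariance \<open>a\<close> between
  \<open>y / \<tau>\<close> and \<open>v \<bullet> X\<close>, where \<open>\<tau> = M\<^sub>2\<close> is the common standard deviation of \<open>y\<close>.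
  The coefficient along \<open>v\<close> changes by \<open>a - b = r\<^sup>2 (1 - a) / (1 - r\<^sup>2) \<ge> r\<^sup>2\<close>.  It is essential that \<open>\<xi>\<close>
  vanishes on \<open>S i\<close>: otherwise the value of the functional would depend on \<open>i\<close>.
\<close>

lemma minimax_length_ge_confounded:
  fixes v :: "nat \<Rightarrow> real" and S :: "'i \<Rightarrow> nat set"
  assumes p: "0 < p" and M: "1 < M\<^sub>1" "0 < M\<^sub>2" and v: "(\<Sum>j<p. (v j)\<^sup>2) = 1"
    and F: "finite F" "F \<noteq> {}"
    and S: "\<And>i. i \<in> F \<Longrightarrow> S i \<subseteq> {..<p}" "\<And>i. i \<in> F \<Longrightarrow> card (S i) = s"
      "\<And>i j. i \<in> F \<Longrightarrow> j \<in> S i \<Longrightarrow> v j = 0 \<and> \<xi> $ j = 0"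
    and s: "0 < s" and \<rho>: "0 < \<rho>" and r_def: "r = \<rho> * sqrt s"
    and r: "r \<le> 1 / 2" "1 \<le> M\<^sub>1 * (1 - r)"
    and a: "0 \<le> a" "a \<le> r\<^sup>2"
    and sp0: "a = 0 \<or> card {j. j < p \<and> v j \<noteq> 0} \<le> k\<^sub>1" "k\<^sub>1 \<le> k"
    and sp1: "(if a = r\<^sup>2 then 0 else card {j. j < p \<and> v j \<noteq> 0}) + s \<le> k"
    and \<eta>: "0 < \<eta>" and \<alpha>: "\<alpha> < 1" "0 \<le> 1 - 2 * \<alpha> - \<eta>"
    and chi: "(\<Sum>i\<in>F. \<Sum>j\<in>F. ((1 + a) / (1 + a - 2 * \<rho>\<^sup>2 * card (S i \<inter> S j))) ^ n) \<le> (1 + \<eta>\<^sup>2) * (real (card F))\<^sup>2"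
  shows "ennreal (M\<^sub>2 * r\<^sup>2 * \<bar>\<xi> \<bullet> vec p v\<bar> * (1 - 2 * \<alpha> - \<eta>))
    \<le> minimax_length n p \<alpha> (Theta M\<^sub>1 M\<^sub>2 p k\<^sub>1) (Theta M\<^sub>1 M\<^sub>2 p k) (\<lambda>\<beta>. \<xi> \<bullet> \<beta>)"
proof -
  let ?m = "card {j. j < p \<and> v j \<noteq> 0}"
  have r0: "0 < r" using \<rho> s by (simp add: r_def)
  have r2: "r\<^sup>2 = \<rho>\<^sup>2 * s" by (simp add: r_def power_mult_distrib)
  have "r\<^sup>2 \<le> (1 / 2)\<^sup>2" using r(1) r0 by (intro power_mono) auto
  then have r4: "r\<^sup>2 \<le> 1 / 4" by (simp add: power2_eq_square)
  have z: "0 < 1 - r\<^sup>2" using r4 by simp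
  have K: "0 < 1 + a - 2 * r\<^sup>2" using r4 a by simp
  define b where "b = (a - r\<^sup>2) / (1 - r\<^sup>2)"
  have b1: "1 + b = (1 + a - 2 * r\<^sup>2) / (1 - r\<^sup>2)" using z by (simp add: b_def field_simps)
  have ab: "(1 - a) * (1 + b) \<le> 1" "0 < (1 - a) * (1 + b)"
  proof -
    have "0 \<le> a" "b \<le> 0" "0 < 1 + b" using a z K unfolding b1 by (simp_all add: b_def divide_nonpos_pos)
    then have "(1 - a) * (1 + b) \<le> 1 * 1" using a r4 by (intro mult_mono) auto
    then show "(1 - a) * (1 + b) \<le> 1" by simp
    show "0 < (1 - a) * (1 + b)" using \<open>0 < 1 + b\<close> a r4 by simp
  qed
  have a2: "0 < 1 - a\<^sup>2" "1 - a\<^sup>2 \<le> 1"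
    using a r4 by (simp_all add: abs_square_less_1)
  define w where "w i j = (if j \<in> S i then 1 / sqrt s else 0)" for i j
  define e where "e i j = (v j + w i j) / sqrt 2" for i j
  define f where "f i j = (v j - w i j) / sqrt 2" for i j
  define \<beta> where "\<beta> i = vec p (\<lambda>j. M\<^sub>2 * (b * v j + \<rho> * (1 - b) * (if j \<in> S i then 1 else 0)))" for i
  define \<Omega> where "\<Omega> i = rank_two_update p (- (r / (1 + r))) (e i) (r / (1 - r)) (f i)" for i
  define \<beta>\<^sub>0 where "\<beta>\<^sub>0 = vec p (\<lambda>j. M\<^sub>2 * a * v j)"
  define \<sigma>\<^sub>0 where "\<sigma>\<^sub>0 = M\<^sub>2 * sqrt (1 - a\<^sup>2)"
  define \<sigma> where "\<sigma> = M\<^sub>2 * sqrt ((1 - a) * (1 + b))"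
  define h where "h j = (1 + a) / sqrt 2 * v j" for j
  define g where "g i j = (if j \<in> S i then sqrt 2 * \<rho> else 0)" for i j
  define \<omega> where "\<omega> = sqrt ((1 - a\<^sup>2) / 2)"
  have fS: "finite (S i)" if "i \<in> F" for i using S(1)[OF that] finite_subset by blast
  have sumS: "(\<Sum>j<p. if j \<in> S i then G j else 0) = (\<Sum>j\<in>S i. G j)" if "i \<in> F" for i and G :: "nat \<Rightarrow> real"
    using S(1)[OF that] by (simp add: sum.If_cases Int_absorb1)
  have vw: "(\<Sum>j<p. v j * w i j) = 0" if "i \<in> F" for i
    using S(3)[OF that] by (intro sum.neutral) (auto simp: w_def)
  have ww: "(\<Sum>j<p. (w i j)\<^sup>2) = 1" if "i \<in> F" for i
  proof -
    have "(\<Sum>j<p. (w i j)\<^sup>2) = (\<Sum>j<p. if j \<in> S i then 1 / real s else 0)"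
      by (intro sum.cong) (auto simp: w_def power_divide)
    then show ?thesis using S(2)[OF that] s sumS[OF that] by simp
  qed
  have ee: "(\<Sum>j<p. e i j * e i j) = 1" and ff: "(\<Sum>j<p. f i j * f i j) = 1" and ef: "(\<Sum>j<p. e i j * f i j) = 0"
    if "i \<in> F" for i
  proof -
    have "(\<Sum>j<p. e i j * e i j) = (\<Sum>j<p. (v j)\<^sup>2 / 2 + v j * w i j + (w i j)\<^sup>2 / 2)"
      by (intro sum.cong) (auto simp: e_def power2_eq_square field_simps)
    then show "(\<Sum>j<p. e i j * e i j) = 1"
      using v vw[OF that] ww[OF that] by (simp add: sum.distrib flip: sum_divide_distrib)
    have "(\<Sum>j<p. f i j * f i j) = (\<Sum>j<p. (v j)\<^sup>2 / 2 - v j * w i j + (w i j)\<^sup>2 / 2)"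
      by (intro sum.cong) (auto simp: f_def power2_eq_square field_simps)
    then show "(\<Sum>j<p. f i j * f i j) = 1"
      using v vw[OF that] ww[OF that] by (simp add: sum.distrib sum_subtractf flip: sum_divide_distrib)
    have "(\<Sum>j<p. e i j * f i j) = (\<Sum>j<p. (v j)\<^sup>2 / 2 - (w i j)\<^sup>2 / 2)"
      by (intro sum.cong) (auto simp: e_def f_def power2_eq_square field_simps)
    then show "(\<Sum>j<p. e i j * f i j) = 0"
      using v ww[OF that] by (simp add: sum_subtractf flip: sum_divide_distrib)
  qed
  have p1: "1 + - (r / (1 + r)) = 1 / (1 + r)" "1 + r / (1 - r) = 1 / (1 - r)"
    using r0 r(1) by (simp_all add: field_simps)
  have det: "Determinant.det (\<Omega> i) = 1 / (1 - r\<^sup>2)" if "i \<in> F" for i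
    unfolding \<Omega>_def det_rank_two_update[OF ee[OF that] ff[OF that] ef[OF that]] p1
    by (simp add: power2_eq_square algebra_simps)
  have th0: "(\<beta>\<^sub>0, 1\<^sub>m p, \<sigma>\<^sub>0) \<in> Theta M\<^sub>1 M\<^sub>2 p k'" if "k' = k \<or> k' = k\<^sub>1" for k'
  proof -
    have "l0 \<beta>\<^sub>0 \<le> k'"
    proof (cases "a = 0")
      case False
      then show ?thesis using that sp0 M by (auto simp: \<beta>\<^sub>0_def l0_vec)
    qed (simp add: \<beta>\<^sub>0_def l0_vec)
    then show ?thesis
      using p M a2 unfolding \<beta>\<^sub>0_def \<sigma>\<^sub>0_def
      by (intro identity_in_Theta) (simp_all add: mult_le_cancel_left1)
  qed
  have th: "(\<beta> i, \<Omega> i, \<sigma>) \<in> Theta M\<^sub>1 M\<^sub>2 p k" if i: "i \<in> F" for i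
  proof -
    have "l0 (\<beta> i) \<le> k"
    proof (cases "a = r\<^sup>2")
      case True
      then have "b = 0" by (simp add: b_def)
      then have "l0 (\<beta> i) \<le> card (S i)"
        unfolding \<beta>_def l0_vec by (intro card_mono fS i) (auto split: if_splits)
      then show ?thesis using S(2)[OF i] sp1 by simp
    next
      case False
      have "l0 (\<beta> i) \<le> card ({j. j < p \<and> v j \<noteq> 0} \<union> S i)"
        unfolding \<beta>_def l0_vec using fS[OF i] by (intro card_mono) (auto split: if_splits)
      also have "\<dots> \<le> ?m + card (S i)" by (rule card_Un_le)
      finally show ?thesis using S(2)[OF i] sp1 False by simp
    qed
    moreover have "1 / (1 + r) \<le> lambda_min (\<Omega> i)" "lambda_min (\<Omega> i) \<le> lambda_max (\<Omega> i)"
      "lambda_max (\<Omega> i) \<le> 1 / (1 - r)"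
      using rank_two_update_lambda[OF ee[OF i] ff[OF i] ef[OF i], of "- (r / (1 + r))" "r / (1 - r)"] r0 r(1)
      unfolding \<Omega>_def p1 by simp_all
    moreover have "1 / (1 - r) \<le> M\<^sub>1" using r by (simp add: divide_le_eq)
    moreover have "1 / M\<^sub>1 \<le> 1 / (1 + r)"
    proof -
      have "(1 + r) * (1 - r) \<le> 1" by (simp add: algebra_simps)
      also have "1 \<le> M\<^sub>1 * (1 - r)" by (rule r)
      finally have "1 + r \<le> M\<^sub>1" using r(1) by (simp add: mult_le_cancel_right)
      then show ?thesis using r0 by (intro divide_left_mono) auto
    qed
    moreover have "0 < \<sigma>" "\<sigma> \<le> M\<^sub>2" using M ab by (simp_all add: \<sigma>_def mult_le_cancel_left1)
    ultimately show ?thesis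
      by (auto simp: Theta_def \<beta>_def \<Omega>_def rank_two_update_carrier rank_two_update_sym)
  qed
  have \<kappa>: "1 + a = \<omega>\<^sup>2 + (\<Sum>j<p. (h j)\<^sup>2)"
  proof -
    have "(\<Sum>j<p. (h j)\<^sup>2) = (1 + a)\<^sup>2 / 2"
    proof -
      have "(\<Sum>j<p. (h j)\<^sup>2) = (\<Sum>j<p. (1 + a)\<^sup>2 / 2 * (v j)\<^sup>2)"
        by (simp add: h_def power_mult_distrib power_divide)
      then show ?thesis unfolding sum_distrib_left[symmetric] v by simp
    qed
    moreover have "\<omega>\<^sup>2 = (1 - a\<^sup>2) / 2" using a2 by (simp add: \<omega>_def)
    ultimately show ?thesis by (simp add: power2_eq_square algebra_simps)
  qed
  have gg: "(\<Sum>k<p. g i k * g j k) = 2 * \<rho>\<^sup>2 * card (S i \<inter> S j)" if "i \<in> F" "j \<in> F" for i j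
  proof -
    have "(\<Sum>k<p. g i k * g j k) = (\<Sum>k<p. if k \<in> S i \<inter> S j then 2 * \<rho>\<^sup>2 else 0)"
      by (intro sum.cong) (auto simp: g_def power2_eq_square)
    also have "\<dots> = (\<Sum>k\<in>{..<p} \<inter> (S i \<inter> S j). 2 * \<rho>\<^sup>2)"
      by (intro sum.inter_restrict[symmetric]) simp
    also have "{..<p} \<inter> (S i \<inter> S j) = S i \<inter> S j" using S(1)[OF that(1)] by blast
    finally show ?thesis by simp
  qed
  have g2: "(\<Sum>k<p. (g i k)\<^sup>2) = 2 * r\<^sup>2" if "i \<in> F" for i
    using gg[OF that that] S(2)[OF that] by (simp add: power2_eq_square[of "g i _"] r2)
  \<comment> \<open>in the coordinates \<open>A, W, Y\<close> this is \<open>confounded_density_identity\<close>\<close>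
  have dens: "obs_density p (\<beta> i, \<Omega> i, \<sigma>) y x = obs_density p (\<beta>\<^sub>0, 1\<^sub>m p, \<sigma>\<^sub>0) y x *
      gaussian_lr p (1 + a) (g i) ((\<Sum>j<p. h j * x j) + \<omega> * ((y - vec p x \<bullet> \<beta>\<^sub>0) / \<sigma>\<^sub>0)) x" if i: "i \<in> F" for i y x
  proof -
    define A where "A = (\<Sum>j<p. v j * x j)"
    define W where "W = (\<Sum>j<p. w i j * x j)"
    define Y where "Y = y / M\<^sub>2"
    have exs: "(\<Sum>j<p. e i j * x j) = (A + W) / sqrt 2" "(\<Sum>j<p. f i j * x j) = (A - W) / sqrt 2"
      unfolding A_def W_def e_def f_def sum.distrib[symmetric] sum_subtractf[symmetric] sum_divide_distrib
      by (intro sum.cong refl; simp add: distrib_right left_diff_distrib)+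
    have rw: "\<rho> * (if j \<in> S i then 1 else 0) = r * w i j" "g i j = sqrt 2 * (r * w i j)" for j
      using s by (simp_all add: w_def r_def g_def)
    have bx: "y - vec p x \<bullet> \<beta> i = M\<^sub>2 * (Y - (b * A + r * (1 - b) * W))"
    proof -
      have "vec p x \<bullet> \<beta> i = (\<Sum>j<p. M\<^sub>2 * b * (v j * x j) + M\<^sub>2 * (1 - b) * r * (w i j * x j))"
        unfolding \<beta>_def scalar_prod_vec_vec
      proof (intro sum.cong refl)
        fix j
        have "M\<^sub>2 * (b * v j + \<rho> * (1 - b) * (if j \<in> S i then 1 else 0)) * x j
          = M\<^sub>2 * b * (v j * x j) + M\<^sub>2 * (1 - b) * x j * (\<rho> * (if j \<in> S i then 1 else 0))"
          by (simp add: algebra_simps)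
        then show "M\<^sub>2 * (b * v j + \<rho> * (1 - b) * (if j \<in> S i then 1 else 0)) * x j
          = M\<^sub>2 * b * (v j * x j) + M\<^sub>2 * (1 - b) * r * (w i j * x j)"
          unfolding rw by (simp add: mult_ac)
      qed
      also have "\<dots> = M\<^sub>2 * b * A + M\<^sub>2 * (1 - b) * r * W"
        by (simp add: sum.distrib A_def W_def flip: sum_distrib_left)
      finally show ?thesis using M by (simp add: Y_def algebra_simps)
    qed
    have b0x: "y - vec p x \<bullet> \<beta>\<^sub>0 = M\<^sub>2 * (Y - a * A)"
      using M by (simp add: \<beta>\<^sub>0_def scalar_prod_vec_vec A_def Y_def sum_distrib_left algebra_simps)
    have D: "(\<Sum>j<p. h j * x j) + \<omega> * ((y - vec p x \<bullet> \<beta>\<^sub>0) / \<sigma>\<^sub>0) = (Y + A) / sqrt 2"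
    proof -
      have "(\<Sum>j<p. h j * x j) = (1 + a) / sqrt 2 * A"
        by (simp add: h_def A_def sum_distrib_left mult.assoc)
      moreover have "\<omega> * ((y - vec p x \<bullet> \<beta>\<^sub>0) / \<sigma>\<^sub>0) = (Y - a * A) / sqrt 2"
        unfolding b0x \<omega>_def \<sigma>\<^sub>0_def using M a2 by (simp add: real_sqrt_divide)
      ultimately show ?thesis by (simp add: field_simps)
    qed
    have gx: "(\<Sum>j<p. g i j * x j) = sqrt 2 * r * W"
      by (simp add: rw W_def sum_distrib_left mult.assoc)
    have l: "gaussian_lr p (1 + a) (g i) ((Y + A) / sqrt 2) x =
      normal_density 0 (sqrt (1 + a - 2 * r\<^sup>2)) ((Y + A) / sqrt 2 - sqrt 2 * r * W) /
       normal_density 0 (sqrt (1 + a)) ((Y + A) / sqrt 2)"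
      unfolding gaussian_lr_def g2[OF i] gx ..
    have split: "- (t\<^sub>1 + t\<^sub>2 + t\<^sub>3) / 2 = - t\<^sub>1 / 2 + - (t\<^sub>2 + t\<^sub>3) / 2" for t\<^sub>1 t\<^sub>2 t\<^sub>3 :: real by simp
    have quad: "exp (- (vec p x \<bullet> (\<Omega> i *\<^sub>v vec p x)) / 2) = exp (- (\<Sum>j<p. (x j)\<^sup>2) / 2) *
      exp (- (- (r / (1 + r)) * ((A + W) / sqrt 2)\<^sup>2 + r / (1 - r) * ((A - W) / sqrt 2)\<^sup>2) / 2)"
      unfolding \<Omega>_def rank_two_update_quadratic exs exp_add[symmetric]
      by (intro arg_cong[where f = exp] split)
    have s0: "0 < sqrt ((1 - a) * (1 + b))" "0 < sqrt (1 - a\<^sup>2)" using ab a2 by simp_all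
    have a1: "a < 1" using a r4 by simp
    note id = confounded_density_identity[OF a(1) a1 r0 K, of A W Y, folded b_def]
    have "obs_density p (\<beta> i, \<Omega> i, \<sigma>) y x = exp (- (\<Sum>j<p. (x j)\<^sup>2) / 2) / sqrt (2 * pi) ^ p / M\<^sub>2 *
      (sqrt (1 / (1 - r\<^sup>2)) *
      exp (- (- (r / (1 + r)) * ((A + W) / sqrt 2)\<^sup>2 + r / (1 - r) * ((A - W) / sqrt 2)\<^sup>2) / 2) *
      normal_density 0 (sqrt ((1 - a) * (1 + b))) (Y - (b * A + r * (1 - b) * W)))"
      unfolding obs_density_def prod.case det[OF i] quad bx \<sigma>_def normal_density_scale[OF M(2) s0(1)]
      by (simp only: times_divide_eq_left times_divide_eq_right mult_ac divide_divide_eq_left)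
    also have "\<dots> = obs_density p (\<beta>\<^sub>0, 1\<^sub>m p, \<sigma>\<^sub>0) y x * gaussian_lr p (1 + a) (g i) ((Y + A) / sqrt 2) x"
      unfolding id l obs_density_def prod.case b0x \<sigma>\<^sub>0_def normal_density_scale[OF M(2) s0(2)] identity_quadratic
      by simp
    finally show ?thesis unfolding D .
  qed
  have T: "\<xi> \<bullet> \<beta> i = M\<^sub>2 * b * (\<xi> \<bullet> vec p v)" if i: "i \<in> F" for i
  proof -
    have "\<xi> \<bullet> \<beta> i = (\<Sum>j<p. M\<^sub>2 * b * (\<xi> $ j * v j))"
      using S(3)[OF i] by (auto simp: scalar_prod_def atLeast0LessThan \<beta>_def intro!: sum.cong)
    then show ?thesis by (simp add: scalar_prod_def atLeast0LessThan sum_distrib_left)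
  qed
  have T0: "\<xi> \<bullet> \<beta>\<^sub>0 = M\<^sub>2 * a * (\<xi> \<bullet> vec p v)"
    by (simp add: scalar_prod_def atLeast0LessThan sum_distrib_left \<beta>\<^sub>0_def mult_ac)
  have "ennreal (\<bar>M\<^sub>2 * b * (\<xi> \<bullet> vec p v) - \<xi> \<bullet> \<beta>\<^sub>0\<bar> * (1 - 2 * \<alpha> - \<eta>))
    \<le> minimax_length n p \<alpha> (Theta M\<^sub>1 M\<^sub>2 p k\<^sub>1) (Theta M\<^sub>1 M\<^sub>2 p k) (\<lambda>\<beta>. \<xi> \<bullet> \<beta>)"
  proof (rule minimax_length_ge_gaussian_mixture[where F = F and \<beta> = \<beta> and \<Omega> = \<Omega>
        and \<sigma> = "\<lambda>_. \<sigma>" and w = \<omega> and \<kappa> = "1 + a" and h = h and g = g and \<eta> = \<eta> and T = "\<lambda>\<beta>. \<xi> \<bullet> \<beta>"])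
    show "(\<beta>\<^sub>0, 1\<^sub>m p, \<sigma>\<^sub>0) \<in> Theta M\<^sub>1 M\<^sub>2 p k\<^sub>1" "(\<beta>\<^sub>0, 1\<^sub>m p, \<sigma>\<^sub>0) \<in> Theta M\<^sub>1 M\<^sub>2 p k"
      using th0 by auto
    show "\<beta>\<^sub>0 \<in> carrier_vec p" "0 < \<sigma>\<^sub>0" "0 < \<omega>" using M a2 by (simp_all add: \<beta>\<^sub>0_def \<sigma>\<^sub>0_def \<omega>_def)
    show "(\<Sum>i\<in>F. \<Sum>j\<in>F. ((1 + a) / (1 + a - (\<Sum>k<p. g i k * g j k))) ^ n) \<le> (1 + \<eta>\<^sup>2) * (real (card F))\<^sup>2"
      using chi by (simp add: gg cong: sum.cong)
    fix i assume i: "i \<in> F"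
    show "(\<beta> i, \<Omega> i, \<sigma>) \<in> Theta M\<^sub>1 M\<^sub>2 p k" by (rule th[OF i])
    show "\<xi> \<bullet> \<beta> i = M\<^sub>2 * b * (\<xi> \<bullet> vec p v)" by (rule T[OF i])
    show "\<beta> i \<in> carrier_vec p" "\<Omega> i \<in> carrier_mat p p" by (simp_all add: \<beta>_def \<Omega>_def rank_two_update_carrier)
    show "0 \<le> Determinant.det (\<Omega> i)" using z by (simp add: det[OF i])
    show "(\<Sum>j<p. (g i j)\<^sup>2) < 1 + a" using K by (simp add: g2[OF i])
    show "h j = 0 \<or> g i j = 0" for j using S(3)[OF i] by (auto simp: h_def g_def)
  qed (use F \<eta> \<alpha> \<kappa> dens in auto)
  moreover have "M\<^sub>2 * r\<^sup>2 * \<bar>\<xi> \<bullet> vec p v\<bar> \<le> \<bar>M\<^sub>2 * b * (\<xi> \<bullet> vec p v) - \<xi> \<bullet> \<beta>\<^sub>0\<bar>"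
  proof -
    have "a - b = r\<^sup>2 * ((1 - a) / (1 - r\<^sup>2))" using z by (simp add: b_def field_simps)
    moreover have "1 \<le> (1 - a) / (1 - r\<^sup>2)" using a z by simp
    ultimately have "r\<^sup>2 \<le> a - b" using mult_left_mono[of 1 "(1 - a) / (1 - r\<^sup>2)" "r\<^sup>2"] by simp
    then have "r\<^sup>2 \<le> \<bar>b - a\<bar>" by simp
    then have "M\<^sub>2 * r\<^sup>2 * \<bar>\<xi> \<bullet> vec p v\<bar> \<le> M\<^sub>2 * \<bar>b - a\<bar> * \<bar>\<xi> \<bullet> vec p v\<bar>"
      using M by (intro mult_right_mono mult_left_mono) auto
    also have "\<dots> = \<bar>M\<^sub>2 * (b - a) * (\<xi> \<bullet> vec p v)\<bar>" using M by (simp add: abs_mult)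
    finally show ?thesis unfolding T0 by (simp add: algebra_simps)
  qed
  then have "M\<^sub>2 * r\<^sup>2 * \<bar>\<xi> \<bullet> vec p v\<bar> * (1 - 2 * \<alpha> - \<eta>)
      \<le> \<bar>M\<^sub>2 * b * (\<xi> \<bullet> vec p v) - \<xi> \<bullet> \<beta>\<^sub>0\<bar> * (1 - 2 * \<alpha> - \<eta>)"
    using \<alpha>(2) by (rule mult_right_mono)
  ultimately show ?thesis by (meson ennreal_leI order_trans)
qed

section \<open>Averaging over random confounder sets\<close>

text \<open>
  Two independent uniform functions agree at each of the \<open>s\<close> places independently with probability
  \<open>1 / B\<close>.  Selecting one element from each of \<open>s\<close> blocks therefore gives the size of the overlap
  of two random sets an exactly binomial law, which for uniform \<open>s\<close>-subsets holds only as a comparison.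
\<close>

lemma sum_exp_agreements:
  assumes "1 \<le> B"
  shows "(\<Sum>f\<in>{..<s::nat} \<rightarrow>\<^sub>E {..<B::nat}. \<Sum>f'\<in>{..<s} \<rightarrow>\<^sub>E {..<B}. exp (l * real (card {i\<in>{..<s}. f i = f' i})))
    = (real B * (real B - 1 + exp l)) ^ s"
proof -
  have one: "(\<Sum>f'\<in>{..<s} \<rightarrow>\<^sub>E {..<B}. exp (l * real (card {i\<in>{..<s}. f i = f' i}))) = (real B - 1 + exp l) ^ s"
    if f: "f \<in> {..<s} \<rightarrow>\<^sub>E {..<B}" for f
  proof -
    have "exp (l * real (card {i\<in>{..<s}. f i = f' i})) = (\<Prod>i<s. if f i = f' i then exp l else 1)" for f'
    proof -
      have "(\<Prod>i<s. if f i = f' i then exp l else 1) = (\<Prod>i\<in>{i\<in>{..<s}. f i = f' i}. exp l)"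
        by (intro prod.inter_filter[symmetric]) simp
      then show ?thesis by (simp add: exp_of_nat_mult mult.commute[of l] del: lessThan_iff)
    qed
    then have "(\<Sum>f'\<in>{..<s} \<rightarrow>\<^sub>E {..<B}. exp (l * real (card {i\<in>{..<s}. f i = f' i})))
      = (\<Prod>i<s. \<Sum>b<B. if f i = b then exp l else 1)"
      by (subst prod_sum_PiE) simp_all
    also have "\<dots> = (\<Prod>i<s. real B - 1 + exp l)"
    proof (intro prod.cong refl)
      fix i assume "i \<in> {..<s}"
      then have fi: "f i \<in> {..<B}" using f by auto
      have "(\<Sum>b<B. if f i = b then exp l else 1) = (\<Sum>b<B. 1 + (if f i = b then exp l - 1 else 0))"
        by (intro sum.cong) auto
      also have "\<dots> = real B - 1 + exp l"
        using fi by (simp add: sum.distrib)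
      finally show "(\<Sum>b<B. if f i = b then exp l else 1) = real B - 1 + exp l" .
    qed
    finally show ?thesis by simp
  qed
  have "(\<Sum>f\<in>{..<s} \<rightarrow>\<^sub>E {..<B}. \<Sum>f'\<in>{..<s} \<rightarrow>\<^sub>E {..<B}. exp (l * real (card {i\<in>{..<s}. f i = f' i})))
    = (\<Sum>f\<in>{..<s} \<rightarrow>\<^sub>E {..<B}. (real B - 1 + exp l) ^ s)"
    by (intro sum.cong refl one)
  also have "\<dots> = (real B * (real B - 1 + exp l)) ^ s"
    by (simp add: card_PiE power_mult_distrib)
  finally show ?thesis .
qed

lemma power_inverse_le_exp:
  fixes x :: real
  assumes "0 \<le> x" "x \<le> 1 / 2"
  shows "(1 / (1 - x)) ^ n \<le> exp (2 * real n * x)"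
proof -
  have "x * x \<le> x * (1 / 2)" using assms by (intro mult_left_mono) auto
  then have "- (2 * x) \<le> ln (1 - x)"
    using ln_one_minus_pos_lower_bound[OF assms] by (simp add: power2_eq_square)
  then have "exp (- (2 * x)) \<le> 1 - x"
    using assms by (subst ln_ge_iff[symmetric]) auto
  then have "1 / (1 - x) \<le> exp (2 * x)"
    using assms by (simp add: exp_minus field_simps)
  then have "(1 / (1 - x)) ^ n \<le> exp (2 * x) ^ n"
    using assms by (intro power_mono) auto
  also have "\<dots> = exp (2 * real n * x)" by (simp add: exp_of_nat_mult[symmetric] mult_ac)
  finally show ?thesis .
qed

text \<open>
  Any \<open>m\<close> of the \<open>q\<close> comparable entries carry at least the fraction \<open>m / (q cb\<^sup>2)\<close> of the squared norm.
\<close>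

lemma obtain_unit_direction:
  assumes \<xi>: "\<xi> \<in> Xi p q cb" and cb: "1 \<le> cb" and m: "1 \<le> m" "m \<le> q"
  obtains v :: "nat \<Rightarrow> real" where "(\<Sum>j<p. (v j)\<^sup>2) = 1" "card {j. j < p \<and> v j \<noteq> 0} \<le> m"
    "\<And>j. v j \<noteq> 0 \<Longrightarrow> j \<in> vsupp \<xi>" "sqrt (real m / real q) / cb * l2 \<xi> \<le> \<bar>\<xi> \<bullet> vec p v\<bar>"
proof -
  let ?S = "vsupp \<xi>"
  have car: "\<xi> \<in> carrier_vec p" and card: "card ?S = q" and ratio:
    "Max ((\<lambda>j. \<bar>\<xi> $ j\<bar>) ` ?S) / Min ((\<lambda>j. \<bar>\<xi> $ j\<bar>) ` ?S) \<le> cb"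
    using \<xi> by (auto simp: Xi_def l0_def)
  have fin: "finite ?S" by (simp add: vsupp_def)
  have ne: "?S \<noteq> {}" using card m by auto
  have Sp: "?S \<subseteq> {..<p}" using car by (auto simp: vsupp_def)
  obtain S' where S': "S' \<subseteq> ?S" "card S' = m"
    using obtain_subset_with_card_n[of m ?S] card m by auto
  have fS': "finite S'" using S' fin finite_subset by blast
  define lo where "lo = Min ((\<lambda>j. \<bar>\<xi> $ j\<bar>) ` ?S)"
  define hi where "hi = Max ((\<lambda>j. \<bar>\<xi> $ j\<bar>) ` ?S)"
  have lo: "lo \<le> \<bar>\<xi> $ j\<bar>" if "j \<in> ?S" for j using fin that by (simp add: lo_def)
  have hi: "\<bar>\<xi> $ j\<bar> \<le> hi" if "j \<in> ?S" for j using fin that by (simp add: hi_def)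
  have "lo \<in> (\<lambda>j. \<bar>\<xi> $ j\<bar>) ` ?S" using fin ne unfolding lo_def by (intro Min_in) auto
  then have lo0: "0 < lo" by (auto simp: vsupp_def)
  have hl: "hi \<le> cb * lo" using ratio lo0 unfolding hi_def[symmetric] lo_def[symmetric] by (simp add: divide_le_eq)
  have hi0: "0 \<le> hi" using ne hi by fastforce
  define N where "N = sqrt (\<Sum>j\<in>S'. (\<xi> $ j)\<^sup>2)"
  have "real m * lo\<^sup>2 = (\<Sum>j\<in>S'. lo\<^sup>2)" using S' by simp
  also have "\<dots> \<le> (\<Sum>j\<in>S'. (\<xi> $ j)\<^sup>2)"
  proof (intro sum_mono)
    fix j assume "j \<in> S'"
    then have "lo\<^sup>2 \<le> \<bar>\<xi> $ j\<bar>\<^sup>2" using lo S' lo0 by (intro power_mono) auto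
    then show "lo\<^sup>2 \<le> (\<xi> $ j)\<^sup>2" by simp
  qed
  finally have mlo: "real m * lo\<^sup>2 \<le> (\<Sum>j\<in>S'. (\<xi> $ j)\<^sup>2)" .
  have "0 < real m * lo\<^sup>2" using m lo0 by simp
  then have N0: "0 < (\<Sum>j\<in>S'. (\<xi> $ j)\<^sup>2)" using mlo by linarith
  then have N: "0 < N" "N\<^sup>2 = (\<Sum>j\<in>S'. (\<xi> $ j)\<^sup>2)" by (simp_all add: N_def)
  define v where "v j = (if j \<in> S' then \<xi> $ j / N else 0)" for j
  have S'p: "{..<p} \<inter> S' = S'" using S' Sp by blast
  have restr: "(\<Sum>j<p. if j \<in> S' then G j else 0) = (\<Sum>j\<in>S'. G j)" for G :: "nat \<Rightarrow> real"
    using sum.inter_restrict[of "{..<p}" G S'] S'p by simp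
  show thesis
  proof
    have "(\<Sum>j<p. (v j)\<^sup>2) = (\<Sum>j<p. if j \<in> S' then (\<xi> $ j)\<^sup>2 / N\<^sup>2 else 0)"
      by (intro sum.cong) (auto simp: v_def power_divide)
    also have "\<dots> = 1" unfolding restr sum_divide_distrib[symmetric] N(2)[symmetric] using N(1) by simp
    finally show "(\<Sum>j<p. (v j)\<^sup>2) = 1" .
    have "card {j. j < p \<and> v j \<noteq> 0} \<le> card S'"
      by (intro card_mono fS') (auto simp: v_def split: if_splits)
    then show "card {j. j < p \<and> v j \<noteq> 0} \<le> m" using S' by simp
    show "j \<in> ?S" if "v j \<noteq> 0" for j using that S' by (auto simp: v_def split: if_splits)
    have "\<xi> \<bullet> vec p v = (\<Sum>j<p. if j \<in> S' then (\<xi> $ j)\<^sup>2 / N else 0)"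
      by (auto simp: scalar_prod_def atLeast0LessThan v_def power2_eq_square intro!: sum.cong)
    also have "\<dots> = N"
      unfolding restr sum_divide_distrib[symmetric] N(2)[symmetric] using N(1) by (simp add: power2_eq_square)
    finally have dot: "\<xi> \<bullet> vec p v = N" .
    have "(l2 \<xi>)\<^sup>2 = (\<Sum>j<p. (\<xi> $ j)\<^sup>2)"
      using car by (simp add: l2_def L2_set_def sum_nonneg)
    also have "\<dots> = (\<Sum>j\<in>?S. (\<xi> $ j)\<^sup>2)"
      using Sp car by (intro sum.mono_neutral_right) (auto simp: vsupp_def)
    also have "\<dots> \<le> (\<Sum>j\<in>?S. hi\<^sup>2)"
    proof (intro sum_mono)
      fix j assume "j \<in> ?S"
      then have "\<bar>\<xi> $ j\<bar>\<^sup>2 \<le> hi\<^sup>2" using hi by (intro power_mono) auto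
      then show "(\<xi> $ j)\<^sup>2 \<le> hi\<^sup>2" by simp
    qed
    also have "\<dots> = real q * hi\<^sup>2" using card by simp
    also have "\<dots> \<le> real q * (cb * lo)\<^sup>2"
      using hl hi0 by (intro mult_left_mono power_mono) auto
    finally have l2q: "(l2 \<xi>)\<^sup>2 \<le> real q * (cb * lo)\<^sup>2" .
    have "(sqrt (real m / real q) / cb * l2 \<xi>)\<^sup>2 = (real m / real q) / cb\<^sup>2 * (l2 \<xi>)\<^sup>2"
      by (simp add: power_mult_distrib power_divide)
    also have "\<dots> \<le> (real m / real q) / cb\<^sup>2 * (real q * (cb * lo)\<^sup>2)"
      using l2q by (intro mult_left_mono) auto
    also have "\<dots> = real m * lo\<^sup>2"
      using cb m by (simp add: power_mult_distrib)
    also have "\<dots> \<le> N\<^sup>2" using mlo N(2) by simp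
    finally have "sqrt (real m / real q) / cb * l2 \<xi> \<le> N"
      using less_imp_le[OF N(1)] by (rule power2_le_imp_le)
    then show "sqrt (real m / real q) / cb * l2 \<xi> \<le> \<bar>\<xi> \<bullet> vec p v\<bar>"
      using dot N(1) by simp
  qed
qed

text \<open>A subset of \<open>R\<close> of size \<open>s * B\<close> is enumerated and cut into \<open>s\<close> blocks of length \<open>B\<close>; \<open>f\<close> selects one element of each.\<close>

lemma obtain_block_selections:
  assumes R: "finite R" "s * B \<le> card R"
  obtains S :: "(nat \<Rightarrow> nat) \<Rightarrow> nat set" where
    "\<And>f. f \<in> {..<s} \<rightarrow>\<^sub>E {..<B} \<Longrightarrow> S f \<subseteq> R"
    "\<And>f. f \<in> {..<s} \<rightarrow>\<^sub>E {..<B} \<Longrightarrow> card (S f) = s"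
    "\<And>f f'. f \<in> {..<s} \<rightarrow>\<^sub>E {..<B} \<Longrightarrow> f' \<in> {..<s} \<rightarrow>\<^sub>E {..<B} \<Longrightarrow> card (S f \<inter> S f') = card {i\<in>{..<s}. f i = f' i}"
proof -
  obtain R' where R': "R' \<subseteq> R" "card R' = s * B" "finite R'"
    using obtain_subset_with_card_n[OF R(2)] by metis
  obtain \<phi> where \<phi>: "bij_betw \<phi> {0..<s * B} R'"
    using ex_bij_betw_nat_finite[OF R'(3)] R'(2) by auto
  define pos where "pos f i = \<phi> (i * B + f i)" for f :: "nat \<Rightarrow> nat" and i
  have lt: "i * B + b < s * B" if "i < s" "b < B" for i b
  proof -
    have "i * B + b < Suc i * B" using that by simp
    also have "\<dots> \<le> s * B" using that by (intro mult_le_mono1) simp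
    finally show ?thesis .
  qed
  have fB: "f i < B" if "f \<in> {..<s} \<rightarrow>\<^sub>E {..<B}" "i < s" for f i using that by auto
  have eq: "pos f i = pos f' i' \<longleftrightarrow> i = i' \<and> f i = f' i'"
    if f: "f \<in> {..<s} \<rightarrow>\<^sub>E {..<B}" "f' \<in> {..<s} \<rightarrow>\<^sub>E {..<B}" and i: "i < s" "i' < s" for f f' i i'
  proof
    assume "pos f i = pos f' i'"
    then have e: "i * B + f i = i' * B + f' i'"
      using \<phi> lt[OF i(1) fB[OF f(1) i(1)]] lt[OF i(2) fB[OF f(2) i(2)]]
      unfolding pos_def bij_betw_def by (auto dest: inj_onD)
    have "i = (i * B + f i) div B" "f i = (i * B + f i) mod B" using fB[OF f(1) i(1)] by auto
    moreover have "i' = (i' * B + f' i') div B" "f' i' = (i' * B + f' i') mod B" using fB[OF f(2) i(2)] by auto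
    ultimately show "i = i' \<and> f i = f' i'" using e by metis
  qed (auto simp: pos_def)
  have inj: "inj_on (pos f) {..<s}" if "f \<in> {..<s} \<rightarrow>\<^sub>E {..<B}" for f
    using eq[OF that that] by (auto intro!: inj_onI)
  show thesis
  proof
    fix f assume f: "f \<in> {..<s} \<rightarrow>\<^sub>E {..<B}"
    show "pos f ` {..<s} \<subseteq> R"
      using \<phi> R'(1) lt[OF _ fB[OF f]] unfolding pos_def bij_betw_def by fastforce
    show "card (pos f ` {..<s}) = s" using card_image[OF inj[OF f]] by simp
    fix f' assume f': "f' \<in> {..<s} \<rightarrow>\<^sub>E {..<B}"
    have "pos f ` {..<s} \<inter> pos f' ` {..<s} = pos f ` {i\<in>{..<s}. f i = f' i}"
      using eq[OF f f'] by (auto simp: image_iff)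
    moreover have "inj_on (pos f) {i\<in>{..<s}. f i = f' i}"
      using inj[OF f] by (rule inj_on_subset) auto
    ultimately show "card (pos f ` {..<s} \<inter> pos f' ` {..<s}) = card {i\<in>{..<s}. f i = f' i}"
      by (simp add: card_image)
  qed
qed

text \<open>
  Each inner product is at most \<open>exp (4 n \<rho>\<^sup>2 J)\<close> with \<open>J\<close> the overlap of the two sets, and the average over
  block selections is at most \<open>exp (s exp (4 n \<rho>\<^sup>2) / B)\<close>.
\<close>

lemma minimax_length_ge_sparse:
  fixes v :: "nat \<Rightarrow> real"
  assumes p: "0 < p" and M: "1 < M\<^sub>1" "0 < M\<^sub>2" and v: "(\<Sum>j<p. (v j)\<^sup>2) = 1"
    and \<xi>: "\<xi> \<in> carrier_vec p" and vsub: "\<And>j. v j \<noteq> 0 \<Longrightarrow> j \<in> vsupp \<xi>"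
    and s: "0 < s" and B: "1 \<le> B" "s * B + card (vsupp \<xi>) \<le> p"
    and \<rho>: "0 < \<rho>" and r_def: "r = \<rho> * sqrt s"
    and r: "r \<le> 1 / 2" "1 \<le> M\<^sub>1 * (1 - r)"
    and a: "0 \<le> a" "a \<le> r\<^sup>2"
    and sp0: "a = 0 \<or> card {j. j < p \<and> v j \<noteq> 0} \<le> k\<^sub>1" "k\<^sub>1 \<le> k"
    and sp1: "(if a = r\<^sup>2 then 0 else card {j. j < p \<and> v j \<noteq> 0}) + s \<le> k"
    and \<eta>: "0 < \<eta>" and \<alpha>: "\<alpha> < 1" "0 \<le> 1 - 2 * \<alpha> - \<eta>"
    and small: "s * exp (4 * real n * \<rho>\<^sup>2) / B \<le> ln (1 + \<eta>\<^sup>2)"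
  shows "ennreal (M\<^sub>2 * r\<^sup>2 * \<bar>\<xi> \<bullet> vec p v\<bar> * (1 - 2 * \<alpha> - \<eta>))
    \<le> minimax_length n p \<alpha> (Theta M\<^sub>1 M\<^sub>2 p k\<^sub>1) (Theta M\<^sub>1 M\<^sub>2 p k) (\<lambda>\<beta>. \<xi> \<bullet> \<beta>)"
proof -
  let ?R = "{..<p} - vsupp \<xi>"
  let ?F = "{..<s} \<rightarrow>\<^sub>E {..<B}"
  have Sp: "vsupp \<xi> \<subseteq> {..<p}" using \<xi> by (auto simp: vsupp_def)
  then have "card ?R = p - card (vsupp \<xi>)"
    using card_Diff_subset[of "vsupp \<xi>" "{..<p}"] finite_subset[OF Sp] by simp
  then have "s * B \<le> card ?R" using B(2) by simp
  then obtain S where S: "\<And>f. f \<in> ?F \<Longrightarrow> S f \<subseteq> ?R" "\<And>f. f \<in> ?F \<Longrightarrow> card (S f) = s"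
    "\<And>f f'. f \<in> ?F \<Longrightarrow> f' \<in> ?F \<Longrightarrow> card (S f \<inter> S f') = card {i\<in>{..<s}. f i = f' i}"
    using obtain_block_selections[of ?R s B] by auto
  have r2: "r\<^sup>2 = \<rho>\<^sup>2 * s" by (simp add: r_def power_mult_distrib)
  have "0 \<le> r" using \<rho> by (simp add: r_def)
  then have "r\<^sup>2 \<le> (1 / 2)\<^sup>2" using r(1) by (intro power_mono) auto
  then have r4: "\<rho>\<^sup>2 * s \<le> 1 / 4" unfolding r2[symmetric] by (simp add: power2_eq_square)
  have summand: "((1 + a) / (1 + a - 2 * \<rho>\<^sup>2 * card (S f \<inter> S f'))) ^ n
      \<le> exp (4 * real n * \<rho>\<^sup>2 * card {i\<in>{..<s}. f i = f' i})" if f: "f \<in> ?F" "f' \<in> ?F" for f f'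
  proof -
    define J where "J = card {i\<in>{..<s}. f i = f' i}"
    have "J \<le> card {..<s}" unfolding J_def by (intro card_mono) auto
    then have "\<rho>\<^sup>2 * J \<le> \<rho>\<^sup>2 * s" by (intro mult_left_mono) auto
    then have J: "2 * \<rho>\<^sup>2 * J \<le> 1 / 2" using r4 by simp
    define x where "x = 2 * \<rho>\<^sup>2 * J / (1 + a)"
    have "2 * \<rho>\<^sup>2 * J * 1 \<le> 2 * \<rho>\<^sup>2 * J * (1 + a)" using a by (intro mult_left_mono) auto
    then have x: "0 \<le> x" "x \<le> 2 * \<rho>\<^sup>2 * J" using a by (simp_all add: x_def divide_le_eq)
    have "(1 + a) / (1 + a - 2 * \<rho>\<^sup>2 * J) = 1 / (1 - x)"
      using a J by (simp add: x_def field_simps)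
    then have "((1 + a) / (1 + a - 2 * \<rho>\<^sup>2 * J)) ^ n \<le> exp (2 * real n * x)"
      using power_inverse_le_exp[of x n] x J by simp
    also have "\<dots> \<le> exp (2 * real n * (2 * \<rho>\<^sup>2 * J))"
      unfolding exp_le_cancel_iff by (intro mult_left_mono x(2)) simp
    finally show ?thesis unfolding S(3)[OF f] J_def[symmetric] by (simp add: mult_ac)
  qed
  have "(\<Sum>f\<in>?F. \<Sum>f'\<in>?F. ((1 + a) / (1 + a - 2 * \<rho>\<^sup>2 * card (S f \<inter> S f'))) ^ n)
      \<le> (\<Sum>f\<in>?F. \<Sum>f'\<in>?F. exp (4 * real n * \<rho>\<^sup>2 * card {i\<in>{..<s}. f i = f' i}))"
    by (intro sum_mono summand)
  also have "\<dots> = (real B * (real B - 1 + exp (4 * real n * \<rho>\<^sup>2))) ^ s"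
    by (rule sum_exp_agreements[OF B(1)])
  also have "\<dots> \<le> (real B * (real B * exp (exp (4 * real n * \<rho>\<^sup>2) / B))) ^ s"
  proof (intro power_mono mult_left_mono)
    have "real B * (1 + exp (4 * real n * \<rho>\<^sup>2) / B) \<le> real B * exp (exp (4 * real n * \<rho>\<^sup>2) / B)"
      by (intro mult_left_mono exp_ge_add_one_self) auto
    then show "real B - 1 + exp (4 * real n * \<rho>\<^sup>2) \<le> real B * exp (exp (4 * real n * \<rho>\<^sup>2) / B)"
      using B(1) by (simp add: algebra_simps)
    show "0 \<le> real B * (real B - 1 + exp (4 * real n * \<rho>\<^sup>2))" using B(1) by simp
  qed simp
  also have "\<dots> = (real B ^ s)\<^sup>2 * exp (s * exp (4 * real n * \<rho>\<^sup>2) / B)"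
    by (simp add: power_mult_distrib exp_of_nat_mult[symmetric] power2_eq_square)
  also have "\<dots> \<le> (real B ^ s)\<^sup>2 * (1 + \<eta>\<^sup>2)"
  proof (intro mult_left_mono)
    have "exp (s * exp (4 * real n * \<rho>\<^sup>2) / B) \<le> exp (ln (1 + \<eta>\<^sup>2))" using small by simp
    then show "exp (s * exp (4 * real n * \<rho>\<^sup>2) / B) \<le> 1 + \<eta>\<^sup>2"
      by (simp add: add_pos_nonneg)
  qed simp
  also have "\<dots> = (1 + \<eta>\<^sup>2) * (real (card ?F))\<^sup>2" by (simp add: card_PiE)
  finally have chi: "(\<Sum>f\<in>?F. \<Sum>f'\<in>?F. ((1 + a) / (1 + a - 2 * \<rho>\<^sup>2 * card (S f \<inter> S f'))) ^ n) \<le> (1 + \<eta>\<^sup>2) * (real (card ?F))\<^sup>2" .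
  have ne: "?F \<noteq> {}" using B(1) by (auto simp: PiE_eq_empty_iff lessThan_empty_iff)
  have fin: "finite ?F" by (intro finite_PiE) auto
  have S1: "S f \<subseteq> {..<p}" if "f \<in> ?F" for f using S(1)[OF that] by blast
  have S2: "v j = 0 \<and> \<xi> $ j = 0" if "f \<in> ?F" "j \<in> S f" for f j
    using S(1)[OF that(1)] that(2) vsub[of j] \<xi> by (auto simp: vsupp_def)
  show ?thesis
    by (rule minimax_length_ge_confounded[OF p M v fin ne S1 S(2) S2 s \<rho> r_def r a sp0 sp1 \<eta> \<alpha> chi])
qed

text \<open>
  With \<open>s \<le> k \<le> c p\<^sup>\<gamma>\<close> confounders, blocks of length at least \<open>p / (2 s)\<close>, and \<open>exp (4 n \<rho>\<^sup>2) \<le> p\<^sup>t\<close>, the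
  exponent above is at most \<open>2 c\<^sup>2 p\<close> to the power \<open>2 \<gamma> + t - 1 = - t\<close>.  This is where
  \<open>\<gamma> < 1 / 2\<close> enters.
\<close>

lemma eventually_sparse_regime:
  fixes \<gamma> c C \<Lambda> t :: real
  assumes "\<gamma> < 1 / 2" "0 < \<Lambda>" and t: "t = (1 - 2 * \<gamma>) / 2"
  shows "\<exists>P\<ge>2. \<forall>p\<ge>P. C * c * real p powr \<gamma> \<le> real p / 4 \<and> c * real p powr \<gamma> \<le> real p / 4 \<and>
    2 * (c * real p powr \<gamma>)\<^sup>2 * real p powr t / real p \<le> \<Lambda>"
proof -
  have lim: "((\<lambda>p. real p powr e) \<longlongrightarrow> 0) sequentially" if "e < 0" for e
    using that by (intro tendsto_neg_powr filterlim_real_sequentially)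
  have l1: "(\<lambda>p. d * real p powr (\<gamma> - 1)) \<longlonglongrightarrow> d * 0" for d
    using assms by (intro tendsto_intros lim) simp
  have l2: "(\<lambda>p. 2 * c\<^sup>2 * real p powr (2 * \<gamma> + t - 1)) \<longlonglongrightarrow> 2 * c\<^sup>2 * 0"
    using assms by (intro tendsto_mult[OF tendsto_const] lim) (simp add: t field_simps)
  have "\<forall>\<^sub>F p in sequentially. C * c * real p powr (\<gamma> - 1) < 1 / 4 \<and> c * real p powr (\<gamma> - 1) < 1 / 4 \<and>
      2 * c\<^sup>2 * real p powr (2 * \<gamma> + t - 1) < \<Lambda> \<and> 2 \<le> p"
    using order_tendstoD(2)[OF l1[of "C * c"], of "1 / 4"] order_tendstoD(2)[OF l1[of c], of "1 / 4"]
      order_tendstoD(2)[OF l2, of \<Lambda>] eventually_ge_at_top[of "2::nat"] assms(2)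
    by (simp add: eventually_conj_iff)
  then obtain P where P: "\<And>p. P \<le> p \<Longrightarrow> C * c * real p powr (\<gamma> - 1) < 1 / 4 \<and> c * real p powr (\<gamma> - 1) < 1 / 4 \<and>
      2 * c\<^sup>2 * real p powr (2 * \<gamma> + t - 1) < \<Lambda> \<and> 2 \<le> p"
    unfolding eventually_sequentially by blast
  have "C * c * real p powr \<gamma> \<le> real p / 4 \<and> c * real p powr \<gamma> \<le> real p / 4 \<and>
    2 * (c * real p powr \<gamma>)\<^sup>2 * real p powr t / real p \<le> \<Lambda>" if "P \<le> p" for p
  proof -
    have p: "0 < real p" using P[OF that] by simp
    have e1: "real p powr (\<gamma> - 1) = real p powr \<gamma> / real p"
      using p by (simp add: powr_diff)
    have e2: "real p powr (2 * \<gamma> + t - 1) = (real p powr \<gamma>)\<^sup>2 * real p powr t / real p"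
    proof -
      have "2 * \<gamma> + t - 1 = \<gamma> + \<gamma> + t - 1" by simp
      then show ?thesis
        using p unfolding power2_eq_square by (simp only: powr_diff powr_add) simp
    qed
    have clear: "d * real p powr \<gamma> \<le> real p / 4" if "d * real p powr (\<gamma> - 1) < 1 / 4" for d
    proof -
      have "d * real p powr \<gamma> = d * real p powr (\<gamma> - 1) * real p" using p unfolding e1 by simp
      also have "\<dots> \<le> 1 / 4 * real p" using that p by (intro mult_right_mono) auto
      finally show ?thesis by simp
    qed
    have "2 * (c * real p powr \<gamma>)\<^sup>2 * real p powr t / real p = 2 * c\<^sup>2 * real p powr (2 * \<gamma> + t - 1)"
      unfolding e2 by (simp add: power_mult_distrib)
    then show ?thesis using P[OF that] clear[of "C * c"] clear[of c] by simp
  qed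
  moreover have "2 \<le> P" using P[of P] by simp
  ultimately show ?thesis by blast
qed

section \<open>Uniform constants\<close>

lemma Xi_nonempty_support:
  assumes "\<xi> \<in> Xi p q cb"
  shows "1 \<le> q" "0 < p" "\<xi> \<in> carrier_vec p" "card (vsupp \<xi>) = q"
proof -
  have car: "\<xi> \<in> carrier_vec p" and ne: "\<xi> \<noteq> 0\<^sub>v p" and q: "card (vsupp \<xi>) = q"
    using assms by (auto simp: Xi_def l0_def)
  obtain j where j: "j < p" "\<xi> $ j \<noteq> 0"
  proof (rule ccontr)
    assume "\<not> thesis"
    then have "\<xi> = 0\<^sub>v p" using that car by (intro eq_vecI) auto
    with ne show False by simp
  qed
  then have "j \<in> vsupp \<xi>" using car by (simp add: vsupp_def)
  moreover have "finite (vsupp \<xi>)" by (simp add: vsupp_def)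
  ultimately have "0 < card (vsupp \<xi>)" by (auto simp: card_gt_0_iff)
  then show "1 \<le> q" "0 < p" "\<xi> \<in> carrier_vec p" "card (vsupp \<xi>) = q" using q j car by auto
qed

text \<open>
  The sparsity \<open>k - k div 2\<close> leaves \<open>k div 2\<close> coordinates to the confounders; both are positive for
  \<open>k \<ge> 2\<close>.
\<close>

lemma obtain_loading_direction:
  assumes \<xi>: "\<xi> \<in> Xi p q cb" and cb: "1 \<le> cb" and C: "0 < C" "real q \<le> C * real k"
  obtains v :: "nat \<Rightarrow> real" where "(\<Sum>j<p. (v j)\<^sup>2) = 1"
    "card {j. j < p \<and> v j \<noteq> 0} \<le> max 1 (k - k div 2)" "\<And>j. v j \<noteq> 0 \<Longrightarrow> j \<in> vsupp \<xi>"
    "sqrt (min 1 (1 / (2 * C))) / cb * l2 \<xi> \<le> \<bar>\<xi> \<bullet> vec p v\<bar>"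
proof -
  have q: "1 \<le> q" using Xi_nonempty_support[OF \<xi>] by simp
  define m where "m = min q (max 1 (k - k div 2))"
  have m: "1 \<le> m" "m \<le> q" using q by (auto simp: m_def)
  obtain v where v: "(\<Sum>j<p. (v j)\<^sup>2) = 1" "card {j. j < p \<and> v j \<noteq> 0} \<le> m"
    "\<And>j. v j \<noteq> 0 \<Longrightarrow> j \<in> vsupp \<xi>" "sqrt (real m / real q) / cb * l2 \<xi> \<le> \<bar>\<xi> \<bullet> vec p v\<bar>"
    using obtain_unit_direction[OF \<xi> cb m] by blast
  have "min 1 (1 / (2 * C)) \<le> real m / real q"
  proof (cases "q \<le> max 1 (k - k div 2)")
    case True
    then show ?thesis using q by (simp add: m_def min_absorb1)
  next
    case False
    then have "m = max 1 (k - k div 2)" by (simp add: m_def)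
    then have "k \<le> 2 * m" by linarith
    then have "real q \<le> 2 * C * real m" using C(2) C(1) mult_left_mono[of "real k" "2 * real m" C] by linarith
    then have "1 / (2 * C) \<le> real m / real q" using q C(1) by (simp add: field_simps)
    then show ?thesis by (rule min.coboundedI2)
  qed
  moreover have "0 \<le> l2 \<xi>" by (simp add: l2_def)
  ultimately have "sqrt (min 1 (1 / (2 * C))) / cb * l2 \<xi> \<le> sqrt (real m / real q) / cb * l2 \<xi>"
    using cb by (intro mult_right_mono divide_right_mono real_sqrt_le_mono) auto
  then have "sqrt (min 1 (1 / (2 * C))) / cb * l2 \<xi> \<le> \<bar>\<xi> \<bullet> vec p v\<bar>" using v(4) by (rule order_trans)
  moreover have "card {j. j < p \<and> v j \<noteq> 0} \<le> max 1 (k - k div 2)"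
    using v(2) by (rule order_trans) (simp add: m_def)
  ultimately show thesis by (intro that[OF v(1) _ v(3)])
qed

lemma parametric_rate:
  fixes M\<^sub>1 M\<^sub>2 cb C \<alpha> :: real
  assumes "M\<^sub>1 > 1" and "M\<^sub>2 > 0" and "cb \<ge> 1" and "C > 0" and "\<alpha> < 1 / 2"
  shows "\<exists>c\<^sub>1>0. \<forall>n p k\<^sub>1 k q \<xi>. n \<ge> 1 \<longrightarrow> \<xi> \<in> Xi p q cb \<longrightarrow> real q \<le> C * real k \<longrightarrow>
    ennreal (c\<^sub>1 * l2 \<xi> * (1 / sqrt (real n)))
      \<le> minimax_length n p \<alpha> (Theta M\<^sub>1 M\<^sub>2 p k\<^sub>1) (Theta M\<^sub>1 M\<^sub>2 p k) (\<lambda>\<beta>. \<xi> \<bullet> \<beta>)"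
proof -
  define \<eta> where "\<eta> = (1 - 2 * \<alpha>) / 2"
  have \<eta>: "0 < \<eta>" "1 - 2 * \<alpha> - \<eta> = \<eta>" using assms by (simp_all add: \<eta>_def field_simps)
  define \<Lambda> where "\<Lambda> = ln (1 + \<eta>\<^sup>2)"
  have \<Lambda>: "0 < \<Lambda>" unfolding \<Lambda>_def using \<eta>(1) by (intro ln_gt_zero) simp
  define d where "d = sqrt (min (1 / 4) (\<Lambda> / 2))"
  have d: "0 < d" "d\<^sup>2 \<le> 1 / 4" "2 * d\<^sup>2 \<le> \<Lambda>" using \<Lambda> by (auto simp: d_def min_def)
  define \<delta> where "\<delta> = sqrt (min 1 (1 / (2 * C))) / cb"
  have \<delta>: "0 < \<delta>" using assms by (simp add: \<delta>_def)
  show ?thesis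
  proof (intro exI[of _ "M\<^sub>2 * d * \<delta> * \<eta>"] conjI allI impI)
    show "0 < M\<^sub>2 * d * \<delta> * \<eta>" using assms d \<delta> \<eta> by simp
    fix n p k\<^sub>1 k q :: nat and \<xi> :: "real vec"
    assume n: "1 \<le> n" and \<xi>: "\<xi> \<in> Xi p q cb" and q: "real q \<le> C * real k"
    note X = Xi_nonempty_support[OF \<xi>]
    have "real q \<noteq> 0" using X by simp
    then have k: "1 \<le> k" using q by (cases k) auto
    obtain v where v: "(\<Sum>j<p. (v j)\<^sup>2) = 1"
      "card {j. j < p \<and> v j \<noteq> 0} \<le> max 1 (k - k div 2)" "\<delta> * l2 \<xi> \<le> \<bar>\<xi> \<bullet> vec p v\<bar>"
      using obtain_loading_direction[OF \<xi> assms(3,4) q] unfolding \<delta>_def by blast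
    have sp: "card {j. j < p \<and> v j \<noteq> 0} \<le> k" using v(2) k by linarith
    define b where "b = d / sqrt n"
    have b2: "b\<^sup>2 = d\<^sup>2 / n" by (simp add: b_def power_divide)
    also have "\<dots> \<le> d\<^sup>2 / 1" using n by (intro divide_left_mono) auto
    finally have b4: "b\<^sup>2 \<le> 1 / 4" using d by simp
    have b0: "0 < b" using d n by (simp add: b_def)
    have "b\<^sup>2 < 1\<^sup>2" using b4 by simp
    then have b1: "b < 1" by (rule power2_less_imp_less) simp
    have "(1 / (1 - b\<^sup>2)) ^ n \<le> exp (2 * real n * b\<^sup>2)"
      using b4 by (intro power_inverse_le_exp) auto
    also have "2 * real n * b\<^sup>2 = 2 * d\<^sup>2" using n by (simp add: b2)
    also have "exp (2 * d\<^sup>2) \<le> exp \<Lambda>" using d by simp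
    also have "\<dots> = 1 + \<eta>\<^sup>2" by (simp add: \<Lambda>_def add_pos_nonneg)
    finally have chi: "(1 / (1 - b\<^sup>2)) ^ n \<le> 1 + \<eta>\<^sup>2" .
    have "M\<^sub>2 * d * \<delta> * \<eta> * l2 \<xi> * (1 / sqrt n) = M\<^sub>2 * b * (\<delta> * l2 \<xi>) * \<eta>" by (simp add: b_def)
    also have "\<dots> \<le> M\<^sub>2 * b * \<bar>\<xi> \<bullet> vec p v\<bar> * \<eta>"
      using assms b0 \<eta> v(3) by (intro mult_right_mono mult_left_mono) auto
    finally have "ennreal (M\<^sub>2 * d * \<delta> * \<eta> * l2 \<xi> * (1 / sqrt n)) \<le> ennreal (M\<^sub>2 * b * \<bar>\<xi> \<bullet> vec p v\<bar> * (1 - 2 * \<alpha> - \<eta>))"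
      unfolding \<eta>(2) by (rule ennreal_leI)
    also have "\<dots> \<le> minimax_length n p \<alpha> (Theta M\<^sub>1 M\<^sub>2 p k\<^sub>1) (Theta M\<^sub>1 M\<^sub>2 p k) (\<lambda>\<beta>. \<xi> \<bullet> \<beta>)"
      using assms by (intro minimax_length_ge_parametric X(2) v(1) sp b0 b1 \<eta>(1) chi) auto
    finally show "ennreal (M\<^sub>2 * d * \<delta> * \<eta> * l2 \<xi> * (1 / sqrt n))
      \<le> minimax_length n p \<alpha> (Theta M\<^sub>1 M\<^sub>2 p k\<^sub>1) (Theta M\<^sub>1 M\<^sub>2 p k) (\<lambda>\<beta>. \<xi> \<bullet> \<beta>)" .
  qed
qed

text \<open>
  The bound \<open>k log p \<le> c n\<close> does not make \<open>r\<^sup>2 = \<rho>\<^sup>2 s\<close> small, but only bounded.  The constant \<open>t'\<close> in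
  \<open>4 n \<rho>\<^sup>2 = t' log p\<close> is therefore chosen small also in terms of \<open>c\<close>, so that \<open>r \<le> r\<^sub>0\<close>; this keeps the
  eigenvalues of \<open>\<Omega>\<close> between \<open>1 / M\<^sub>1\<close> and \<open>M\<^sub>1\<close>.
\<close>

lemma sparse_rate:
  fixes M\<^sub>1 M\<^sub>2 cb C c \<gamma> \<alpha> :: real
  assumes "M\<^sub>1 > 1" and "M\<^sub>2 > 0" and "cb \<ge> 1" and "C > 0" and "c > 0"
    and "\<gamma> < 1 / 2" and "\<alpha> < 1 / 2"
  shows "\<exists>c\<^sub>1>0. \<exists>P\<ge>2. \<forall>n p k\<^sub>1 k q \<xi>. n \<ge> 1 \<longrightarrow> P \<le> p \<longrightarrow> \<xi> \<in> Xi p q cb \<longrightarrow> real q \<le> C * real k \<longrightarrow>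
    k\<^sub>1 \<le> k \<longrightarrow> (k\<^sub>1, k) \<noteq> (0, 1) \<longrightarrow>
    real k \<le> c * real p powr \<gamma> \<longrightarrow> real k * ln (real p) \<le> c * real n \<longrightarrow>
    ennreal (c\<^sub>1 * l2 \<xi> * (real k * (ln (real p) / real n)))
      \<le> minimax_length n p \<alpha> (Theta M\<^sub>1 M\<^sub>2 p k\<^sub>1) (Theta M\<^sub>1 M\<^sub>2 p k) (\<lambda>\<beta>. \<xi> \<bullet> \<beta>)"
proof -
  define \<eta> where "\<eta> = (1 - 2 * \<alpha>) / 2"
  have \<eta>: "0 < \<eta>" "1 - 2 * \<alpha> - \<eta> = \<eta>" using assms by (simp_all add: \<eta>_def field_simps)
  define \<Lambda> where "\<Lambda> = ln (1 + \<eta>\<^sup>2)"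
  have \<Lambda>: "0 < \<Lambda>" unfolding \<Lambda>_def using \<eta>(1) by (intro ln_gt_zero) simp
  define \<delta> where "\<delta> = sqrt (min 1 (1 / (2 * C))) / cb"
  have \<delta>: "0 < \<delta>" using assms by (simp add: \<delta>_def)
  define t where "t = (1 - 2 * \<gamma>) / 2"
  have t: "0 < t" using assms by (simp add: t_def)
  define r\<^sub>0 where "r\<^sub>0 = min (1 / 2) (1 - 1 / M\<^sub>1)"
  have r0: "0 < r\<^sub>0" using assms by (simp add: r\<^sub>0_def)
  define t' where "t' = min t (4 * r\<^sub>0\<^sup>2 / c)"
  have t': "0 < t'" "t' \<le> t" "t' \<le> 4 * r\<^sub>0\<^sup>2 / c" using t r0 assms by (auto simp: t'_def)
  obtain P where P: "2 \<le> P" "\<And>p. P \<le> p \<Longrightarrow> C * c * real p powr \<gamma> \<le> real p / 4 \<and> c * real p powr \<gamma> \<le> real p / 4 \<and>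
    2 * (c * real p powr \<gamma>)\<^sup>2 * real p powr t / real p \<le> \<Lambda>"
    using eventually_sparse_regime[OF assms(6) \<Lambda> t_def, of C c] by blast
  show ?thesis
  proof (intro exI[of _ "M\<^sub>2 * \<delta> * \<eta> * (t' / 12)"] exI[of _ P] conjI allI impI P(1))
    show "0 < M\<^sub>2 * \<delta> * \<eta> * (t' / 12)" using assms \<delta> \<eta> t' by simp
    fix n p k\<^sub>1 k q :: nat and \<xi> :: "real vec"
    assume n: "1 \<le> n" and p: "P \<le> p" and \<xi>: "\<xi> \<in> Xi p q cb" and q: "real q \<le> C * real k"
      and k1: "k\<^sub>1 \<le> k" and ne: "(k\<^sub>1, k) \<noteq> (0, 1)"
      and kp: "real k \<le> c * real p powr \<gamma>" and kn: "real k * ln (real p) \<le> c * real n"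
    note X = Xi_nonempty_support[OF \<xi>]
    have "real q \<noteq> 0" using X by simp
    then have k: "1 \<le> k" using q by (cases k) auto
    obtain v where v: "(\<Sum>j<p. (v j)\<^sup>2) = 1" "card {j. j < p \<and> v j \<noteq> 0} \<le> max 1 (k - k div 2)"
      "\<And>j. v j \<noteq> 0 \<Longrightarrow> j \<in> vsupp \<xi>" "\<delta> * l2 \<xi> \<le> \<bar>\<xi> \<bullet> vec p v\<bar>"
      using obtain_loading_direction[OF \<xi> assms(3,4) q] unfolding \<delta>_def by blast
    define s where "s = max 1 (k div 2)"
    have s: "0 < s" "s \<le> k" "k \<le> 3 * s" using k by (auto simp: s_def)
    have p2: "2 \<le> p" using p P(1) by simp
    then have lnp: "0 < ln (real p)" by simp
    define \<rho> where "\<rho> = sqrt (t' * ln (real p) / (4 * real n))"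
    have \<rho>: "0 < \<rho>" "4 * real n * \<rho>\<^sup>2 = t' * ln (real p)"
      using t' lnp n by (simp_all add: \<rho>_def)
    define r where "r = \<rho> * sqrt (real s)"
    have r2: "r\<^sup>2 = t' * (real s * ln (real p)) / (4 * real n)"
      using t' lnp n by (simp add: r_def \<rho>_def power_mult_distrib)
    have rpos: "0 < r" using \<rho> s by (simp add: r_def)
    have "real s * ln (real p) \<le> c * real n"
    proof -
      have "real s * ln (real p) \<le> real k * ln (real p)"
        using s(2) lnp by (intro mult_right_mono) auto
      then show ?thesis using kn by simp
    qed
    then have "r\<^sup>2 \<le> t' * (c * real n) / (4 * real n)"
      unfolding r2 using t'(1) by (intro divide_right_mono mult_left_mono) auto
    also have "\<dots> = t' * c / 4" using n by simp
    also have "\<dots> \<le> r\<^sub>0\<^sup>2" using t'(3) assms(5) by (simp add: field_simps)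
    finally have rr0: "r \<le> r\<^sub>0" using r0 by (intro power2_le_imp_le[of r r\<^sub>0]) auto
    have rM: "r \<le> 1 / 2" "1 \<le> M\<^sub>1 * (1 - r)"
    proof -
      show "r \<le> 1 / 2" using rr0 by (simp add: r\<^sub>0_def)
      have "1 / M\<^sub>1 \<le> 1 - r" using rr0 by (simp add: r\<^sub>0_def)
      then show "1 \<le> M\<^sub>1 * (1 - r)" using assms(1) by (simp add: field_simps)
    qed
    define B where "B = (p - q) div s"
    have "real q \<le> C * (c * real p powr \<gamma>)"
      using q kp assms(4) mult_left_mono[OF kp, of C] by linarith
    then have q4: "real q \<le> real p / 4" using P(2)[OF p] by (simp add: mult.assoc)
    have s4: "real s \<le> real p / 4" using P(2)[OF p] kp s(2) by linarith
    have Bs: "real p / (2 * real s) \<le> real B"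
    proof -
      have "p - q = B * s + (p - q) mod s" by (simp add: B_def)
      also have "\<dots> \<le> B * s + s" using s(1) by (simp add: less_imp_le)
      finally have "real p - real q \<le> real B * real s + real s"
        using q4 by (simp flip: of_nat_mult of_nat_add add: of_nat_diff)
      then have "real p / 2 \<le> real B * real s" using q4 s4 by simp
      then show ?thesis using s(1) by (simp add: field_simps)
    qed
    have "0 < real p / (2 * real s)" using p2 s(1) by simp
    then have B1: "1 \<le> B" using Bs by (cases B) auto
    have "s * B \<le> p - q" by (simp add: B_def)
    then have BR: "s * B + card (vsupp \<xi>) \<le> p" using X(4) q4 by linarith
    have small: "real s * exp (4 * real n * \<rho>\<^sup>2) / real B \<le> ln (1 + \<eta>\<^sup>2)"
    proof -
      have "exp (4 * real n * \<rho>\<^sup>2) = real p powr t'" using p2 by (simp add: \<rho>(2) powr_def)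
      also have "\<dots> \<le> real p powr t" using t' p2 by (intro powr_mono) auto
      finally have "real s * exp (4 * real n * \<rho>\<^sup>2) / real B \<le> real s * (real p powr t) / (real p / (2 * real s))"
        using Bs p2 s(1) by (intro frac_le mult_left_mono) auto
      also have "\<dots> = 2 * (real s)\<^sup>2 * real p powr t / real p"
        by (simp add: power2_eq_square)
      also have "\<dots> \<le> 2 * (c * real p powr \<gamma>)\<^sup>2 * real p powr t / real p"
        using s(2) kp by (intro divide_right_mono mult_right_mono mult_left_mono power_mono) auto
      also have "\<dots> \<le> \<Lambda>" using P(2)[OF p] by simp
      finally show ?thesis by (simp add: \<Lambda>_def)
    qed
    \<comment> \<open>for \<open>k = 1\<close> also \<open>k\<^sub>1 = 1\<close>, so the null may use the one coordinate of \<open>v\<close>\<close>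
    define a where "a = (if k = 1 then r\<^sup>2 else 0)"
    have a: "0 \<le> a" "a \<le> r\<^sup>2" by (auto simp: a_def)
    have sp0: "a = 0 \<or> card {j. j < p \<and> v j \<noteq> 0} \<le> k\<^sub>1"
      using v(2) ne k1 by (cases "k = 1") (auto simp: a_def)
    have sp1: "(if a = r\<^sup>2 then 0 else card {j. j < p \<and> v j \<noteq> 0}) + s \<le> k"
    proof (cases "k = 1")
      case True
      then show ?thesis by (simp add: a_def s_def)
    next
      case False
      then have "a \<noteq> r\<^sup>2" "s = k div 2" "max 1 (k - k div 2) = k - k div 2"
        using rpos k by (auto simp: a_def s_def)
      then show ?thesis using v(2) by simp
    qed
    have "t' / 12 * (real k * (ln (real p) / real n)) \<le> r\<^sup>2"
    proof -
      have "real k * (t' * ln (real p)) \<le> (3 * real s) * (t' * ln (real p))"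
        using s(3) t' lnp by (intro mult_right_mono) auto
      then show ?thesis unfolding r2 using n by (simp add: field_simps)
    qed
    then have "M\<^sub>2 * (t' / 12 * (real k * (ln (real p) / real n))) * (\<delta> * l2 \<xi>) * \<eta> \<le> M\<^sub>2 * r\<^sup>2 * \<bar>\<xi> \<bullet> vec p v\<bar> * \<eta>"
      using v(4) assms(2) \<eta>(1) \<delta> by (intro mult_right_mono mult_mono mult_left_mono) (auto simp: l2_def)
    then have "ennreal (M\<^sub>2 * \<delta> * \<eta> * (t' / 12) * l2 \<xi> * (real k * (ln (real p) / real n)))
        \<le> ennreal (M\<^sub>2 * r\<^sup>2 * \<bar>\<xi> \<bullet> vec p v\<bar> * (1 - 2 * \<alpha> - \<eta>))"
      unfolding \<eta>(2) by (intro ennreal_leI) (simp add: mult_ac)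
    also have "\<dots> \<le> minimax_length n p \<alpha> (Theta M\<^sub>1 M\<^sub>2 p k\<^sub>1) (Theta M\<^sub>1 M\<^sub>2 p k) (\<lambda>\<beta>. \<xi> \<bullet> \<beta>)"
      using \<eta> assms(7)
      by (intro minimax_length_ge_sparse[OF X(2) assms(1,2) v(1) X(3) v(3) s(1) B1 BR \<rho>(1) r_def rM a sp0 k1 sp1 \<eta>(1) _ _ small]) auto
    finally show "ennreal (M\<^sub>2 * \<delta> * \<eta> * (t' / 12) * l2 \<xi> * (real k * (ln (real p) / real n)))
      \<le> minimax_length n p \<alpha> (Theta M\<^sub>1 M\<^sub>2 p k\<^sub>1) (Theta M\<^sub>1 M\<^sub>2 p k) (\<lambda>\<beta>. \<xi> \<bullet> \<beta>)" .
  qed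
qed

(* The bound k <= c min {p^gamma, n / log p} is written as its two halves, the second one
   multiplied out: for p = 1, where log p = 0, it is then no constraint, whereas n / 0 = 0
   would exclude this case.
   The pair (k1, k) = (0, 1) has to be left out.  There, for xi = e_1, the convex hull of 0
   and of the interval from the regression of y on its first covariate covers beta_1 over
   Theta(1), and at beta = 0 its expected length is of order 1 / sqrt n, so that no bound of
   order log p / n holds. *)
theorem theorem2:
  fixes M\<^sub>1 M\<^sub>2 cb C c \<gamma> \<alpha> :: real
  assumes "M\<^sub>1 > 1" and "M\<^sub>2 > 0" and "cb \<ge> 1" and "C > 0" and "c > 0"
    and "0 \<le> \<gamma>" and "\<gamma> < 1 / 2" and "0 < \<alpha>" and "\<alpha> < 1 / 2"
  shows "\<exists>c\<^sub>1>0. \<forall>(n::nat) (p::nat) (k\<^sub>1::nat) (k::nat) (q::nat) (\<xi>::real vec).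
    n \<ge> 1 \<longrightarrow>
    \<xi> \<in> Xi p q cb \<longrightarrow> real q \<le> C * real k \<longrightarrow>
    k\<^sub>1 \<le> k \<longrightarrow> (k\<^sub>1, k) \<noteq> (0, 1) \<longrightarrow>
    real k \<le> c * real p powr \<gamma> \<longrightarrow> real k * ln (real p) \<le> c * real n \<longrightarrow>
    ennreal (c\<^sub>1 * l2 \<xi> * (1 / sqrt (real n) + real k * (ln (real p) / real n)))
      \<le> minimax_length n p \<alpha> (Theta M\<^sub>1 M\<^sub>2 p k\<^sub>1) (Theta M\<^sub>1 M\<^sub>2 p k) (\<lambda>\<beta>. \<xi> \<bullet> \<beta>)"
proof -
  obtain c\<^sub>a where ca: "0 < c\<^sub>a" and A: "\<And>n p k\<^sub>1 k q \<xi>. n \<ge> 1 \<Longrightarrow> \<xi> \<in> Xi p q cb \<Longrightarrow> real q \<le> C * real k \<Longrightarrow>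
    ennreal (c\<^sub>a * l2 \<xi> * (1 / sqrt (real n)))
      \<le> minimax_length n p \<alpha> (Theta M\<^sub>1 M\<^sub>2 p k\<^sub>1) (Theta M\<^sub>1 M\<^sub>2 p k) (\<lambda>\<beta>. \<xi> \<bullet> \<beta>)"
    using parametric_rate[OF assms(1-4,9)] by blast
  obtain c\<^sub>b P where cb: "0 < c\<^sub>b" "2 \<le> P" and B: "\<And>n p k\<^sub>1 k q \<xi>. n \<ge> 1 \<Longrightarrow> P \<le> p \<Longrightarrow> \<xi> \<in> Xi p q cb \<Longrightarrow>
    real q \<le> C * real k \<Longrightarrow> k\<^sub>1 \<le> k \<Longrightarrow> (k\<^sub>1, k) \<noteq> (0, 1) \<Longrightarrow>
    real k \<le> c * real p powr \<gamma> \<Longrightarrow> real k * ln (real p) \<le> c * real n \<Longrightarrow>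
    ennreal (c\<^sub>b * l2 \<xi> * (real k * (ln (real p) / real n)))
      \<le> minimax_length n p \<alpha> (Theta M\<^sub>1 M\<^sub>2 p k\<^sub>1) (Theta M\<^sub>1 M\<^sub>2 p k) (\<lambda>\<beta>. \<xi> \<bullet> \<beta>)"
    using sparse_rate[OF assms(1-5,7,9)] by blast
  \<comment> \<open>below \<open>P\<close> both \<open>k\<close> and \<open>log p\<close> are bounded, and the parametric rate dominates\<close>
  define K where "K = c * real P * real P"
  have K: "0 \<le> K" using assms(5) by (simp add: K_def)
  define c\<^sub>1 where "c\<^sub>1 = min (c\<^sub>a / (1 + K)) (min c\<^sub>a c\<^sub>b / 2)"
  have c1: "0 < c\<^sub>1" "c\<^sub>1 * (1 + K) \<le> c\<^sub>a" "2 * c\<^sub>1 \<le> c\<^sub>a" "2 * c\<^sub>1 \<le> c\<^sub>b"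
  proof -
    show "0 < c\<^sub>1" using ca cb K by (simp add: c\<^sub>1_def)
    have "c\<^sub>1 \<le> c\<^sub>a / (1 + K)" by (simp add: c\<^sub>1_def)
    then show "c\<^sub>1 * (1 + K) \<le> c\<^sub>a" using K by (simp add: pos_le_divide_eq)
    have "c\<^sub>1 \<le> min c\<^sub>a c\<^sub>b / 2" unfolding c\<^sub>1_def by (rule min.cobounded2)
    then show "2 * c\<^sub>1 \<le> c\<^sub>a" "2 * c\<^sub>1 \<le> c\<^sub>b" by simp_all
  qed
  show ?thesis
  proof (intro exI[of _ c\<^sub>1] conjI allI impI c1(1))
    fix n p k\<^sub>1 k q :: nat and \<xi> :: "real vec"
    assume n: "1 \<le> n" and \<xi>: "\<xi> \<in> Xi p q cb" and q: "real q \<le> C * real k"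
      and k1: "k\<^sub>1 \<le> k" and ne: "(k\<^sub>1, k) \<noteq> (0, 1)"
      and kp: "real k \<le> c * real p powr \<gamma>" and kn: "real k * ln (real p) \<le> c * real n"
    let ?L = "minimax_length n p \<alpha> (Theta M\<^sub>1 M\<^sub>2 p k\<^sub>1) (Theta M\<^sub>1 M\<^sub>2 p k) (\<lambda>\<beta>. \<xi> \<bullet> \<beta>)"
    let ?x = "1 / sqrt (real n)" and ?y = "real k * (ln (real p) / real n)"
    note LA = A[OF n \<xi> q, of k\<^sub>1]
    have p1: "1 \<le> p" using Xi_nonempty_support(2)[OF \<xi>] by simp
    have xy: "0 \<le> ?x" "0 \<le> ?y" using p1 by simp_all
    have l2: "0 \<le> l2 \<xi>" by (simp add: l2_def)
    show "ennreal (c\<^sub>1 * l2 \<xi> * (?x + ?y)) \<le> ?L"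
    proof (cases "?y \<le> K * ?x \<or> ?y \<le> ?x")
      case True
      then have "c\<^sub>1 * (?x + ?y) \<le> c\<^sub>a * ?x"
      proof
        assume "?y \<le> K * ?x"
        then have "c\<^sub>1 * (?x + ?y) \<le> c\<^sub>1 * ((1 + K) * ?x)"
          using c1(1) unfolding distrib_right[of 1 K] mult_1 by (intro mult_left_mono add_left_mono) auto
        also have "\<dots> \<le> c\<^sub>a * ?x" using mult_right_mono[OF c1(2) xy(1)] by (simp only: mult.assoc)
        finally show ?thesis .
      next
        assume "?y \<le> ?x"
        then have "c\<^sub>1 * (?x + ?y) \<le> c\<^sub>1 * (2 * ?x)" using c1(1) by (intro mult_left_mono) auto
        also have "\<dots> \<le> c\<^sub>a * ?x" using mult_right_mono[OF c1(3) xy(1)] by (simp only: mult_ac)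
        finally show ?thesis .
      qed
      from mult_right_mono[OF this l2] have "c\<^sub>1 * l2 \<xi> * (?x + ?y) \<le> c\<^sub>a * l2 \<xi> * ?x"
        by (simp only: mult_ac)
      then show ?thesis using LA by (meson ennreal_leI order_trans)
    next
      case False
      have "P \<le> p"
      proof (rule ccontr)
        assume "\<not> P \<le> p"
        then have pP: "real p \<le> real P" by simp
        have "real p powr \<gamma> \<le> real p powr 1" using p1 assms(7) by (intro powr_mono) auto
        then have "c * real p powr \<gamma> \<le> c * real P" using p1 pP assms(5) by (intro mult_left_mono) auto
        then have "real k \<le> c * real P" using kp by linarith
        moreover have "ln (real p) \<le> real P" using ln_le_minus_one[of "real p"] p1 pP by simp
        ultimately have "real k * ln (real p) \<le> c * real P * real P"
          using p1 assms(5) by (intro mult_mono) auto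
        then have "?y \<le> K * (1 / real n)" using n by (simp add: K_def divide_right_mono)
        also have "1 / real n \<le> ?x"
        proof -
          have "1 \<le> sqrt (real n)" using n by simp
          then have "sqrt (real n) * 1 \<le> sqrt (real n) * sqrt (real n)" by (intro mult_left_mono) auto
          then show ?thesis using n by (intro divide_left_mono) auto
        qed
        then have "K * (1 / real n) \<le> K * ?x" using K by (rule mult_left_mono)
        finally show False using False by simp
      qed
      note LB = B[OF n this \<xi> q k1 ne kp kn]
      have "?x \<le> ?y" using False by (meson nle_le)
      then have "?x + ?y \<le> 2 * ?y" unfolding mult_2 by (rule add_right_mono)
      then have "c\<^sub>1 * (?x + ?y) \<le> c\<^sub>1 * (2 * ?y)" using c1(1) by (intro mult_left_mono) auto
      also have "\<dots> \<le> c\<^sub>b * ?y" using mult_right_mono[OF c1(4) xy(2)] by (simp only: mult_ac)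
      finally have "c\<^sub>1 * (?x + ?y) \<le> c\<^sub>b * ?y" .
      from mult_right_mono[OF this l2] have "c\<^sub>1 * l2 \<xi> * (?x + ?y) \<le> c\<^sub>b * l2 \<xi> * ?y"
        by (simp only: mult_ac)
      then show ?thesis using LB by (meson ennreal_leI order_trans)
    qed
  qed
qed

end
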